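(* Let $\mathbb{G}$ be a coloured ribbon graph and let $e$ be an edge of $\mathbb{G}$. Then $(\mathbb{G}^* )^*=\mathbb{G}$, $(\mathbb{G}/e)^*=(\mathbb{G}^* )\backslash e$, and $(\mathbb{G}\backslash e)^*=(\mathbb{G}^* )/e$, as coloured ribbon graphs (up to equivalence).
   Context: A ribbon graph $\mathbb{G}=(V(\mathbb{G}),E(\mathbb{G}))$ is a surface with boundary represented as the union of two finite sets of closed discs, vertices and edges, such that vertices and edges intersect in disjoint line segments, each lying on the boundary of precisely one vertex and one edge, and each edge contains exactly two such segments. $F(\mathbb{G})$ is its set of boundary components. Ribbon graphs are considered up to homeomorphisms preserving vertices and edges (orientation preserving when orientable). An edge is a loop if it meets one vertex; a loop is non-orientable if its union with its vertex is a Möbius band, orientable otherwise. Deletion $\mathbb{G}\backslash e$ removes the edge $e$. Contraction $\mathbb{G}/e$: with $u,v$ the (not necessarily distinct) vertices incident with $e$, regard the boundary components of $e\cup u\cup v$ as curves on $\mathbb{G}$, glue a disc along each (these become new vertices) and remove $e,u,v$; a non-loop's ends merge into one vertex, a non-orientable loop's vertex is replaced by one vertex, an orientable loop's vertex by two vertices, and boundary components are unchanged. The geometric dual $\mathbb{G}^*$ is obtained by capping off each boundary component of $\mathbb{G}$ with a disc; these discs form $V(\mathbb{G}^* )$ and $\mathbb{G}^*=(V(\mathbb{G}^* ),E(\mathbb{G}))$. This gives natural bijections between $V(\mathbb{G})$ and $F(\mathbb{G}^* )$ and between $F(\mathbb{G})$ and $V(\mathbb{G}^* )$. A coloured ribbon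 graph is a ribbon graph with a partition of $V(\mathbb{G})$ into vertex colour classes and a partition of $F(\mathbb{G})$ into boundary colour classes, up to equivalences preserving both partitions. Contraction of $e$ in a coloured ribbon graph: boundary classes unchanged; if distinct ends $u,v$ merge into $p$, the classes of $u,v$ merge into $([u]\cup[v]\cup\{p\})\setminus\{u,v\}$; if $e$ is a non-orientable loop at $u$ producing $p$, $p$ replaces $u$ in its class; if $e$ is an orientable loop at $u$ producing $p,q$, both replace $u$ in its class; other vertices keep their classes. Deletion of $e$: vertex classes unchanged; if $e$ meets two distinct boundary components $a,b$ that merge into $r$, their classes merge into $([a]\cup[b]\cup\{r\})\setminus\{a,b\}$; if $e$ meets one boundary component $a$ and one component $r$ results in its place, $r$ replaces $a$ in its class; if two components $r,s$ result, both replace $a$ in its class; other boundary components keep their classes. The dual of a coloured ribbon graph $\mathbb{G}$ is the ribbon graph $\mathbb{G}^*$ whose vertex colouring is induced from the boundary colouring of $\mathbb{G}$ and whose boundary colouring is induced from the vertex colouring of $\mathbb{G}$, via the bijections above. *)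

theory Defs
  imports "HOL-Analysis.Analysis"
begin

definition half_plane :: "complex set" where
  "half_plane = {z. 0 \<le> Im z}"

definition surface_with_boundary :: "'a topology \<Rightarrow> bool" where
  "surface_with_boundary X \<longleftrightarrow>
     Hausdorff_space X \<and> second_countable X \<and>
     (\<forall>x\<in>topspace X. \<exists>U T. openin X U \<and> x \<in> U \<and>
        openin (top_of_set half_plane) T \<and> subtopology X U homeomorphic_space top_of_set T)"

text \<open>The intrinsic (manifold) boundary: the points that have no planar neighbourhood.
  For \<^term>\<open>D\<close> a closed disc in \<^term>\<open>X\<close>,
  \<^term>\<open>surface_boundary (subtopology X D)\<close> is its boundary circle.\<close>

definition surface_boundary :: "'a topology \<Rightarrow> 'a set" where
  "surface_boundary X =
     {x \<in> topspace X. \<not> (\<exists>U T. openin X U \<and> x \<in> U \<and>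
        open (T :: complex set) \<and> subtopology X U homeomorphic_space top_of_set T)}"

definition boundary_curves :: "'a topology \<Rightarrow> 'a set set" where
  "boundary_curves X = connected_components_of (subtopology X (surface_boundary X))"

definition closed_disc_in :: "'a topology \<Rightarrow> 'a set \<Rightarrow> bool" where
  "closed_disc_in X D \<longleftrightarrow>
     D \<subseteq> topspace X \<and> subtopology X D homeomorphic_space top_of_set (cball (0::complex) 1)"

definition line_segment_in :: "'a topology \<Rightarrow> 'a set \<Rightarrow> bool" where
  "line_segment_in X s \<longleftrightarrow>
     s \<subseteq> topspace X \<and> subtopology X s homeomorphic_space top_of_set {0..1::real}"

record 'a ribbon_graph =
  surface :: "'a topology"
  vertices :: "'a set set"
  edges :: "'a set set"

text \<open>The line segments in which vertices and edges intersect. As the segments are required to be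
  disjoint, they are the connected components of the intersections of a vertex with an edge.\<close>

definition segments :: "'a ribbon_graph \<Rightarrow> 'a set set" where
  "segments G = (\<Union>v\<in>vertices G. \<Union>e\<in>edges G.
     connected_components_of (subtopology (surface G) (v \<inter> e)))"

definition is_ribbon_graph :: "'a ribbon_graph \<Rightarrow> bool" where
  "is_ribbon_graph G \<longleftrightarrow>
     surface_with_boundary (surface G) \<and>
     finite (vertices G) \<and> finite (edges G) \<and>
     topspace (surface G) = \<Union>(vertices G) \<union> \<Union>(edges G) \<and>
     (\<forall>D \<in> vertices G \<union> edges G. closed_disc_in (surface G) D) \<and>
     pairwise disjnt (vertices G) \<and> pairwise disjnt (edges G) \<and>
     (\<forall>s\<in>segments G. line_segment_in (surface G) s \<and>
        (\<exists>!v. v \<in> vertices G \<and> s \<subseteq> surface_boundary (subtopology (surface G) v)) \<and>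
        (\<exists>!e. e \<in> edges G \<and> s \<subseteq> surface_boundary (subtopology (surface G) e))) \<and>
     (\<forall>e\<in>edges G. card {s \<in> segments G. s \<subseteq> e} = 2)"

definition boundary_components :: "'a ribbon_graph \<Rightarrow> 'a set set" where
  "boundary_components G = boundary_curves (surface G)"

definition ends :: "'a ribbon_graph \<Rightarrow> 'a set \<Rightarrow> 'a set set" where
  "ends G e = {v \<in> vertices G. v \<inter> e \<noteq> {}}"

text \<open>Gluing a disc to \<open>X\<close> along each curve in a set \<open>S\<close>: the quotient of the disjoint union of
  \<open>X\<close> and one closed unit disc for every \<open>c \<in> S\<close>, in which the boundary circle of the disc of
  \<open>c\<close> is identified with \<open>c\<close> by a homeomorphism. A point of the quotient is represented by
  \<open>Base x\<close> if it comes from a point \<open>x\<close> of \<open>X\<close>, and by \<open>Disc c z\<close> with \<open>norm z < 1\<close> if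
  it is an interior point of the disc glued along \<open>c\<close>. Another choice of the
  attaching homeomorphism gives a space that is homeomorphic relative to \<open>X\<close>.\<close>

datatype 'a glued = Base 'a | Disc "'a set" complex

definition attaching_map :: "'a topology \<Rightarrow> 'a set \<Rightarrow> complex \<Rightarrow> 'a" where
  "attaching_map X c =
     (SOME h. homeomorphic_map (top_of_set (sphere (0::complex) 1)) (subtopology X c) h)"

definition disc_map :: "'a topology \<Rightarrow> 'a set \<Rightarrow> complex \<Rightarrow> 'a glued" where
  "disc_map X c z = (if norm z < 1 then Disc c z else Base (attaching_map X c z))"

definition glued_disc :: "'a topology \<Rightarrow> 'a set \<Rightarrow> 'a glued set" where
  "glued_disc X c = disc_map X c ` cball 0 1"

definition glue_open :: "'a topology \<Rightarrow> 'a set set \<Rightarrow> 'a glued set \<Rightarrow> bool" where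
  "glue_open X S U \<longleftrightarrow>
     U \<subseteq> Base ` topspace X \<union> {Disc c z | c z. c \<in> S \<and> norm z < 1} \<and>
     openin X {x \<in> topspace X. Base x \<in> U} \<and>
     (\<forall>c\<in>S. openin (top_of_set (cball 0 1)) {z \<in> cball 0 1. disc_map X c z \<in> U})"

definition glue_discs :: "'a topology \<Rightarrow> 'a set set \<Rightarrow> 'a glued topology" where
  "glue_discs X S = topology (glue_open X S)"

lemma openin_glue_discs: "openin (glue_discs X S) = glue_open X S"
proof -
  have inter: "glue_open X S (U \<inter> V)" if U: "glue_open X S U" and V: "glue_open X S V" for U V
  proof -
    have 1: "{x \<in> topspace X. Base x \<in> U \<inter> V} =
        {x \<in> topspace X. Base x \<in> U} \<inter> {x \<in> topspace X. Base x \<in> V}" by auto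
    have 2: "{z \<in> cball 0 1. disc_map X c z \<in> U \<inter> V} =
        {z \<in> cball 0 1. disc_map X c z \<in> U} \<inter> {z \<in> cball 0 1. disc_map X c z \<in> V}" for c by auto
    show ?thesis
      using U V unfolding glue_open_def 1 2 by (auto intro!: openin_Int)
  qed
  have union: "glue_open X S (\<Union>K)" if K: "\<forall>U\<in>K. glue_open X S U" for K
  proof -
    have 1: "{x \<in> topspace X. Base x \<in> \<Union>K} = (\<Union>U\<in>K. {x \<in> topspace X. Base x \<in> U})" by auto
    have 2: "{z \<in> cball 0 1. disc_map X c z \<in> \<Union>K} =
        (\<Union>U\<in>K. {z \<in> cball 0 1. disc_map X c z \<in> U})" for c by auto
    have "\<Union>K \<subseteq> Base ` topspace X \<union> {Disc c z | c z. c \<in> S \<and> norm z < 1}"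
      using K unfolding glue_open_def by blast
    then show ?thesis
      using K unfolding glue_open_def 1 2 by (auto intro!: openin_Union)
  qed
  have "istopology (glue_open X S)"
    unfolding istopology_def using inter union by blast
  then show ?thesis
    by (simp add: glue_discs_def topology_inverse')
qed

definition delete_edge :: "'a ribbon_graph \<Rightarrow> 'a set \<Rightarrow> 'a ribbon_graph" where
  "delete_edge G e =
     \<lparr>surface = subtopology (surface G) (\<Union>(vertices G) \<union> \<Union>(edges G - {e})),
      vertices = vertices G,
      edges = edges G - {e}\<rparr>"

definition contraction_curves :: "'a ribbon_graph \<Rightarrow> 'a set \<Rightarrow> 'a set set" where
  "contraction_curves G e = boundary_curves (subtopology (surface G) (e \<union> \<Union>(ends G e)))"

text \<open>After gluing, removing \<open>e\<close> and its ends leaves exactly the union of the remaining vertices,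
  the remaining edges and the glued discs; the latter contain the curves themselves.\<close>

definition contract_edge :: "'a ribbon_graph \<Rightarrow> 'a set \<Rightarrow> 'a glued ribbon_graph" where
  "contract_edge G e =
     (let C = contraction_curves G e;
          V = (`) Base ` (vertices G - ends G e) \<union> glued_disc (surface G) ` C;
          E = (`) Base ` (edges G - {e})
      in \<lparr>surface = subtopology (glue_discs (surface G) C) (\<Union>V \<union> \<Union>E),
          vertices = V,
          edges = E\<rparr>)"

definition geometric_dual :: "'a ribbon_graph \<Rightarrow> 'a glued ribbon_graph" where
  "geometric_dual G =
     (let F = boundary_components G;
          V = glued_disc (surface G) ` F;
          E = (`) Base ` edges G
      in \<lparr>surface = subtopology (glue_discs (surface G) F) (\<Union>V \<union> \<Union>E),
          vertices = V,
          edges = E\<rparr>)"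

record 'a coloured_ribbon_graph =
  underlying :: "'a ribbon_graph"
  vertex_classes :: "'a set set set"
  boundary_classes :: "'a set set set"

definition is_coloured_ribbon_graph :: "'a coloured_ribbon_graph \<Rightarrow> bool" where
  "is_coloured_ribbon_graph G \<longleftrightarrow>
     is_ribbon_graph (underlying G) \<and>
     partition_on (vertices (underlying G)) (vertex_classes G) \<and>
     partition_on (boundary_components (underlying G)) (boundary_classes G)"

text \<open>The classes of the elements of \<open>old\<close> are merged, and in the merged class \<open>old\<close> is replaced by
  \<open>new\<close>; all other classes are kept. If \<open>old\<close> is a single element this is replacement within its
  class, and if \<open>old = {a, b}\<close> and \<open>new = {r}\<close> the new class is
  \<open>([a] \<union> [b] \<union> {r}) - {a, b}\<close>. So all the cases of contraction and deletion
  are instances.\<close>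

definition recolour :: "'b set set \<Rightarrow> 'b set \<Rightarrow> 'b set \<Rightarrow> 'b set set" where
  "recolour P old new =
     insert ((\<Union>{C \<in> P. C \<inter> old \<noteq> {}} - old) \<union> new) {C \<in> P. C \<inter> old = {}}"

definition base_classes :: "'a set set set \<Rightarrow> 'a glued set set set" where
  "base_classes P = (`) ((`) Base) ` P"

text \<open>A boundary component is affected by the deletion of \<open>e\<close> iff it meets \<open>e\<close>; the boundary
  components that arise in its place are those that contain points of (the segments of) \<open>e\<close>.\<close>

definition cdelete :: "'a coloured_ribbon_graph \<Rightarrow> 'a set \<Rightarrow> 'a coloured_ribbon_graph" where
  "cdelete G e =
     (let H = delete_edge (underlying G) e
      in \<lparr>underlying = H,
          vertex_classes = vertex_classes G,
          boundary_classes = recolour (boundary_classes G)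
            {a \<in> boundary_components (underlying G). a \<inter> e \<noteq> {}}
            {r \<in> boundary_components H. r \<inter> e \<noteq> {}}\<rparr>)"

text \<open>Contraction does not change the boundary components, even as point sets.\<close>

definition ccontract :: "'a coloured_ribbon_graph \<Rightarrow> 'a set \<Rightarrow> 'a glued coloured_ribbon_graph" where
  "ccontract G e =
     (let K = underlying G
      in \<lparr>underlying = contract_edge K e,
          vertex_classes = recolour (base_classes (vertex_classes G))
            ((`) Base ` ends K e) (glued_disc (surface K) ` contraction_curves K e),
          boundary_classes = base_classes (boundary_classes G)\<rparr>)"

text \<open>A boundary component \<open>c\<close> corresponds to the vertex of the dual that is glued along \<open>c\<close>, and a
  vertex \<open>v\<close> to the boundary component of the dual that is the boundary circle of \<open>v\<close>.\<close>

definition cdual :: "'a coloured_ribbon_graph \<Rightarrow> 'a glued coloured_ribbon_graph" where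
  "cdual G =
     (let X = surface (underlying G)
      in \<lparr>underlying = geometric_dual (underlying G),
          vertex_classes = (`) (glued_disc X) ` boundary_classes G,
          boundary_classes =
            (`) (\<lambda>v. Base ` surface_boundary (subtopology X v)) ` vertex_classes G\<rparr>)"

text \<open>Equivalence: a homeomorphism that preserves vertices, edges and both partitions. A ribbon graph
  carries no chosen orientation, only the property of being orientable or not, and a homeomorphism
  between orientable surfaces takes any orientation of the first to an orientation of the
  second. Hence asking it to be orientation preserving in the orientable case, for some
  orientations of the two surfaces, is no further condition.\<close>

definition equivalent :: "'a coloured_ribbon_graph \<Rightarrow> 'b coloured_ribbon_graph \<Rightarrow> bool"
    (infix \<open>\<cong>\<^sub>c\<close> 50) where
  "G \<cong>\<^sub>c H \<longleftrightarrow>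
     (\<exists>\<phi>. homeomorphic_map (surface (underlying G)) (surface (underlying H)) \<phi> \<and>
          (`) \<phi> ` vertices (underlying G) = vertices (underlying H) \<and>
          (`) \<phi> ` edges (underlying G) = edges (underlying H) \<and>
          (`) ((`) \<phi>) ` vertex_classes G = vertex_classes H \<and>
          (`) ((`) \<phi>) ` boundary_classes G = boundary_classes H)"

end

theory Submission
  imports Defs
begin

text \<open>
  A ribbon graph is determined by its one-dimensional skeleton: the boundary circles of the
  vertices together with the edge discs, each edge meeting the circles in two disjoint arcs of its
  rim. Replacing, for every edge, these two arcs by the two complementary arcs of the rim turns the
  vertex circles into the boundary circles of the surface. This operation is an involution and
  can be carried out one edge at a time. Dualising performs it at all edges, contracting \<open>e\<close> performs
  it at \<open>e\<close> and then forgets \<open>e\<close>, and deleting \<open>e\<close> just forgets \<open>e\<close>. So both sides of each claim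
  come from the same skeleton with the same partitions of circles. Finally, a homeomorphism between
  the boundary circles of two discs extends radially to the discs, so that a skeleton determines the
  ribbon graph up to equivalence.

  Everything takes place in the surface of the given graph: the iterated graphs are described by an
  embedding of their skeleton.
\<close>

section \<open>Discs and the boundary of a surface\<close>

text \<open>The overview takes for granted that the boundary circles of a skeleton are the boundary
  of the surface; most of the topology goes into this. The boundary is intrinsic, made of the points
  without a planar neighbourhood, and has to be computed again after discs are glued in. A point of
  a single disc is decided by invariance of domain. An inner point of an arc shared by a vertex and
  an edge needs a chart built from both discs. At the corners, where such an arc ends, no chart is
  inspected: the boundary is closed and the corners are limits of free rim points.

  A second obstacle is that the components of the resulting set must be circles, which would usually
  follow from the classification of compact 1-manifolds. Here it is combinatorial: cutting circles
  at two arcs and regluing along two others leaves a short list of ways to match four points.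

  Finally, gluing changes the type of points, so the two sides of every claim have different types.
  Embeddings of one common skeleton make them comparable without any map between iterated
  gluings.\<close>

definition parametrizes :: "'a topology \<Rightarrow> 'c::t2_space set \<Rightarrow> ('c \<Rightarrow> 'a) \<Rightarrow> 'a set \<Rightarrow> bool" where
  "parametrizes X S h D \<longleftrightarrow> continuous_map (top_of_set S) X h \<and> inj_on h S \<and> h ` S = D"

lemma subtopology_subtopology_subset:
  "T \<subseteq> S \<Longrightarrow> subtopology (subtopology X S) T = subtopology X T"
  by (simp add: subtopology_subtopology inf.absorb2)

lemma openin_subtopology_subset:
  "openin (subtopology X S) U \<Longrightarrow> U \<subseteq> T \<Longrightarrow> T \<subseteq> S \<Longrightarrow> openin (subtopology X T) U"
  by (auto simp: openin_subtopology)

lemma parametrizes_subset_topspace: "parametrizes X S h D \<Longrightarrow> D \<subseteq> topspace X"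
  unfolding parametrizes_def
  by (metis continuous_map_image_subset_topspace topspace_euclidean_subtopology)

lemma parametrizes_subset:
  "parametrizes X S h D \<Longrightarrow> T \<subseteq> S \<Longrightarrow> parametrizes X T h (h ` T)"
  unfolding parametrizes_def
  by (metis continuous_map_from_subtopology_mono inj_on_subset)

text \<open>A continuous injection of a compact space into a Hausdorff space is an embedding. Hence
  \<open>parametrizes\<close> can leave the inverse out, and it is easily pushed forward along an
  injective continuous map.\<close>

lemma parametrizes_homeomorphic_map:
  assumes "Hausdorff_space X" "compact S" "parametrizes X S h D"
  shows "homeomorphic_map (top_of_set S) (subtopology X D) h"
proof (rule continuous_imp_homeomorphic_map)
  show "compact_space (top_of_set S)"
    using assms(2) by (simp add: compact_space_subtopology)
  show "Hausdorff_space (subtopology X D)"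
    using assms(1) by (rule Hausdorff_space_subtopology)
  show "continuous_map (top_of_set S) (subtopology X D) h"
    using assms(3) unfolding parametrizes_def continuous_map_in_subtopology by auto
  show "h ` topspace (top_of_set S) = topspace (subtopology X D)"
    using assms(3) parametrizes_subset_topspace[OF assms(3)] unfolding parametrizes_def by auto
  show "inj_on h (topspace (top_of_set S))"
    using assms(3) unfolding parametrizes_def by simp
qed

lemma homeomorphic_map_parametrizes:
  assumes "homeomorphic_map (top_of_set S) (subtopology X D) h" "D \<subseteq> topspace X"
  shows "parametrizes X S h D"
proof -
  have "continuous_map (top_of_set S) (subtopology X D) h" "inj_on h S" "h ` S = D"
    using assms homeomorphic_imp_continuous_map homeomorphic_imp_injective_map
      homeomorphic_imp_surjective_map by fastforce+
  then show ?thesis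
    unfolding parametrizes_def continuous_map_in_subtopology by auto
qed

lemma homeomorphic_space_iff_parametrizes:
  assumes "Hausdorff_space X" "compact S"
  shows "D \<subseteq> topspace X \<and> subtopology X D homeomorphic_space top_of_set S \<longleftrightarrow>
    (\<exists>h. parametrizes X S h D)" (is "?L \<longleftrightarrow> ?R")
proof
  assume L: ?L
  then obtain h where "homeomorphic_map (top_of_set S) (subtopology X D) h"
    using homeomorphic_space homeomorphic_space_sym by blast
  then show ?R using homeomorphic_map_parametrizes L by blast
next
  assume ?R
  then obtain h where h: "parametrizes X S h D" by blast
  then show ?L
    using parametrizes_homeomorphic_map[OF assms h] homeomorphic_space homeomorphic_space_sym
      parametrizes_subset_topspace by blast
qed

lemma parametrizes_compactin:
  assumes "parametrizes X S h D" "compact S"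
  shows "compactin X D"
  using assms image_compactin[of "top_of_set S" S X h] unfolding parametrizes_def
  by (metis compactin_subtopology compactin_euclidean_iff order_refl)

lemma parametrizes_closedin:
  assumes "Hausdorff_space X" "parametrizes X S h D" "compact S"
  shows "closedin X D"
  using assms parametrizes_compactin compactin_imp_closedin by blast

lemma parametrizes_connectedin:
  assumes "parametrizes X S h D" "connected S"
  shows "connectedin X D"
  using assms connectedin_continuous_map_image[of "top_of_set S" X h S] unfolding parametrizes_def
  by (metis connectedin_subtopology connectedin_iff_connected order_refl)

lemma parametrizes_inverse:
  assumes "Hausdorff_space X" "compact S" "parametrizes X S h D"
  obtains k where "continuous_map (subtopology X D) (top_of_set S) k"
    "\<And>z. z \<in> S \<Longrightarrow> k (h z) = z" "\<And>x. x \<in> D \<Longrightarrow> h (k x) = x" "k ` D = S"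
proof -
  obtain k where k: "homeomorphic_maps (top_of_set S) (subtopology X D) h k"
    using parametrizes_homeomorphic_map[OF assms] homeomorphic_map_maps by blast
  have D: "D \<subseteq> topspace X" "h ` S = D"
    using assms(3) parametrizes_subset_topspace parametrizes_def by metis+
  have 1: "continuous_map (subtopology X D) (top_of_set S) k"
    "\<And>z. z \<in> S \<Longrightarrow> k (h z) = z" "\<And>x. x \<in> D \<Longrightarrow> h (k x) = x"
    using k D unfolding homeomorphic_maps_def by auto
  moreover have "k ` D = S"
    using 1(2) D(2) by force
  ultimately show thesis using that by blast
qed

text \<open>Compactness of the preimage makes the restriction of \<open>h\<close> to it a homeomorphism.\<close>

lemma connected_compact_preimage:
  fixes S :: "'c::t2_space set"
  assumes X: "Hausdorff_space X" and h: "continuous_map (top_of_set S) X h" and S: "compact S"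
    and inj: "inj_on h {z\<in>S. h z \<in> s}" and s: "s \<subseteq> h ` S" "compactin X s" "connectedin X s"
  shows "compact {z\<in>S. h z \<in> s}" "connected {z\<in>S. h z \<in> s}"
proof -
  let ?Z = "{z\<in>S. h z \<in> s}"
  have "closedin X s" using X s compactin_imp_closedin by blast
  then have "closedin (top_of_set S) ?Z"
    using h closedin_continuous_map_preimage by fastforce
  then show Z: "compact ?Z"
    using S closedin_compact by blast
  have "continuous_map (top_of_set ?Z) X h"
    by (rule continuous_map_from_subtopology_mono[OF h]) auto
  then have p: "parametrizes X ?Z h s"
    using inj s unfolding parametrizes_def by auto
  have "homeomorphic_map (top_of_set ?Z) (subtopology X s) h"
    using parametrizes_homeomorphic_map[OF X Z p] .
  moreover have "connected_space (subtopology X s)"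
    using s by (simp add: connectedin_def)
  ultimately have "connected_space (top_of_set ?Z)"
    using homeomorphic_connected_space homeomorphic_space by blast
  then have "connectedin euclidean ?Z"
    by (simp add: connectedin_def)
  then show "connected ?Z"
    by (simp add: connectedin_iff_connected)
qed

text \<open>The restriction of the embedding \<open>h\<close> to the open set \<open>T\<close> is a
  planar chart. It serves with a disc for \<open>R\<close>, and later with a rectangle spread over
  two discs.\<close>

lemma open_chart_not_boundary:
  fixes h :: "complex \<Rightarrow> 'a"
  assumes X: "Hausdorff_space X" and h: "parametrizes X R h E" and R: "compact R"
    and T: "open T" "T \<subseteq> R" "openin X (h ` T)" and x: "x \<in> h ` T"
  shows "x \<notin> surface_boundary X"
proof -
  have hom: "homeomorphic_map (top_of_set R) (subtopology X E) h"
    using parametrizes_homeomorphic_map[OF X R h] .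
  have EX: "E \<subseteq> topspace X" using parametrizes_subset_topspace[OF h] .
  have hR: "h ` R = E" using h by (simp add: parametrizes_def)
  have TE: "h ` T \<subseteq> E" using hR T(2) by blast
  have "homeomorphic_map (subtopology (top_of_set R) T) (subtopology (subtopology X E) (h ` T)) h"
    by (rule homeomorphic_map_subtopologies[OF hom]) (use T(2) TE EX in auto)
  moreover have "subtopology (top_of_set R) T = top_of_set T"
    by (rule subtopology_subtopology_subset[OF T(2)])
  moreover have "subtopology (subtopology X E) (h ` T) = subtopology X (h ` T)"
    by (rule subtopology_subtopology_subset[OF TE])
  ultimately have "homeomorphic_map (top_of_set T) (subtopology X (h ` T)) h" by (simp only:)
  then have "subtopology X (h ` T) homeomorphic_space top_of_set T"
    using homeomorphic_space homeomorphic_space_sym by blast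
  then show ?thesis using x T(1,3) unfolding surface_boundary_def by blast
qed

text \<open>Inner points of the disc inherit a chart from \<open>h\<close>. A rim point has none:
  followed by the inverse of \<open>h\<close>, a chart would be a continuous injection of a planar
  open set into the closed unit disc, whose image is open by invariance of domain and yet contains a
  unit vector.\<close>

lemma disc_chart_boundary:
  fixes h :: "complex \<Rightarrow> 'a"
  assumes X: "Hausdorff_space X" and h: "parametrizes X (cball 0 1) h D"
    and W: "openin X W" "W \<subseteq> D" and x: "x \<in> W"
  shows "x \<in> surface_boundary X \<longleftrightarrow> x \<in> h ` sphere 0 1"
proof -
  let ?C = "cball (0::complex) 1"
  have DX: "D \<subseteq> topspace X" using parametrizes_subset_topspace[OF h] .
  obtain k where k: "continuous_map (subtopology X D) (top_of_set ?C) k"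
    "\<And>z. z \<in> ?C \<Longrightarrow> k (h z) = z" "\<And>x. x \<in> D \<Longrightarrow> h (k x) = x"
    using parametrizes_inverse[OF X compact_cball h] by metis
  have hC: "h ` ?C = D" and hc: "continuous_map (top_of_set ?C) X h"
    using h unfolding parametrizes_def by auto
  show ?thesis
  proof
    assume B: "x \<in> surface_boundary X"
    show "x \<in> h ` sphere 0 1"
    proof (rule ccontr)
      assume ns: "x \<notin> h ` sphere 0 1"
      let ?N = "{w \<in> ?C. h w \<in> W}"
      let ?T = "?N \<inter> ball 0 1"
      have "openin (top_of_set ?C) ?N"
        using openin_continuous_map_preimage[OF hc W(1)] by simp
      then have oN: "openin (top_of_set ?C) ?T"
        by (rule openin_Int_open) simp
      then obtain T0 where "open T0" "?T = ?C \<inter> T0"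
        unfolding openin_open by blast
      moreover have "ball (0::complex) 1 \<subseteq> ?C" by (rule ball_subset_cball)
      ultimately have "?T = T0 \<inter> ball 0 1" by blast
      then have oT: "open ?T" using \<open>open T0\<close> by (metis open_Int open_ball)
      have "openin (subtopology X D) (h ` ?T)"
        using parametrizes_homeomorphic_map[OF X compact_cball h] oN homeomorphic_imp_open_map
        unfolding open_map_def by blast
      then have "openin (subtopology X W) (h ` ?T)"
        by (rule openin_subtopology_subset) (use W(2) in auto)
      then have oU: "openin X (h ` ?T)"
        using W(1) openin_open_subtopology by blast
      obtain z where z: "z \<in> ?C" "x = h z" using x W(2) hC by blast
      then have "norm z \<noteq> 1" using ns by auto
      then have "z \<in> ball 0 1" using z(1) by simp
      then have "x \<in> h ` ?T" using z x by blast
      moreover have "?T \<subseteq> ?C" by blast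
      ultimately show False using open_chart_not_boundary[OF X h compact_cball oT _ oU] B by blast
    qed
  next
    assume "x \<in> h ` sphere 0 1"
    then obtain z where n1: "norm z = 1" and z: "x = h z" by auto
    have "\<not> (\<exists>U T. openin X U \<and> x \<in> U \<and> open (T::complex set) \<and>
        subtopology X U homeomorphic_space top_of_set T)"
    proof
      assume "\<exists>U T. openin X U \<and> x \<in> U \<and> open (T::complex set) \<and>
        subtopology X U homeomorphic_space top_of_set T"
      then obtain U and T :: "complex set" where U: "openin X U" "x \<in> U" "open T"
        "subtopology X U homeomorphic_space top_of_set T" by blast
      then obtain f where f0: "homeomorphic_map (top_of_set T) (subtopology X U) f"
        using homeomorphic_space homeomorphic_space_sym by blast
      have UX: "U \<subseteq> topspace X" using U openin_subset by blast
      have f: "continuous_map (top_of_set T) X f" "inj_on f T" "f ` T = U"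
        using homeomorphic_map_parametrizes[OF f0 UX] unfolding parametrizes_def by auto
      let ?T = "{t\<in>T. f t \<in> W}"
      have "openin (top_of_set T) ?T"
        using openin_continuous_map_preimage[OF f(1) W(1)] by simp
      then have oT: "open ?T" using U(3) openin_open_eq by blast
      have "continuous_map (top_of_set ?T) X f"
        by (rule continuous_map_from_subtopology_mono[OF f(1)]) auto
      then have "continuous_map (top_of_set ?T) (subtopology X D) f"
        unfolding continuous_map_in_subtopology using W(2) by auto
      then have "continuous_map (top_of_set ?T) (top_of_set ?C) (k \<circ> f)"
        using continuous_map_compose k(1) by blast
      then have cont: "continuous_on ?T (k \<circ> f)" and im: "(k \<circ> f) ` ?T \<subseteq> ?C"
        unfolding continuous_map_in_subtopology by auto
      have "inj_on (k \<circ> f) ?T"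
      proof (rule inj_onI)
        fix x y assume "x \<in> ?T" "y \<in> ?T" "(k \<circ> f) x = (k \<circ> f) y"
        moreover from this have "f x = f y"
          using k(3) W(2) by (metis (mono_tags, lifting) comp_apply mem_Collect_eq subsetD)
        ultimately show "x = y" using f(2) by (auto simp: inj_on_def)
      qed
      then have op: "open ((k \<circ> f) ` ?T)"
        using invariance_of_domain[OF cont oT] by blast
      obtain t where t: "t \<in> T" "f t = x" using U(2) f(3) by auto
      have "k x = z" unfolding z using n1 by (intro k(2)) simp
      then have "z \<in> (k \<circ> f) ` ?T" using t x by (intro image_eqI[of _ _ t]) auto
      then have "z \<in> interior ?C"
        using op im interiorI by blast
      then show False using n1 by simp
    qed
    moreover have "x \<in> topspace X" using x W(2) DX by blast
    ultimately show "x \<in> surface_boundary X" unfolding surface_boundary_def by blast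
  qed
qed

lemma surface_boundary_disc:
  fixes h :: "complex \<Rightarrow> 'a"
  assumes X: "Hausdorff_space X" and h: "parametrizes X (cball 0 1) h D"
  shows "surface_boundary (subtopology X D) = h ` sphere 0 1"
proof -
  have D: "D \<subseteq> topspace X" using parametrizes_subset_topspace[OF h] .
  have p: "parametrizes (subtopology X D) (cball 0 1) h D"
    using h unfolding parametrizes_def continuous_map_in_subtopology by auto
  have "openin (subtopology X D) D" using D by (simp add: openin_subtopology_refl)
  then have "x \<in> surface_boundary (subtopology X D) \<longleftrightarrow> x \<in> h ` sphere 0 1" if "x \<in> D" for x
    using disc_chart_boundary[OF Hausdorff_space_subtopology[OF X] p _ order_refl that] by blast
  moreover have "surface_boundary (subtopology X D) \<subseteq> D"
    unfolding surface_boundary_def by auto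
  moreover have "h ` sphere 0 1 \<subseteq> D" using h by (auto simp: parametrizes_def)
  ultimately show ?thesis by blast
qed

text \<open>The complement is a union of open sets with planar charts. Closedness later settles the
  corners of an edge as limits of other rim points.\<close>

lemma closedin_surface_boundary: "closedin X (surface_boundary X)"
proof -
  let ?P = "\<lambda>U. openin X U \<and> (\<exists>T. open (T::complex set) \<and> subtopology X U homeomorphic_space top_of_set T)"
  have "topspace X - surface_boundary X = \<Union>{U. ?P U}"
    unfolding surface_boundary_def using openin_subset by fastforce
  moreover have "openin X (\<Union>{U. ?P U})" by auto
  moreover have "surface_boundary X \<subseteq> topspace X" unfolding surface_boundary_def by auto
  ultimately show ?thesis unfolding closedin_def by simp
qed

section \<open>Arcs and circles\<close>

text \<open>The ends are named because the regluing of circles depends only on which ends the arcs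
  match.\<close>

definition arc_from :: "'a topology \<Rightarrow> 'a set \<Rightarrow> 'a \<Rightarrow> 'a \<Rightarrow> bool" where
  "arc_from X s a b \<longleftrightarrow> (\<exists>p. parametrizes X {0..1::real} p s \<and> p 0 = a \<and> p 1 = b)"

definition circle_in :: "'a topology \<Rightarrow> 'a set \<Rightarrow> bool" where
  "circle_in X c \<longleftrightarrow> (\<exists>h. parametrizes X (sphere (0::complex) 1) h c)"

lemma line_segment_in_iff_arc_from:
  assumes "Hausdorff_space X"
  shows "line_segment_in X s \<longleftrightarrow> (\<exists>a b. arc_from X s a b)"
  using homeomorphic_space_iff_parametrizes[OF assms, of "{0..1::real}" s]
  unfolding line_segment_in_def arc_from_def by auto

lemma closed_disc_in_iff_parametrizes:
  assumes "Hausdorff_space X"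
  shows "closed_disc_in X D \<longleftrightarrow> (\<exists>h. parametrizes X (cball (0::complex) 1) h D)"
  using homeomorphic_space_iff_parametrizes[OF assms, of "cball (0::complex) 1" D]
  unfolding closed_disc_in_def by auto

lemma arc_from_closedin: "Hausdorff_space X \<Longrightarrow> arc_from X s a b \<Longrightarrow> closedin X s"
  unfolding arc_from_def using parametrizes_closedin compact_Icc by blast

lemma arc_from_compactin: "arc_from X s a b \<Longrightarrow> compactin X s"
  unfolding arc_from_def using parametrizes_compactin compact_Icc by blast

lemma arc_from_connectedin: "arc_from X s a b \<Longrightarrow> connectedin X s"
  unfolding arc_from_def using parametrizes_connectedin connected_Icc by blast

lemma arc_from_ends:
  assumes "arc_from X s a b"
  shows "a \<in> s" "b \<in> s" "a \<noteq> b"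
proof -
  obtain p where "parametrizes X {0..1::real} p s" "p 0 = a" "p 1 = b"
    using assms unfolding arc_from_def by blast
  moreover have "(0::real) \<in> {0..1}" "(1::real) \<in> {0..1}" by auto
  ultimately show "a \<in> s" "b \<in> s" "a \<noteq> b"
    unfolding parametrizes_def using inj_on_eq_iff[of p "{0..1}" 0 1] by auto
qed

lemma arc_from_interval:
  assumes "u < v" "continuous_map (top_of_set {u..v}) X g" "inj_on g {u..v::real}"
  shows "arc_from X (g ` {u..v}) (g u) (g v)"
proof -
  let ?f = "\<lambda>t. u + t * (v - u)"
  have im: "?f ` {0..1} = {u..v}"
  proof (intro set_eqI iffI)
    fix y assume "y \<in> ?f ` {0..1}"
    then obtain t where "y = u + t * (v - u)" "t \<in> {0..1}" by (rule imageE)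
    then have "y = u + t * (v - u)" "0 \<le> t" "t \<le> 1" by auto
    moreover from this have "0 \<le> t * (v - u)" "t * (v - u) \<le> 1 * (v - u)"
      using assms(1) by (simp_all add: mult_right_mono)
    ultimately show "y \<in> {u..v}" by auto
  next
    fix y assume "y \<in> {u..v}"
    then have "y = ?f ((y - u) / (v - u))" "(y - u) / (v - u) \<in> {0..1}"
      using assms(1) by (auto simp: field_simps)
    then show "y \<in> ?f ` {0..1}" by blast
  qed
  have "continuous_map (top_of_set {0..1}) (top_of_set {u..v}) ?f"
    unfolding continuous_map_in_subtopology using im by (auto intro!: continuous_intros)
  then have "continuous_map (top_of_set {0..1}) X (g \<circ> ?f)"
    using assms(2) continuous_map_compose by blast
  moreover have "inj_on ?f {0..1}" using assms(1) by (auto simp: inj_on_def)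
  then have "inj_on (g \<circ> ?f) {0..1}"
    using assms(3) im by (metis comp_inj_on)
  moreover have "(g \<circ> ?f) ` {0..1} = g ` {u..v}"
    using im by (metis image_comp)
  ultimately have "parametrizes X {0..1::real} (g \<circ> ?f) (g ` {u..v})"
    unfolding parametrizes_def by blast
  then show ?thesis unfolding arc_from_def by force
qed

lemma arc_from_sym:
  assumes "arc_from X s a b"
  shows "arc_from X s b a"
proof -
  obtain p where p: "parametrizes X {0..1::real} p s" "p 0 = a" "p 1 = b"
    using assms unfolding arc_from_def by blast
  have im: "(\<lambda>t::real. 1 - t) ` {0..1} = {0..1}" by (auto simp: image_def intro!: bexI[of _ "1 - _"])
  have "continuous_map (top_of_set {0..1::real}) (top_of_set {0..1}) (\<lambda>t. 1 - t)"
    unfolding continuous_map_in_subtopology by (auto intro!: continuous_intros)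
  then have "continuous_map (top_of_set {0..1::real}) X (p \<circ> (\<lambda>t. 1 - t))"
    using p continuous_map_compose unfolding parametrizes_def by blast
  moreover have "inj_on (p \<circ> (\<lambda>t. 1 - t)) {0..1}"
    using p im unfolding parametrizes_def by (intro comp_inj_on) (auto simp: inj_on_def)
  moreover have "(p \<circ> (\<lambda>t. 1 - t)) ` {0..1} = s"
    using p im unfolding parametrizes_def by (metis image_comp)
  ultimately show ?thesis
    using p unfolding arc_from_def parametrizes_def by (intro exI[of _ "p \<circ> (\<lambda>t. 1 - t)"]) auto
qed

text \<open>The ends are the points whose removal leaves an arc connected, a description free of
  parametrizations.\<close>

lemma arc_from_endpoint_unique:
  assumes X: "Hausdorff_space X" and "arc_from X s a b" "arc_from X s c d"
  shows "c \<in> {a, b}"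
proof -
  obtain p where p: "parametrizes X {0..1::real} p s" "p 0 = a" "p 1 = b"
    using assms unfolding arc_from_def by blast
  obtain q where q: "parametrizes X {0..1::real} q s" "q 0 = c" "q 1 = d"
    using assms unfolding arc_from_def by blast
  obtain k where k: "continuous_map (subtopology X s) (top_of_set {0..1}) k"
    "\<And>z. z \<in> {0..1} \<Longrightarrow> k (p z) = z" "\<And>x. x \<in> s \<Longrightarrow> p (k x) = x" "k ` s = {0..1}"
    using parametrizes_inverse[OF X compact_Icc p(1)] by metis
  have qs: "q ` {0..1} = s" "inj_on q {0..1}" using q by (auto simp: parametrizes_def)
  have "continuous_map (top_of_set {0..1}) (subtopology X s) q"
    using q(1) unfolding parametrizes_def continuous_map_in_subtopology by auto
  then have "continuous_map (top_of_set {0..1}) (top_of_set {0..1}) (k \<circ> q)"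
    using k(1) continuous_map_compose by blast
  then have "continuous_on {0..1} (k \<circ> q)"
    unfolding continuous_map_in_subtopology by auto
  then have "connected ((k \<circ> q) ` {0<..1})"
    by (intro connected_continuous_image) (auto elim: continuous_on_subset)
  \<comment> \<open>In the coordinate of \<open>p\<close>, the arc \<open>q\<close> without its
    start is the unit interval without \<open>k c\<close>. It is connected, so \<open>k c\<close> is
    0 or 1.\<close>
  moreover have "(k \<circ> q) ` {0<..1} = {0..1} - {k c}"
  proof -
    have "inj_on (k \<circ> q) {0..1}"
      using qs k(3) by (intro comp_inj_on) (auto intro: inj_on_inverseI)
    then have "(k \<circ> q) ` ({0..1} - {0}) = (k \<circ> q) ` {0..1} - (k \<circ> q) ` {0}"
      by (rule inj_on_image_set_diff) auto
    moreover have "{0<..1} = {0..1} - {0::real}" by auto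
    moreover have "(k \<circ> q) ` {0..1} = {0..1}" using qs k(4) by (metis image_comp)
    moreover have "(k \<circ> q) 0 = k c" using q by simp
    ultimately show ?thesis
      by (simp only: image_insert image_empty)
  qed
  ultimately have con: "connected ({0..1} - {k c})" by simp
  have "c \<in> s" using assms(3) by (rule arc_from_ends)
  then have kc: "k c \<in> {0..1}" "p (k c) = c" using k by auto
  have "k c = 0 \<or> k c = 1"
  proof (rule ccontr)
    assume "\<not> ?thesis"
    then have "0 \<in> {0..1} - {k c}" "1 \<in> {0..1} - {k c}" by auto
    then have "{0..1} \<subseteq> {0..1} - {k c}" using connected_contains_Icc[OF con] by blast
    then show False using kc by auto
  qed
  then show ?thesis using kc p by auto
qed

lemma arc_from_ends_unique:
  assumes "Hausdorff_space X" "arc_from X s a b" "arc_from X s c d"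
  shows "a = c \<and> b = d \<or> a = d \<and> b = c"
  using arc_from_endpoint_unique[OF assms(1,2,3)]
    arc_from_endpoint_unique[OF assms(1,2) arc_from_sym[OF assms(3)]] arc_from_ends(3)[OF assms(3)]
  by auto

lemma continuous_map_paste:
  assumes "closedin Z A" "closedin Z B" "topspace Z \<subseteq> A \<union> B"
    "continuous_map (subtopology Z A) X f" "continuous_map (subtopology Z B) X g"
    "\<And>x. x \<in> A \<inter> B \<Longrightarrow> f x = g x"
  shows "continuous_map Z X (\<lambda>x. if x \<in> A then f x else g x)"
proof (rule pasting_lemma_closed[where I = "{True, False}" and T = "\<lambda>i. if i then A else B"
      and f = "\<lambda>i. if i then f else g"])
qed (use assms in \<open>auto split: if_splits\<close>)

lemma continuous_map_paste_euclidean: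
  fixes A B :: "'c::t2_space set"
  assumes "closed A" "closed B"
    "continuous_map (top_of_set A) X f" "continuous_map (top_of_set B) X g"
    "\<And>x. x \<in> A \<inter> B \<Longrightarrow> f x = g x"
  shows "continuous_map (top_of_set (A \<union> B)) X (\<lambda>x. if x \<in> A then f x else g x)"
proof (rule continuous_map_paste[of _ A B])
  show "closedin (top_of_set (A \<union> B)) A" "closedin (top_of_set (A \<union> B)) B"
    using assms by (auto intro: closed_subset)
qed (use assms in \<open>auto simp: subtopology_subtopology inf.absorb2 Int_absorb1\<close>)

lemma arc_from_join:
  assumes s: "arc_from X s a b" and t: "arc_from X t b c" and st: "s \<inter> t = {b}"
  shows "arc_from X (s \<union> t) a c"
proof -
  obtain p where p: "parametrizes X {0..1::real} p s" "p 0 = a" "p 1 = b"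
    using s unfolding arc_from_def by blast
  obtain q where q: "parametrizes X {0..1::real} q t" "q 0 = b" "q 1 = c"
    using t unfolding arc_from_def by blast
  \<comment> \<open>\<open>p\<close> is run on the interval from 0 to 1 and \<open>q\<close>,
    shifted by one, on the interval from 1 to 2; both give \<open>b\<close> at 1.\<close>
  let ?g = "\<lambda>x. if x \<in> {0..1} then p x else (q \<circ> (\<lambda>x. x - 1)) x"
  have "continuous_map (top_of_set {1..2::real}) (top_of_set {0..1}) (\<lambda>x. x - 1)"
    unfolding continuous_map_in_subtopology by (auto intro!: continuous_intros)
  then have "continuous_map (top_of_set {1..2::real}) X (q \<circ> (\<lambda>x. x - 1))"
    using q(1) continuous_map_compose unfolding parametrizes_def by blast
  then have "continuous_map (top_of_set ({0..1} \<union> {1..2})) X ?g"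
    using p q by (intro continuous_map_paste_euclidean) (auto simp: parametrizes_def o_def)
  moreover have U: "{0..1} \<union> {1..2} = {0..2::real}" by auto
  ultimately have cont: "continuous_map (top_of_set {0..2}) X ?g" by simp
  have ps: "p ` {0..1} = s" "inj_on p {0..1}" and qt: "q ` {0..1} = t" "inj_on q {0..1}"
    using p q by (auto simp: parametrizes_def)
  have q': "(q \<circ> (\<lambda>x. x - 1)) ` {1..2} = t" "inj_on (q \<circ> (\<lambda>x. x - 1)) {1..2}"
  proof -
    have im: "(\<lambda>x::real. x - 1) ` {1..2} = {0..1}"
      by (auto simp: image_def intro!: bexI[of _ "_ + 1"])
    show "(q \<circ> (\<lambda>x. x - 1)) ` {1..2} = t"
      by (simp only: image_comp[symmetric] im qt)
    have "inj_on (\<lambda>x::real. x - 1) {1..2}" by (simp add: inj_on_def)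
    then show "inj_on (q \<circ> (\<lambda>x. x - 1)) {1..2}"
      by (rule comp_inj_on) (simp only: im qt)
  qed
  have cross: "x = y" if "x \<in> {0..1}" "y \<in> {1..2}" "p x = q (y - 1)" for x y
  proof -
    have y: "y - 1 \<in> {0..1}" using that by simp
    have "p x \<in> s" "q (y - 1) \<in> t" unfolding ps(1)[symmetric] qt(1)[symmetric] using that(1) y by blast+
    then have "p x = b" "q (y - 1) = b" using that(3) st by auto
    then have "x = 1" "y - 1 = 0"
      using inj_onD[OF ps(2) _ that(1), of 1] inj_onD[OF qt(2) _ y, of 0] p(3) q(2) by auto
    then show ?thesis by simp
  qed
  have "inj_on ?g {0..2}"
  proof (rule inj_onI)
    fix x y :: real assume xy: "x \<in> {0..2}" "y \<in> {0..2}" "?g x = ?g y"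
    consider "x \<le> 1" "y \<le> 1" | "x \<le> 1" "1 < y" | "1 < x" "y \<le> 1" | "1 < x" "1 < y" by linarith
    then show "x = y"
    proof cases
      case 1 then show ?thesis using xy ps(2) by (auto simp: inj_on_def)
    next
      case 2 then show ?thesis using xy cross[of x y] by auto
    next
      case 3 then show ?thesis using xy cross[of y x] by auto
    next
      case 4 then show ?thesis using xy q'(2) by (auto simp: inj_on_def)
    qed
  qed
  then have "arc_from X (?g ` {0..2}) (?g 0) (?g 2)"
    using arc_from_interval[of 0 2, OF _ cont] by simp
  moreover have "?g ` {0..2} = s \<union> t"
  proof -
    have "?g ` {0..1} = s" using ps by auto
    moreover have "?g ` {1..2} = (q \<circ> (\<lambda>x. x - 1)) ` {1..2}"
      using p q by (intro image_cong) auto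
    ultimately show ?thesis by (simp only: U[symmetric] image_Un q'(1))
  qed
  ultimately show ?thesis using p q by simp
qed

text \<open>The real part is thus a coordinate on each closed semicircle, which lets two arcs be
  laid along the circle without angles.\<close>

lemma Re_eq_on_semicircle:
  assumes "norm z = 1" "norm w = 1" "Re z = Re w" "Im z * Im w \<ge> 0"
  shows "z = w"
proof -
  have "(Im z)\<^sup>2 = (Im w)\<^sup>2"
    using assms by (metis add_left_cancel cmod_power2)
  then have "\<bar>Im z\<bar> = \<bar>Im w\<bar>" by (simp add: power2_eq_iff abs_eq_iff)
  then have "Im z = Im w" using assms(4)
    by (auto simp: abs_eq_iff zero_le_mult_iff)
  then show ?thesis using assms complex_eqI by blast
qed

text \<open>\<open>u\<close> is laid along the upper semicircle from 1 to -1 and \<open>t\<close>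
  along the lower one back to 1. A coincidence between the halves can only be at \<open>a\<close> or
  \<open>b\<close>, that is at 1 or -1.\<close>

lemma circle_in_join:
  assumes u: "arc_from X u a b" and t: "arc_from X t b a" and ut: "u \<inter> t = {a, b}"
  shows "circle_in X (u \<union> t)"
proof -
  obtain p where p: "parametrizes X {0..1::real} p u" "p 0 = a" "p 1 = b"
    using u unfolding arc_from_def by blast
  obtain q where q: "parametrizes X {0..1::real} q t" "q 0 = b" "q 1 = a"
    using t unfolding arc_from_def by blast
  let ?U = "sphere (0::complex) 1 \<inter> {z. Im z \<ge> 0}" and ?L = "sphere (0::complex) 1 \<inter> {z. Im z \<le> 0}"
  \<comment> \<open>\<open>?f\<close> takes 1 to 0 and -1 to 1, \<open>?g\<close> the other way
    round, so both halves give \<open>a\<close> at 1 and \<open>b\<close> at -1.\<close>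
  let ?f = "\<lambda>z. (1 - Re z) / 2" and ?g = "\<lambda>z. (1 + Re z) / 2"
  have Re: "\<bar>Re z\<bar> \<le> 1" if "norm z = 1" for z :: complex
    using that abs_Re_le_cmod by metis
  have "continuous_map (top_of_set ?U) (top_of_set {0..1}) ?f"
    "continuous_map (top_of_set ?L) (top_of_set {0..1}) ?g"
    unfolding continuous_map_in_subtopology using Re by (auto intro!: continuous_intros simp: abs_le_iff) force+
  then have "continuous_map (top_of_set ?U) X (p \<circ> ?f)" "continuous_map (top_of_set ?L) X (q \<circ> ?g)"
    using p q continuous_map_compose unfolding parametrizes_def by blast+
  moreover have "closed ?U" "closed ?L"
    using closed_halfspace_Im_ge[of 0] closed_halfspace_Im_le[of 0] by (auto intro!: closed_Int)
  moreover have pm: "z = 1 \<or> z = -1" if "norm z = 1" "Im z = 0" for z :: complex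
    using that cmod_power2[of z] by (auto simp: complex_eq_iff power2_eq_1_iff)
  have "(p \<circ> ?f) z = (q \<circ> ?g) z" if "z \<in> ?U \<inter> ?L" for z
    using pm[of z] that p q by auto
  moreover have "?U \<union> ?L = sphere 0 1" by auto
  moreover define h where "h = (\<lambda>z. if z \<in> ?U then (p \<circ> ?f) z else (q \<circ> ?g) z)"
  ultimately have cont: "continuous_map (top_of_set (sphere 0 1)) X h"
    using continuous_map_paste_euclidean[of ?U ?L X "p \<circ> ?f" "q \<circ> ?g"] by auto
  have ps: "p ` {0..1} = u" "inj_on p {0..1}" and qt: "q ` {0..1} = t" "inj_on q {0..1}"
    using p q by (auto simp: parametrizes_def)
  have hU: "h z = p (?f z)" if "z \<in> ?U" for z using that h_def by simp
  have hL: "h z = q (?g z)" if "z \<in> ?L" for z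
    using that h_def pm[of z] p q by auto
  have fU: "?f z \<in> {0..1}" "?g z \<in> {0..1}" if "norm z = 1" for z :: complex
    using Re[OF that] by auto
  have sp: "norm z = 1" "z \<in> ?U \<or> z \<in> ?L" if "z \<in> sphere 0 1" for z using that by auto
  have same: "z = w" if "z \<in> ?U \<and> w \<in> ?U \<or> z \<in> ?L \<and> w \<in> ?L" "h z = h w" for z w
  proof (rule Re_eq_on_semicircle)
    show "norm z = 1" "norm w = 1" "Im z * Im w \<ge> 0" using that(1) by (auto simp: mult_nonpos_nonpos)
    show "Re z = Re w"
      using that(1)
    proof
      assume zw: "z \<in> ?U \<and> w \<in> ?U"
      then have "p (?f z) = p (?f w)" using hU that(2) by auto
      then have "?f z = ?f w" by (rule inj_onD[OF ps(2)]) (use fU zw in auto)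
      then show ?thesis by simp
    next
      assume zw: "z \<in> ?L \<and> w \<in> ?L"
      then have "q (?g z) = q (?g w)" using hL that(2) by auto
      then have "?g z = ?g w" by (rule inj_onD[OF qt(2)]) (use fU zw in auto)
      then show ?thesis by simp
    qed
  qed
  have cross: "z = w" if zw: "z \<in> ?U" "w \<in> ?L" "h z = h w" for z w
  proof -
    have "?f z \<in> {0..1}" "?g w \<in> {0..1}" using zw fU by auto
    then have "p (?f z) \<in> u" "q (?g w) \<in> t" unfolding ps(1)[symmetric] qt(1)[symmetric] by blast+
    then have "h z \<in> u" "h w \<in> t" using hU[OF zw(1)] hL[OF zw(2)] by simp_all
    then have "h z = a \<or> h z = b" using zw ut by auto
    moreover have "?f z = 0" if "h z = a" using that hU[OF zw(1)] fU[of z] zw(1) p(2) inj_onD[OF ps(2), of "?f z" 0] by auto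
    moreover have "?f z = 1" if "h z = b" using that hU[OF zw(1)] fU[of z] zw(1) p(3) inj_onD[OF ps(2), of "?f z" 1] by auto
    moreover have "?g w = 1" if "h w = a" using that hL[OF zw(2)] fU[of w] zw(2) q(3) inj_onD[OF qt(2), of "?g w" 1] by auto
    moreover have "?g w = 0" if "h w = b" using that hL[OF zw(2)] fU[of w] zw(2) q(2) inj_onD[OF qt(2), of "?g w" 0] by auto
    ultimately have "(?f z = 0 \<and> ?g w = 1) \<or> (?f z = 1 \<and> ?g w = 0)"
      using zw(3) by auto
    then have R: "(Re z = 1 \<and> Re w = 1) \<or> (Re z = -1 \<and> Re w = -1)" by auto
    have "Im z = 0" "Im w = 0"
      using R zw cmod_power2[of z] cmod_power2[of w] by auto
    then show "z = w" using R complex_eqI by auto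
  qed
  have "inj_on h (sphere 0 1)"
  proof (rule inj_onI)
    fix z w assume "z \<in> sphere 0 1" "w \<in> sphere 0 1" "h z = h w"
    then show "z = w" using same[of z w] cross[of z w] cross[of w z] sp(2)[of z] sp(2)[of w] by metis
  qed
  moreover have "h ` sphere 0 1 = u \<union> t"
  proof (intro equalityI subsetI)
    fix x assume "x \<in> h ` sphere 0 1"
    then obtain z where "z \<in> sphere 0 1" "x = h z" by auto
    then show "x \<in> u \<union> t" using sp[of z] hU[of z] hL[of z] fU[of z] ps(1) qt(1) by auto
  next
    fix x assume "x \<in> u \<union> t"
    then consider s where "s \<in> {0..1}" "x = p s" | s where "s \<in> {0..1}" "x = q s"
      using ps qt by blast
    then show "x \<in> h ` sphere 0 1"
    proof cases
      case 1
      \<comment> \<open>The solution of \<open>?f z = s\<close> on the upper semicircle; the witness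
        for \<open>q\<close> solves \<open>?g z = s\<close> on the lower one.\<close>
      let ?z = "Complex (1 - 2 * s) (sqrt (1 - (1 - 2 * s)\<^sup>2))"
      have "(1 - 2 * s)\<^sup>2 \<le> 1" using 1 by (auto simp: abs_square_le_1)
      then have "?z \<in> ?U" by (auto simp: cmod_def)
      moreover from this have "h ?z = x" using hU[of ?z] 1 by simp
      ultimately show ?thesis by blast
    next
      case 2
      let ?z = "Complex (2 * s - 1) (- sqrt (1 - (2 * s - 1)\<^sup>2))"
      have "(2 * s - 1)\<^sup>2 \<le> 1" using 2 by (auto simp: abs_square_le_1)
      then have "?z \<in> ?L" by (auto simp: cmod_def)
      moreover from this have "h ?z = x" using hL[of ?z] 2 by simp
      ultimately show ?thesis by blast
    qed
  qed
  ultimately show ?thesis using cont unfolding circle_in_def parametrizes_def by blast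
qed

text \<open>Inner points are dense in an arc, so taking a closure restores end points that were
  removed.\<close>

lemma arc_from_subset_closure:
  assumes "arc_from X s a b"
  shows "s \<subseteq> X closure_of (s - {a, b})"
proof -
  obtain p where p: "parametrizes X {0..1::real} p s" "p 0 = a" "p 1 = b"
    using assms unfolding arc_from_def by blast
  have "(top_of_set {0..1::real}) closure_of {0<..<1} = {0..1}"
    by (simp add: closure_of_subtopology inf.absorb2 greaterThanLessThan_subseteq_atLeastAtMost_iff)
  then have "p ` {0..1} \<subseteq> X closure_of (p ` {0<..<1})"
    using p continuous_map_image_closure_subset[of "top_of_set {0..1}" X p "{0<..<1}"]
    unfolding parametrizes_def by simp
  moreover have "p ` {0<..<1} \<subseteq> s - {a, b}"
  proof
    fix x assume "x \<in> p ` {0<..<1}"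
    then obtain t where "x = p t" "0 < t" "t < 1" by auto
    then show "x \<in> s - {a, b}"
      using p inj_onD[of p "{0..1}" t 0] inj_onD[of p "{0..1}" t 1] unfolding parametrizes_def by auto
  qed
  ultimately have "p ` {0..1} \<subseteq> X closure_of (s - {a, b})"
    using closure_of_mono by blast
  then show ?thesis using p(1) unfolding parametrizes_def by simp
qed

section \<open>Cutting circles along arcs\<close>

text \<open>A circle cut open at a base point \<open>q\<close>. Arcs that avoid \<open>q\<close>
  become closed subintervals of the open unit interval, where complements can be read off.\<close>

definition loop :: "'a topology \<Rightarrow> (real \<Rightarrow> 'a) \<Rightarrow> 'a \<Rightarrow> 'a set \<Rightarrow> bool" where
  "loop X g q Q \<longleftrightarrow> continuous_map (top_of_set {0..1}) X g \<and> g 0 = q \<and> g 1 = q \<and>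
     inj_on g {0..<1} \<and> g ` {0..1} = Q"

lemma circle_in_loop:
  assumes Q: "circle_in X Q" and q: "q \<in> Q"
  obtains g where "loop X g q Q"
proof -
  obtain h where h: "continuous_map (top_of_set (sphere (0::complex) 1)) X h" "inj_on h (sphere 0 1)"
    "h ` sphere 0 1 = Q"
    using Q unfolding circle_in_def parametrizes_def by blast
  obtain w where w: "norm w = 1" "h w = q" using h q by auto
  \<comment> \<open>The factor \<open>w\<close> rotates the standard winding so that it starts at
    the preimage of \<open>q\<close>.\<close>
  define f where "f = (\<lambda>t. w * cis (2 * pi * t))"
  have nf: "norm (f t) = 1" for t by (simp add: f_def norm_mult w)
  have "continuous_map (top_of_set {0..1}) (top_of_set (sphere 0 1)) f"
    unfolding continuous_map_in_subtopology using nf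
    by (auto intro!: continuous_intros simp: f_def)
  then have 1: "continuous_map (top_of_set {0..1}) X (h \<circ> f)"
    using h continuous_map_compose by blast
  have 2: "(h \<circ> f) 0 = q" "(h \<circ> f) 1 = q" using w by (simp_all add: f_def)
  have "inj_on f {0..<1}"
  proof (rule inj_onI)
    fix x y :: real assume xy: "x \<in> {0..<1}" "y \<in> {0..<1}" "f x = f y"
    have "w \<noteq> 0" using w by auto
    then have "cis (2 * pi * x) = cis (2 * pi * y)" using xy f_def by simp
    then have "sin (2 * pi * y) = sin (2 * pi * x) \<and> cos (2 * pi * y) = cos (2 * pi * x)"
      by (simp add: complex_eq_iff)
    then obtain n :: int where "2 * pi * y = 2 * pi * x + 2 * pi * n"
      using sin_cos_eq_iff by blast
    then have "2 * pi * y = 2 * pi * (x + n)" by (simp add: algebra_simps)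
    then have yx: "y = x + n" by simp
    then have "\<bar>real_of_int n\<bar> < 1" using xy by auto
    then have "n = 0" by linarith
    then show "x = y" using yx by simp
  qed
  then have 3: "inj_on (h \<circ> f) {0..<1}"
    using h(2) nf by (intro comp_inj_on) (auto intro: inj_on_subset)
  have "f ` {0..1} = sphere 0 1"
  proof (intro equalityI subsetI)
    fix z assume "z \<in> f ` {0..1}"
    then show "z \<in> sphere 0 1" using nf by auto
  next
    fix z :: complex assume z: "z \<in> sphere 0 1"
    then have n: "norm (z / w) = 1" using w by (simp add: norm_divide)
    have "(Re (z/w))\<^sup>2 + (Im (z/w))\<^sup>2 = 1" using n cmod_power2[of "z / w"] by simp
    then obtain t where t: "0 \<le> t" "t < 2*pi" "Re (z/w) = cos t" "Im (z/w) = sin t"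
      by (rule sincos_total_2pi)
    then have "z / w = cis t" by (simp add: complex_eq_iff)
    moreover have "w \<noteq> 0" using w by auto
    ultimately have "z = w * cis t" by (metis nonzero_mult_div_cancel_left times_divide_eq_right)
    then have "z = f (t / (2 * pi))" by (simp add: f_def)
    moreover have "t / (2 * pi) \<in> {0..1}" using t by auto
    ultimately show "z \<in> f ` {0..1}" by blast
  qed
  then have 4: "(h \<circ> f) ` {0..1} = Q" using h(3) by (simp only: image_comp[symmetric])
  show thesis by (rule that[of "h \<circ> f"]) (use 1 2 3 4 in \<open>simp add: loop_def\<close>)
qed

lemma loop_eqD:
  assumes "loop X g q Q" "x \<in> {0..1}" "y \<in> {0..1}" "g x = g y"
  shows "x = y \<or> x = 0 \<and> y = 1 \<or> x = 1 \<and> y = 0"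
proof -
  have inj: "inj_on g {0..<1}" and g: "g 0 = g 1" using assms(1) by (auto simp: loop_def)
  \<comment> \<open>Folds 1 onto 0, because injectivity of \<open>g\<close> is given on the
    half-open interval.\<close>
  define r where "r = (\<lambda>x::real. if x = 1 then 0 else x)"
  have "g (r x) = g (r y)" using assms(4) g by (auto simp: r_def)
  moreover have "r x \<in> {0..<1}" "r y \<in> {0..<1}" using assms by (auto simp: r_def)
  ultimately have "r x = r y" using inj_onD[OF inj] by blast
  then show ?thesis by (auto simp: r_def split: if_splits)
qed

text \<open>The last hypothesis excludes the full turn, the only closed interval on which
  \<open>g\<close> repeats a value.\<close>

lemma loop_arc:
  assumes "loop X g q Q" "0 \<le> u" "u < v" "v \<le> 1" "0 < u \<or> v < 1"
  shows "arc_from X (g ` {u..v}) (g u) (g v)"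
proof (rule arc_from_interval[OF assms(3)])
  have "{u..v} \<subseteq> {0..1}" using assms by auto
  then show "continuous_map (top_of_set {u..v}) X g"
    using assms(1) continuous_map_from_subtopology_mono unfolding loop_def by blast
  show "inj_on g {u..v}"
  proof (rule inj_onI)
    fix x y assume "x \<in> {u..v}" "y \<in> {u..v}" "g x = g y"
    then show "x = y" using loop_eqD[OF assms(1), of x y] assms by auto
  qed
qed

text \<open>The complementary arc passes through the base point, so it is a join of two intervals
  there.\<close>

lemma loop_outer_arc:
  assumes g: "loop X g q Q" and uv: "0 < u" "u < v" "v < 1"
  shows "arc_from X (g ` {v..1} \<union> g ` {0..u}) (g v) (g u)"
proof (rule arc_from_join)
  have g01: "g 0 = q" "g 1 = q" using g by (auto simp: loop_def)
  have "x = 1 \<and> y = 0" if "x \<in> {v..1}" "y \<in> {0..u}" "g x = g y" for x y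
    using loop_eqD[OF g, of x y] that uv by auto
  then have "g ` {v..1} \<inter> g ` {0..u} \<subseteq> {q}" using g01 by blast
  moreover have "q \<in> g ` {v..1}" using g01(2) uv by (auto intro!: rev_image_eqI[of 1])
  moreover have "q \<in> g ` {0..u}" using g01(1) uv by (auto intro!: rev_image_eqI[of 0])
  ultimately show "g ` {v..1} \<inter> g ` {0..u} = {q}" by blast
  show "arc_from X (g ` {v..1}) (g v) q" "arc_from X (g ` {0..u}) q (g u)"
    using loop_arc[OF g, of v 1] loop_arc[OF g, of 0 u] uv g01 by auto
qed

text \<open>The only repeated value is that at 0 and 1; the last two hypotheses keep it from linking
  \<open>A\<close> with \<open>B\<close>.\<close>

lemma loop_image_Int:
  assumes "loop X g q Q" "A \<subseteq> {0..1}" "B \<subseteq> {0..1}"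
    "\<not> (0 \<in> A \<and> 1 \<in> B)" "\<not> (1 \<in> A \<and> 0 \<in> B)"
  shows "g ` A \<inter> g ` B = g ` (A \<inter> B)"
proof -
  have "x = y" if "x \<in> A" "y \<in> B" "g x = g y" for x y
    using loop_eqD[OF assms(1), of x y] that assms by blast
  then show ?thesis by auto
qed

text \<open>Off the base point \<open>g\<close> is injective, so the preimage of \<open>s\<close> is
  compact and connected, hence an interval. It is not a single point because the ends of
  \<open>s\<close> differ.\<close>

lemma arc_in_loop:
  assumes X: "Hausdorff_space X" and g: "loop X g q Q" and s: "arc_from X s a b" "s \<subseteq> Q" "q \<notin> s"
  obtains u v where "0 < u" "u < v" "v < 1" "s = g ` {u..v}" "{t\<in>{0..1}. g t \<in> s} = {u..v}"
proof -
  let ?I = "{t\<in>{0..1}. g t \<in> s}"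
  have gc: "continuous_map (top_of_set {0..1}) X g" and gQ: "g ` {0..1} = Q" and g01: "g 0 = q" "g 1 = q"
    using g by (auto simp: loop_def)
  have I01: "t \<noteq> 0 \<and> t \<noteq> 1" if "t \<in> ?I" for t using that g01 s(3) by auto
  have inj: "inj_on g ?I"
  proof (rule inj_onI)
    fix x y assume xy: "x \<in> ?I" "y \<in> ?I" "g x = g y"
    then show "x = y" using loop_eqD[OF g, of x y] I01[OF xy(1)] by auto
  qed
  have "s \<subseteq> g ` {0..1}" using s gQ by simp
  note pre = connected_compact_preimage[OF X gc compact_Icc inj this arc_from_compactin[OF s(1)] arc_from_connectedin[OF s(1)]]
  then obtain u v where uv: "?I = {u..v}"
    using connected_compact_interval_1 by blast
  have im: "g ` ?I = s" using s(2) gQ by auto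
  have ab: "a \<in> s" "b \<in> s" "a \<noteq> b" using s(1) by (rule arc_from_ends)+
  have "u < v"
  proof (rule ccontr)
    assume "\<not> u < v"
    then have "{u..v} \<subseteq> {u}" by auto
    then have "s \<subseteq> {g u}" using im uv by blast
    then show False using ab by auto
  qed
  then have "u \<in> ?I" "v \<in> ?I" unfolding uv by auto
  then have "0 < u" "v < 1" using I01[of u] I01[of v] by auto
  with \<open>u < v\<close> uv im show thesis using that by metis
qed

text \<open>A circle cut into four consecutive arcs; the point listed after an arc is where it ends
  and the next one begins. For the rim of an edge, one opposite pair will be the attaching segments
  and the other pair the free sides, and a rotation by one place exchanges the pairs: this is
  duality at an edge.\<close>

definition cyclic_arcs :: "'a topology \<Rightarrow> 'a set \<Rightarrow> 'a \<Rightarrow> 'a set \<Rightarrow> 'a \<Rightarrow> 'a set \<Rightarrow> 'a \<Rightarrow> 'a set \<Rightarrow> 'a \<Rightarrow> bool" where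
  "cyclic_arcs X A a B b C c D d \<longleftrightarrow>
     arc_from X A d a \<and> arc_from X B a b \<and> arc_from X C b c \<and> arc_from X D c d \<and>
     A \<inter> B = {a} \<and> B \<inter> C = {b} \<and> C \<inter> D = {c} \<and> D \<inter> A = {d} \<and> A \<inter> C = {} \<and> B \<inter> D = {}"

lemma cyclic_arcs_rotate: "cyclic_arcs X A a B b C c D d \<Longrightarrow> cyclic_arcs X B b C c D d A a"
  unfolding cyclic_arcs_def by (simp add: Int_commute)

lemma cyclic_arcs_circle:
  assumes "cyclic_arcs X A a B b C c D d"
  shows "circle_in X (A \<union> B \<union> C \<union> D)"
proof -
  have "arc_from X (A \<union> B) d b" "arc_from X (C \<union> D) b d"
    using assms by (auto simp: cyclic_arcs_def intro!: arc_from_join)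
  moreover have "(A \<union> B) \<inter> (C \<union> D) = {d, b}"
    using assms unfolding cyclic_arcs_def by blast
  ultimately have "circle_in X ((A \<union> B) \<union> (C \<union> D))" by (rule circle_in_join)
  then show ?thesis by (simp only: Un_assoc)
qed

lemma cut_loop_two:
  assumes X: "Hausdorff_space X" and g: "loop X g q Q"
    and uv: "0 < u1" "u1 < v1" "v1 < u2" "u2 < v2" "v2 < 1"
  shows "\<exists>p0 p1 p2 p3 t1 t2. cyclic_arcs X (g ` {u1..v1}) p1 t1 p2 (g ` {u2..v2}) p3 t2 p0 \<and>
    Q = g ` {u1..v1} \<union> t1 \<union> g ` {u2..v2} \<union> t2"
proof -
  let ?s1 = "g ` {u1..v1}" and ?t1 = "g ` {v1..u2}" and ?s2 = "g ` {u2..v2}"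
  let ?t2 = "g ` {v2..1} \<union> g ` {0..u1}"
  have gQ: "g ` {0..1} = Q" using g by (simp add: loop_def)
  have a4: "arc_from X ?t2 (g v2) (g u1)" using uv by (intro loop_outer_arc[OF g]) auto
  have a: "arc_from X ?s1 (g u1) (g v1)" "arc_from X ?t1 (g v1) (g u2)" "arc_from X ?s2 (g u2) (g v2)"
    using uv by (auto intro!: loop_arc[OF g])
  have t2: "?t2 = g ` ({v2..1} \<union> {0..u1})" by (simp only: image_Un)
  have i1: "?s1 \<inter> ?t1 = {g v1}" "?t1 \<inter> ?s2 = {g u2}"
  proof -
    have "{u1..v1} \<inter> {v1..u2} = {v1}" "{v1..u2} \<inter> {u2..v2} = {u2}" using uv by auto
    then show "?s1 \<inter> ?t1 = {g v1}" "?t1 \<inter> ?s2 = {g u2}"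
      using uv by (simp_all add: loop_image_Int[OF g])
  qed
  have i2: "?s2 \<inter> ?t2 = {g v2}" "?t2 \<inter> ?s1 = {g u1}" "?t1 \<inter> ?t2 = {}" "?s1 \<inter> ?s2 = {}"
  proof -
    have "{u2..v2} \<inter> ({v2..1} \<union> {0..u1}) = {v2}" "({v2..1} \<union> {0..u1}) \<inter> {u1..v1} = {u1}"
      "{v1..u2} \<inter> ({v2..1} \<union> {0..u1}) = {}" "{u1..v1} \<inter> {u2..v2} = {}" using uv by auto
    moreover have "g ` {u2..v2} \<inter> g ` ({v2..1} \<union> {0..u1}) = g ` ({u2..v2} \<inter> ({v2..1} \<union> {0..u1}))"
      "g ` ({v2..1} \<union> {0..u1}) \<inter> g ` {u1..v1} = g ` (({v2..1} \<union> {0..u1}) \<inter> {u1..v1})"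
      "g ` {v1..u2} \<inter> g ` ({v2..1} \<union> {0..u1}) = g ` ({v1..u2} \<inter> ({v2..1} \<union> {0..u1}))"
      "g ` {u1..v1} \<inter> g ` {u2..v2} = g ` ({u1..v1} \<inter> {u2..v2})"
      using uv by (intro loop_image_Int[OF g]; auto)+
    ultimately show "?s2 \<inter> ?t2 = {g v2}" "?t2 \<inter> ?s1 = {g u1}" "?t1 \<inter> ?t2 = {}" "?s1 \<inter> ?s2 = {}"
      unfolding t2 by (simp_all only: image_insert image_empty)
  qed
  have "{0..1} = {u1..v1} \<union> {v1..u2} \<union> {u2..v2} \<union> ({v2..1} \<union> {0..u1})" using uv by auto
  then have "Q = ?s1 \<union> ?t1 \<union> ?s2 \<union> ?t2" using gQ by (simp only: image_Un[symmetric])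
  moreover have "cyclic_arcs X ?s1 (g v1) ?t1 (g u2) ?s2 (g v2) ?t2 (g u1)"
    unfolding cyclic_arcs_def using a a4 i1 i2 by (intro conjI)
  ultimately show ?thesis by blast
qed

text \<open>Finiteness makes the union of the other members closed, so it and \<open>c\<close> would
  separate a connected set that meets both.\<close>

lemma connectedin_subset_of_disjoint_closed:
  assumes "connectedin X s" "s \<noteq> {}" "s \<subseteq> \<Union>\<V>" "finite \<V>" "\<And>c. c \<in> \<V> \<Longrightarrow> closedin X c"
    "pairwise disjnt \<V>"
  obtains c where "c \<in> \<V>" "s \<subseteq> c"
proof -
  obtain x c where x: "x \<in> s" "x \<in> c" "c \<in> \<V>" using assms by blast
  let ?R = "\<Union>(\<V> - {c})"
  have "closedin X ?R" using assms by (intro closedin_Union) auto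
  moreover have "closedin X c" using x assms by blast
  moreover have "s \<subseteq> c \<union> ?R" using assms x by blast
  moreover have "c \<inter> ?R = {}" using assms(6) x(3) unfolding pairwise_def disjnt_def by blast
  moreover have "c \<inter> s \<noteq> {}" using x by blast
  ultimately have "?R \<inter> s = {}"
    using assms(1) unfolding connectedin_closedin by (metis Int_empty_left)
  then have "s \<subseteq> c" using \<open>s \<subseteq> c \<union> ?R\<close> by blast
  then show thesis using that x by blast
qed

lemma cut_circle_two:
  assumes X: "Hausdorff_space X" and Q: "circle_in X Q"
    and s1: "arc_from X s1 a1 b1" "s1 \<subseteq> Q" and s2: "arc_from X s2 a2 b2" "s2 \<subseteq> Q" and dis: "s1 \<inter> s2 = {}"
  shows "\<exists>p0 p1 p2 p3 t1 t2. cyclic_arcs X s1 p1 t1 p2 s2 p3 t2 p0 \<and> Q = s1 \<union> t1 \<union> s2 \<union> t2"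
proof -
  have conQ: "connectedin X Q"
    using Q parametrizes_connectedin connected_sphere[of "0::complex" 1] unfolding circle_in_def by auto
  have ne: "a1 \<in> s1" "a2 \<in> s2" using s1 s2 arc_from_ends(1) by metis+
  \<comment> \<open>A connected circle is not the union of two disjoint nonempty closed arcs. A
    point off both is the place to cut the circle open.\<close>
  have "Q \<noteq> s1 \<union> s2"
  proof
    assume eq: "Q = s1 \<union> s2"
    have "finite {s1, s2}" "Q \<subseteq> \<Union>{s1, s2}" "pairwise disjnt {s1, s2}" "Q \<noteq> {}"
      using eq dis ne by (auto simp: pairwise_def disjnt_def)
    moreover have "\<And>c. c \<in> {s1, s2} \<Longrightarrow> closedin X c"
      using arc_from_closedin[OF X s1(1)] arc_from_closedin[OF X s2(1)] by auto
    ultimately obtain c where "c \<in> {s1, s2}" "Q \<subseteq> c"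
      using connectedin_subset_of_disjoint_closed[OF conQ, of "{s1, s2}"] by metis
    then show False using ne eq dis by blast
  qed
  then obtain q where q: "q \<in> Q" "q \<notin> s1" "q \<notin> s2" using s1 s2 by blast
  obtain g where g: "loop X g q Q" using circle_in_loop[OF Q q(1)] .
  obtain u1 v1 where 1: "0 < u1" "u1 < v1" "v1 < 1" "s1 = g ` {u1..v1}" "{t\<in>{0..1}. g t \<in> s1} = {u1..v1}"
    using arc_in_loop[OF X g s1 q(2)] .
  obtain u2 v2 where 2: "0 < u2" "u2 < v2" "v2 < 1" "s2 = g ` {u2..v2}" "{t\<in>{0..1}. g t \<in> s2} = {u2..v2}"
    using arc_in_loop[OF X g s2 q(3)] .
  have "{u1..v1} \<inter> {u2..v2} = {}" using 1(5) 2(5) dis by blast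
  then have "v1 < u2 \<or> v2 < u1"
    using 1(2) 2(2) by (cases "u1 \<le> u2") (auto simp: disjoint_iff not_le dest: spec[of _ u1] spec[of _ u2])
  then show ?thesis
  proof
    assume "v1 < u2"
    then show ?thesis using cut_loop_two[OF X g 1(1,2) _ 2(2,3)] unfolding 1(4) 2(4) by blast
  next
    \<comment> \<open>Here \<open>s2\<close> comes first on the loop; a half turn of the cyclic
      order puts \<open>s1\<close> in front.\<close>
    assume "v2 < u1"
    then obtain p0 p1 p2 p3 t1 t2 where c: "cyclic_arcs X s2 p1 t1 p2 s1 p3 t2 p0" "Q = s2 \<union> t1 \<union> s1 \<union> t2"
      using cut_loop_two[OF X g 2(1,2) _ 1(2,3)] unfolding 1(4) 2(4) by blast
    have "cyclic_arcs X s1 p3 t2 p0 s2 p1 t1 p2"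
      by (rule cyclic_arcs_rotate[OF cyclic_arcs_rotate[OF c(1)]])
    moreover have "Q = s1 \<union> t2 \<union> s2 \<union> t1" using c(2) by blast
    ultimately show ?thesis by blast
  qed
qed

text \<open>An arc is contractible and a circle is not. It follows that an arc on a circle always
  misses a point that can serve as base point.\<close>

lemma circle_not_arc:
  assumes X: "Hausdorff_space X" and "circle_in X Q" "arc_from X Q a b"
  shows False
proof -
  obtain h p where "parametrizes X (sphere (0::complex) 1) h Q" "parametrizes X {0..1::real} p Q"
    using assms unfolding circle_in_def arc_from_def by blast
  then have "homeomorphic_map (top_of_set (sphere (0::complex) 1)) (subtopology X Q) h"
    "homeomorphic_map (top_of_set {0..1::real}) (subtopology X Q) p"
    using parametrizes_homeomorphic_map[OF X compact_sphere] parametrizes_homeomorphic_map[OF X compact_Icc]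
    by blast+
  then have 1: "top_of_set (sphere (0::complex) 1) homeomorphic_space subtopology X Q"
    and 2: "top_of_set {0..1::real} homeomorphic_space subtopology X Q"
    using homeomorphic_space by blast+
  have "contractible_space (top_of_set (sphere (0::complex) 1)) \<longleftrightarrow> contractible_space (top_of_set {0..1::real})"
    using homeomorphic_space_contractibility[OF 1] homeomorphic_space_contractibility[OF 2] by (simp only:)
  moreover have "contractible {0..1::real}" by (simp add: convex_imp_contractible)
  ultimately show False by (simp add: contractible_sphere)
qed

lemma cut_circle_one:
  assumes X: "Hausdorff_space X" and Q: "circle_in X Q" and s: "arc_from X s a b" "s \<subseteq> Q"
  shows "\<exists>t. arc_from X t a b \<and> Q = s \<union> t \<and> s \<inter> t = {a, b}"
proof -
  have "Q \<noteq> s" using circle_not_arc[OF X Q] s by blast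
  then obtain q where q: "q \<in> Q" "q \<notin> s" using s by blast
  obtain g where g: "loop X g q Q" using circle_in_loop[OF Q q(1)] .
  obtain u v where 1: "0 < u" "u < v" "v < 1" "s = g ` {u..v}" "{t\<in>{0..1}. g t \<in> s} = {u..v}"
    using arc_in_loop[OF X g s q(2)] .
  have gQ: "g ` {0..1} = Q" using g by (simp add: loop_def)
  let ?t = "g ` {v..1} \<union> g ` {0..u}"
  have t: "arc_from X ?t (g v) (g u)" by (rule loop_outer_arc[OF g 1(1-3)])
  have "{0..1} = {u..v} \<union> ({v..1} \<union> {0..u})" using 1(1-3) by auto
  then have Qe: "Q = s \<union> ?t" using gQ unfolding 1(4) by (simp only: image_Un[symmetric])
  have st: "s \<inter> ?t = {g u, g v}"
  proof -
    have "{u..v} \<inter> ({v..1} \<union> {0..u}) = {u, v}" using 1(1-3) by auto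
    moreover have "g ` {u..v} \<inter> g ` ({v..1} \<union> {0..u}) = g ` ({u..v} \<inter> ({v..1} \<union> {0..u}))"
      using 1(1-3) by (intro loop_image_Int[OF g]) auto
    ultimately show ?thesis unfolding 1(4) by (simp only: image_insert image_empty image_Un[symmetric])
  qed
  have "arc_from X s (g u) (g v)" unfolding 1(4) using 1(1-3) by (intro loop_arc[OF g]) auto
  then have "a = g u \<and> b = g v \<or> a = g v \<and> b = g u"
    using arc_from_ends_unique[OF X _ s(1)] by metis
  then show ?thesis
  proof
    assume "a = g u \<and> b = g v"
    then show ?thesis using arc_from_sym[OF t] Qe st by (intro exI[of _ ?t]) simp
  next
    assume "a = g v \<and> b = g u"
    then show ?thesis using t Qe st by (intro exI[of _ ?t]) (simp add: insert_commute)
  qed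
qed

section \<open>Families of disjoint circles\<close>

definition circles :: "'a topology \<Rightarrow> 'a set set \<Rightarrow> bool" where
  "circles X \<V> \<longleftrightarrow> finite \<V> \<and> (\<forall>c\<in>\<V>. circle_in X c) \<and> pairwise disjnt \<V>"

lemma circle_in_closedin: "Hausdorff_space X \<Longrightarrow> circle_in X c \<Longrightarrow> closedin X c"
  unfolding circle_in_def using parametrizes_closedin[OF _ _ compact_sphere] by blast

lemma circle_in_compactin: "circle_in X c \<Longrightarrow> compactin X c"
  unfolding circle_in_def using parametrizes_compactin[OF _ compact_sphere] by blast

lemma circle_in_connectedin: "circle_in X c \<Longrightarrow> connectedin X c"
  unfolding circle_in_def using parametrizes_connectedin connected_sphere[of "0::complex" 1] by auto

lemma circle_in_nonempty: "circle_in X c \<Longrightarrow> c \<noteq> {}"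
  unfolding circle_in_def parametrizes_def by auto

lemma circles_unique:
  "circles X \<V> \<Longrightarrow> c \<in> \<V> \<Longrightarrow> d \<in> \<V> \<Longrightarrow> x \<in> c \<Longrightarrow> x \<in> d \<Longrightarrow> c = d"
  unfolding circles_def pairwise_def disjnt_def by blast

text \<open>A finite disjoint family of circles is recovered from its union. Equations between
  families therefore reduce to equations between point sets, which carries all later computations of
  boundary circles.\<close>

lemma connected_components_of_circles:
  assumes X: "Hausdorff_space X" and V: "circles X \<V>"
  shows "connected_components_of (subtopology X (\<Union>\<V>)) = \<V>"
proof -
  let ?Y = "subtopology X (\<Union>\<V>)"
  have sub: "\<Union>\<V> \<subseteq> topspace X"
    using V circle_in_closedin[OF X] closedin_subset unfolding circles_def by blast
  have comp: "connected_component_of_set ?Y x = c" if c: "c \<in> \<V>" "x \<in> c" for c x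
  proof
    have "x \<in> topspace ?Y" using c sub by auto
    then have xin: "x \<in> connected_component_of_set ?Y x" by (simp add: connected_component_of_refl)
    have con: "connectedin ?Y (connected_component_of_set ?Y x)"
      by (rule connectedin_connected_component_of)
    then have 1: "connectedin X (connected_component_of_set ?Y x)"
      "connected_component_of_set ?Y x \<subseteq> \<Union>\<V>" by (simp_all only: connectedin_subtopology)
    obtain d where "d \<in> \<V>" "connected_component_of_set ?Y x \<subseteq> d"
    proof (rule connectedin_subset_of_disjoint_closed[OF 1(1) _ 1(2)])
      show "connected_component_of_set ?Y x \<noteq> {}" using xin by blast
    qed (use V circle_in_closedin[OF X] in \<open>auto simp: circles_def\<close>)
    then show "connected_component_of_set ?Y x \<subseteq> c"
      using circles_unique[OF V] c xin by blast
    show "c \<subseteq> connected_component_of_set ?Y x"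
      by (rule connected_component_of_maximal)
        (use V c circle_in_connectedin in \<open>auto simp: connectedin_subtopology circles_def\<close>)
  qed
  have "topspace ?Y = \<Union>\<V>" using sub by auto
  then have "connected_components_of ?Y = (\<lambda>x. connected_component_of_set ?Y x) ` \<Union>\<V>"
    unfolding connected_components_of_def by simp
  also have "\<dots> = \<V>"
  proof (intro equalityI subsetI)
    fix c assume "c \<in> (\<lambda>x. connected_component_of_set ?Y x) ` \<Union>\<V>"
    then show "c \<in> \<V>" using comp by auto
  next
    fix c assume c: "c \<in> \<V>"
    then obtain x where "x \<in> c" using V circle_in_nonempty unfolding circles_def by blast
    then show "c \<in> (\<lambda>x. connected_component_of_set ?Y x) ` \<Union>\<V>" using comp c by blast
  qed
  finally show ?thesis .
qed

section \<open>Exchanging arcs along an edge\<close>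

lemma circles_singleton: "circle_in X c \<Longrightarrow> circles X {c}"
  by (simp add: circles_def)

lemma circles_Un:
  assumes "circles X \<V>" "circles X \<W>" "\<Union>\<V> \<inter> \<Union>\<W> = {}"
  shows "circles X (\<V> \<union> \<W>)"
proof -
  have "pairwise disjnt (\<V> \<union> \<W>)"
  proof (rule pairwiseI)
    fix c d assume cd: "c \<in> \<V> \<union> \<W>" "d \<in> \<V> \<union> \<W>" "c \<noteq> d"
    then consider "c \<in> \<V> \<and> d \<in> \<V>" | "c \<in> \<W> \<and> d \<in> \<W>" | "c \<in> \<V> \<and> d \<in> \<W>" | "c \<in> \<W> \<and> d \<in> \<V>" by blast
    then show "disjnt c d"
    proof cases
      case 1 then show ?thesis using assms(1) cd by (auto simp: circles_def pairwise_def)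
    next
      case 2 then show ?thesis using assms(2) cd by (auto simp: circles_def pairwise_def)
    next
      case 3 then show ?thesis using assms(3) unfolding disjnt_def by blast
    next
      case 4 then show ?thesis using assms(3) unfolding disjnt_def by blast
    qed
  qed
  then show ?thesis using assms by (auto simp: circles_def)
qed

lemma circles_subset: "circles X \<V> \<Longrightarrow> \<W> \<subseteq> \<V> \<Longrightarrow> circles X \<W>"
  unfolding circles_def by (meson finite_subset pairwise_subset subsetD)

text \<open>The three cases are the three ways in which two arcs can match four corners. If
  \<open>u1\<close>, \<open>u2\<close> match them as \<open>t1\<close>, \<open>t2\<close> do, two
  circles close up, otherwise one. For a contracted edge the cases are, in this order, an orientable
  loop, a non-orientable loop and a non-loop.\<close>

lemma four_arcs_circles:
  assumes t1: "arc_from X t1 p1 p2" and t2: "arc_from X t2 p3 p0" and t: "t1 \<inter> t2 = {}"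
    and u: "u1 \<inter> u2 = {}" and m: "(u1 \<union> u2) \<inter> (t1 \<union> t2) = {p0, p1, p2, p3}"
    and cas: "arc_from X u1 p1 p2 \<and> arc_from X u2 p3 p0 \<or> arc_from X u1 p1 p3 \<and> arc_from X u2 p0 p2 \<or>
      arc_from X u1 p1 p0 \<and> arc_from X u2 p3 p2"
  shows "\<exists>\<N>. circles X \<N> \<and> \<Union>\<N> = u1 \<union> u2 \<union> t1 \<union> t2"
proof -
  have tm: "p1 \<in> t1" "p2 \<in> t1" "p3 \<in> t2" "p0 \<in> t2"
    using arc_from_ends(1,2)[OF t1] arc_from_ends(1,2)[OF t2] by auto
  then have tn: "p1 \<notin> t2" "p2 \<notin> t2" "p3 \<notin> t1" "p0 \<notin> t1" using t by auto
  have k: "S \<inter> T = {p0, p1, p2, p3} \<inter> (S \<inter> T)" if "S \<subseteq> u1 \<union> u2" "T \<subseteq> t1 \<union> t2" for S T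
    unfolding m[symmetric] using that by blast
  have k4: "u1 \<inter> t1 = {p0, p1, p2, p3} \<inter> (u1 \<inter> t1)" "u1 \<inter> t2 = {p0, p1, p2, p3} \<inter> (u1 \<inter> t2)"
    "u2 \<inter> t1 = {p0, p1, p2, p3} \<inter> (u2 \<inter> t1)" "u2 \<inter> t2 = {p0, p1, p2, p3} \<inter> (u2 \<inter> t2)"
    by (rule k; blast)+
  from cas show ?thesis
  proof (elim disjE conjE)
    assume a: "arc_from X u1 p1 p2" "arc_from X u2 p3 p0"
    have um: "p1 \<in> u1" "p2 \<in> u1" "p3 \<in> u2" "p0 \<in> u2"
      using arc_from_ends(1,2)[OF a(1)] arc_from_ends(1,2)[OF a(2)] by auto
    then have un: "p1 \<notin> u2" "p2 \<notin> u2" "p3 \<notin> u1" "p0 \<notin> u1" using u by auto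
    have i: "u1 \<inter> t1 = {p1, p2}" "u2 \<inter> t2 = {p3, p0}" "u1 \<inter> t2 = {}" "u2 \<inter> t1 = {}"
      by (subst k4, simp add: tm tn um un Int_insert_left insert_commute)+
    have "circle_in X (u1 \<union> t1)" "circle_in X (u2 \<union> t2)"
      using circle_in_join[OF a(1) arc_from_sym[OF t1] i(1)] circle_in_join[OF a(2) arc_from_sym[OF t2] i(2)]
      by auto
    moreover have "\<Union>{u1 \<union> t1} \<inter> \<Union>{u2 \<union> t2} = {}"
      using i u t by (simp add: Int_Un_distrib Int_Un_distrib2 Int_commute)
    ultimately have "circles X ({u1 \<union> t1} \<union> {u2 \<union> t2})"
      by (intro circles_Un circles_singleton)
    then show ?thesis by (intro exI[of _ "{u1 \<union> t1} \<union> {u2 \<union> t2}"]) auto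
  next
    assume a: "arc_from X u1 p1 p3" "arc_from X u2 p0 p2"
    have um: "p1 \<in> u1" "p3 \<in> u1" "p2 \<in> u2" "p0 \<in> u2"
      using arc_from_ends(1,2)[OF a(1)] arc_from_ends(1,2)[OF a(2)] by auto
    then have un: "p1 \<notin> u2" "p3 \<notin> u2" "p2 \<notin> u1" "p0 \<notin> u1" using u by auto
    have "u1 \<inter> t2 = {p3}" "u2 \<inter> t2 = {p0}" "u2 \<inter> t1 = {p2}" "u1 \<inter> t1 = {p1}"
      by (subst k4, simp add: tm tn um un Int_insert_left insert_commute)+
    then have "u1 \<inter> t2 = {p3}" "t2 \<inter> u2 = {p0}" "u2 \<inter> t1 = {p2}" "t1 \<inter> u1 = {p1}" "t2 \<inter> t1 = {}"
      using t by (simp_all add: Int_commute)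
    then have "cyclic_arcs X u1 p3 t2 p0 u2 p2 t1 p1"
      unfolding cyclic_arcs_def using a t2 arc_from_sym[OF t1] u by simp
    then have "circle_in X (u1 \<union> t2 \<union> u2 \<union> t1)" by (rule cyclic_arcs_circle)
    then show ?thesis using circles_singleton by (intro exI[of _ "{u1 \<union> t2 \<union> u2 \<union> t1}"]) auto
  next
    assume a: "arc_from X u1 p1 p0" "arc_from X u2 p3 p2"
    have um: "p1 \<in> u1" "p0 \<in> u1" "p2 \<in> u2" "p3 \<in> u2"
      using arc_from_ends(1,2)[OF a(1)] arc_from_ends(1,2)[OF a(2)] by auto
    then have un: "p1 \<notin> u2" "p0 \<notin> u2" "p2 \<notin> u1" "p3 \<notin> u1" using u by auto
    have "u1 \<inter> t2 = {p0}" "u2 \<inter> t2 = {p3}" "u2 \<inter> t1 = {p2}" "u1 \<inter> t1 = {p1}"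
      by (subst k4, simp add: tm tn um un Int_insert_left insert_commute)+
    then have "u1 \<inter> t2 = {p0}" "t2 \<inter> u2 = {p3}" "u2 \<inter> t1 = {p2}" "t1 \<inter> u1 = {p1}" "t2 \<inter> t1 = {}"
      using t by (simp_all add: Int_commute)
    then have "cyclic_arcs X u1 p0 t2 p3 u2 p2 t1 p1"
      unfolding cyclic_arcs_def using a arc_from_sym[OF t2] arc_from_sym[OF t1] u by simp
    then have "circle_in X (u1 \<union> t2 \<union> u2 \<union> t1)" by (rule cyclic_arcs_circle)
    then show ?thesis using circles_singleton by (intro exI[of _ "{u1 \<union> t2 \<union> u2 \<union> t1}"]) auto
  qed
qed

text \<open>Only the circles through \<open>s1\<close> and \<open>s2\<close>, two or one of them,
  are affected. Cutting these arcs out leaves two arcs between the four corners, which close up with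
  \<open>t1\<close> and \<open>t2\<close>.\<close>

lemma circles_surgery:
  assumes X: "Hausdorff_space X" and V: "circles X \<V>"
    and cyc: "cyclic_arcs X s1 p1 t1 p2 s2 p3 t2 p0"
    and m: "\<Union>\<V> \<inter> (s1 \<union> t1 \<union> s2 \<union> t2) = s1 \<union> s2"
  shows "\<exists>\<W>. circles X \<W> \<and> \<Union>\<W> = (\<Union>\<V> - (s1 \<union> s2)) \<union> (t1 \<union> t2)"
proof -
  have s1: "arc_from X s1 p0 p1" and t1: "arc_from X t1 p1 p2" and s2: "arc_from X s2 p2 p3"
    and t2: "arc_from X t2 p3 p0" and tt: "t1 \<inter> t2 = {}" and ss: "s1 \<inter> s2 = {}"
    and st: "s1 \<inter> t1 = {p1}" "t1 \<inter> s2 = {p2}" "s2 \<inter> t2 = {p3}" "t2 \<inter> s1 = {p0}"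
    using cyc unfolding cyclic_arcs_def by auto
  have pm: "p0 \<in> s1" "p1 \<in> s1" "p2 \<in> s2" "p3 \<in> s2" using st by auto
  have clo: "\<And>c. c \<in> \<V> \<Longrightarrow> closedin X c" and fin: "finite \<V>" and dis: "pairwise disjnt \<V>"
    using V circle_in_closedin[OF X] by (auto simp: circles_def)
  have ne: "s1 \<noteq> {}" "s2 \<noteq> {}" using pm by auto
  have sub: "s1 \<subseteq> \<Union>\<V>" "s2 \<subseteq> \<Union>\<V>" using m by blast+
  obtain c1 where c1: "c1 \<in> \<V>" "s1 \<subseteq> c1"
    using connectedin_subset_of_disjoint_closed[OF arc_from_connectedin[OF s1] ne(1) sub(1) fin clo dis] by blast
  obtain c2 where c2: "c2 \<in> \<V>" "s2 \<subseteq> c2"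
    using connectedin_subset_of_disjoint_closed[OF arc_from_connectedin[OF s2] ne(2) sub(2) fin clo dis] by blast
  have circ: "circle_in X c1" "circle_in X c2" using V c1 c2 by (auto simp: circles_def)
  \<comment> \<open>The remainders \<open>u1\<close> and \<open>u2\<close> of the old circles, with
    the matching of corners that they realise. On two different circles each remainder returns to
    the same segment; on one circle they connect \<open>s1\<close> with \<open>s2\<close>.\<close>
  have "\<exists>u1 u2. u1 \<inter> u2 = {} \<and> u1 \<union> u2 \<union> (s1 \<union> s2) = c1 \<union> c2 \<and>
      (u1 \<union> u2) \<inter> (s1 \<union> s2) = {p0, p1, p2, p3} \<and>
      (arc_from X u1 p1 p2 \<and> arc_from X u2 p3 p0 \<or> arc_from X u1 p1 p3 \<and> arc_from X u2 p0 p2 \<or>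
       arc_from X u1 p1 p0 \<and> arc_from X u2 p3 p2)" (is "\<exists>u1 u2. ?P u1 u2")
  proof (cases "c1 = c2")
    case False
    then have c12: "c1 \<inter> c2 = {}" using dis c1 c2 by (auto simp: pairwise_def disjnt_def)
    obtain u1 where u1: "arc_from X u1 p0 p1" "c1 = s1 \<union> u1" "s1 \<inter> u1 = {p0, p1}"
      using cut_circle_one[OF X circ(1) s1 c1(2)] by blast
    obtain u2 where u2: "arc_from X u2 p2 p3" "c2 = s2 \<union> u2" "s2 \<inter> u2 = {p2, p3}"
      using cut_circle_one[OF X circ(2) s2 c2(2)] by blast
    have "?P u1 u2"
    proof (intro conjI disjI2)
      show "u1 \<inter> u2 = {}" "u1 \<union> u2 \<union> (s1 \<union> s2) = c1 \<union> c2" using c12 u1(2) u2(2) by blast+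
      have "u1 \<inter> s2 = {}" "u2 \<inter> s1 = {}" using c12 u1(2) u2(2) by blast+
      then show "(u1 \<union> u2) \<inter> (s1 \<union> s2) = {p0, p1, p2, p3}" using u1(3) u2(3) by blast
    qed (rule arc_from_sym, fact)+
    then show ?thesis by blast
  next
    case True
    obtain r0 r1 r2 r3 u1 u2 where r: "cyclic_arcs X s1 r1 u1 r2 s2 r3 u2 r0" "c1 = s1 \<union> u1 \<union> s2 \<union> u2"
      using cut_circle_two[OF X circ(1) s1 c1(2) s2 _ ss] c2 True by blast
    have a: "arc_from X s1 r0 r1" "arc_from X u1 r1 r2" "arc_from X s2 r2 r3" "arc_from X u2 r3 r0"
      and i: "s1 \<inter> u1 = {r1}" "u1 \<inter> s2 = {r2}" "s2 \<inter> u2 = {r3}" "u2 \<inter> s1 = {r0}" "u1 \<inter> u2 = {}"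
      using r(1) unfolding cyclic_arcs_def by auto
    \<comment> \<open>The cut of the vertex circle has its own cyclic order, so it may run through
      \<open>s1\<close> and \<open>s2\<close> in either direction compared with the rim of the edge.
      If both directions agree or both are reversed, the loop is orientable; if exactly one is
      reversed, it is not.\<close>
    have e1: "p0 = r0 \<and> p1 = r1 \<or> p0 = r1 \<and> p1 = r0"
      using arc_from_ends_unique[OF X s1 a(1)] .
    have e2: "p2 = r2 \<and> p3 = r3 \<or> p2 = r3 \<and> p3 = r2"
      using arc_from_ends_unique[OF X s2 a(3)] .
    have "(u1 \<union> u2) \<inter> (s1 \<union> s2) = {r0, r1, r2, r3}" using i by blast
    moreover have "{r0, r1, r2, r3} = {p0, p1, p2, p3}" using e1 e2 by auto
    moreover have "u1 \<union> u2 \<union> (s1 \<union> s2) = c1 \<union> c2" using r(2) True by blast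
    ultimately have b: "u1 \<union> u2 \<union> (s1 \<union> s2) = c1 \<union> c2" "u2 \<union> u1 \<union> (s1 \<union> s2) = c1 \<union> c2"
      "(u1 \<union> u2) \<inter> (s1 \<union> s2) = {p0, p1, p2, p3}" "(u2 \<union> u1) \<inter> (s1 \<union> s2) = {p0, p1, p2, p3}"
      "u1 \<inter> u2 = {}" "u2 \<inter> u1 = {}"
      using i(5) by (simp_all add: Un_commute Int_commute)
    show ?thesis
    proof (cases "p0 = r0 \<and> p1 = r1")
      case p: True
      show ?thesis
      proof (cases "p2 = r2 \<and> p3 = r3")
        case True
        then have "?P u1 u2" using b a p by simp
        then show ?thesis by blast
      next
        case False
        then have "p2 = r3" "p3 = r2" using e2 by auto
        then have "?P u1 u2" using b a(2) arc_from_sym[OF a(4)] p by simp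
        then show ?thesis by blast
      qed
    next
      case p: False
      show ?thesis
      proof (cases "p2 = r2 \<and> p3 = r3")
        case True
        have "p0 = r1" "p1 = r0" using p e1 by auto
        then have "?P u2 u1" using b a(2) arc_from_sym[OF a(4)] True by simp
        then show ?thesis by blast
      next
        case False
        then have "p2 = r3" "p3 = r2" "p0 = r1" "p1 = r0" using p e1 e2 by auto
        then have "?P u2 u1" using b arc_from_sym[OF a(2)] arc_from_sym[OF a(4)] by simp
        then show ?thesis by blast
      qed
    qed
  qed
  then obtain u1 u2 where u: "u1 \<inter> u2 = {}" "u1 \<union> u2 \<union> (s1 \<union> s2) = c1 \<union> c2"
    "(u1 \<union> u2) \<inter> (s1 \<union> s2) = {p0, p1, p2, p3}"
    and cas: "arc_from X u1 p1 p2 \<and> arc_from X u2 p3 p0 \<or> arc_from X u1 p1 p3 \<and> arc_from X u2 p0 p2 \<or>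
       arc_from X u1 p1 p0 \<and> arc_from X u2 p3 p2" by (elim exE conjE) rule
  have uV: "u1 \<union> u2 \<subseteq> \<Union>\<V>" using u(2) c1(1) c2(1) by blast
  have ut: "(u1 \<union> u2) \<inter> (t1 \<union> t2) = {p0, p1, p2, p3}"
  proof
    show "(u1 \<union> u2) \<inter> (t1 \<union> t2) \<subseteq> {p0, p1, p2, p3}" using uV m u(3) by blast
    show "{p0, p1, p2, p3} \<subseteq> (u1 \<union> u2) \<inter> (t1 \<union> t2)" using u(3) st by blast
  qed
  obtain \<N> where N: "circles X \<N>" "\<Union>\<N> = u1 \<union> u2 \<union> t1 \<union> t2"
    using four_arcs_circles[OF t1 t2 tt u(1) ut cas] by blast
  let ?R = "\<V> - {c1, c2}"
  have R: "\<Union>?R \<inter> (c1 \<union> c2) = {}" using dis c1(1) c2(1) unfolding pairwise_def disjnt_def by blast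
  have Rt: "\<Union>?R \<inter> (t1 \<union> t2) = {}"
  proof -
    have "\<Union>?R \<inter> (t1 \<union> t2) \<subseteq> s1 \<union> s2" using m by blast
    then show ?thesis using R c1(2) c2(2) by blast
  qed
  have "circles X (\<N> \<union> ?R)"
  proof (rule circles_Un[OF N(1) circles_subset[OF V]])
    show "\<Union>\<N> \<inter> \<Union>?R = {}" unfolding N(2) using R Rt u(2) by blast
  qed blast
  moreover have "\<Union>(\<N> \<union> ?R) = (\<Union>\<V> - (s1 \<union> s2)) \<union> (t1 \<union> t2)"
  proof -
    have V2: "\<Union>\<V> = (c1 \<union> c2) \<union> \<Union>?R" using c1 c2 by blast
    have "c1 \<union> c2 - (s1 \<union> s2) \<subseteq> u1 \<union> u2" using u(2) by blast
    \<comment> \<open>The four corners are removed with \<open>s1\<close>, \<open>s2\<close> and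
      come back with \<open>t1\<close>, \<open>t2\<close>.\<close>
    moreover have "(u1 \<union> u2) \<inter> (s1 \<union> s2) \<subseteq> t1 \<union> t2" unfolding u(3) ut[symmetric] by blast
    then have "u1 \<union> u2 \<subseteq> (c1 \<union> c2 - (s1 \<union> s2)) \<union> (t1 \<union> t2)" using u(2) by blast
    moreover have "\<Union>?R - (s1 \<union> s2) = \<Union>?R" using R c1(2) c2(2) by blast
    ultimately show ?thesis unfolding Union_Un_distrib N(2) V2 by blast
  qed
  ultimately show ?thesis by blast
qed

section \<open>Skeletons\<close>

definition rim :: "'a topology \<Rightarrow> 'a set \<Rightarrow> 'a set" where
  "rim X D = surface_boundary (subtopology X D)"

definition attached :: "'a topology \<Rightarrow> 'a set \<Rightarrow> 'a set \<Rightarrow> bool" where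
  "attached X A e \<longleftrightarrow> (\<exists>s1 p1 t1 p2 s2 p3 t2 p0. cyclic_arcs X s1 p1 t1 p2 s2 p3 t2 p0 \<and>
     rim X e = s1 \<union> t1 \<union> s2 \<union> t2 \<and> A \<inter> e = s1 \<union> s2)"

text \<open>The closure yields the two complementary arcs including their corners, without the
  choice of a cut of the rim.\<close>

definition sides :: "'a topology \<Rightarrow> 'a set \<Rightarrow> 'a set \<Rightarrow> 'a set" where
  "sides X A e = X closure_of (rim X e - A)"

lemma attachedE:
  assumes "attached X A e"
  obtains s1 p1 t1 p2 s2 p3 t2 p0 where "cyclic_arcs X s1 p1 t1 p2 s2 p3 t2 p0"
    "rim X e = s1 \<union> t1 \<union> s2 \<union> t2" "A \<inter> e = s1 \<union> s2"
  using assms unfolding attached_def by (elim exE conjE) (rule that)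

lemma rim_subset: "rim X D \<subseteq> D"
  unfolding rim_def surface_boundary_def by auto

lemma sides_eq:
  assumes X: "Hausdorff_space X" and cyc: "cyclic_arcs X s1 p1 t1 p2 s2 p3 t2 p0"
    and e: "rim X e = s1 \<union> t1 \<union> s2 \<union> t2" "A \<inter> e = s1 \<union> s2"
  shows "sides X A e = t1 \<union> t2"
proof -
  have t1: "arc_from X t1 p1 p2" and t2: "arc_from X t2 p3 p0" and tt: "t1 \<inter> t2 = {}"
    and st: "s1 \<inter> t1 = {p1}" "t1 \<inter> s2 = {p2}" "s2 \<inter> t2 = {p3}" "t2 \<inter> s1 = {p0}"
    using cyc unfolding cyclic_arcs_def by auto
  have "rim X e - A = rim X e - (s1 \<union> s2)" using e(2) rim_subset[of X e] by blast
  also have "\<dots> = (t1 - {p1, p2}) \<union> (t2 - {p3, p0})" unfolding e(1) using st by blast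
  finally have "sides X A e = X closure_of (t1 - {p1, p2}) \<union> X closure_of (t2 - {p3, p0})"
    unfolding sides_def by (simp only: closure_of_Un)
  moreover have "X closure_of (t1 - {p1, p2}) = t1"
    using arc_from_subset_closure[OF t1] closure_of_minimal[OF _ arc_from_closedin[OF X t1]] by blast
  moreover have "X closure_of (t2 - {p3, p0}) = t2"
    using arc_from_subset_closure[OF t2] closure_of_minimal[OF _ arc_from_closedin[OF X t2]] by blast
  ultimately show ?thesis by simp
qed

lemma sides_subset:
  assumes "Hausdorff_space X" "attached X A e"
  shows "sides X A e \<subseteq> e"
proof -
  obtain s1 p1 t1 p2 s2 p3 t2 p0 where c: "cyclic_arcs X s1 p1 t1 p2 s2 p3 t2 p0"
     "rim X e = s1 \<union> t1 \<union> s2 \<union> t2" "A \<inter> e = s1 \<union> s2"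
    using assms(2) by (rule attachedE)
  show ?thesis using sides_eq[OF assms(1) c] c(2) rim_subset[of X e] by blast
qed

text \<open>Rotating the cut of the rim by one place turns the sides into attaching segments and the
  segments into sides. This local involution is behind the double dual.\<close>

lemma attached_dual:
  assumes X: "Hausdorff_space X" and e: "attached X A e" and B: "B \<inter> e = sides X A e"
  shows "attached X B e" "sides X B e = A \<inter> e"
proof -
  obtain s1 p1 t1 p2 s2 p3 t2 p0 where c: "cyclic_arcs X s1 p1 t1 p2 s2 p3 t2 p0"
     "rim X e = s1 \<union> t1 \<union> s2 \<union> t2" "A \<inter> e = s1 \<union> s2"
    using e by (rule attachedE)
  have 1: "cyclic_arcs X t1 p2 s2 p3 t2 p0 s1 p1" using cyclic_arcs_rotate[OF c(1)] .
  have 2: "rim X e = t1 \<union> s2 \<union> t2 \<union> s1" using c(2) by blast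
  have 3: "B \<inter> e = t1 \<union> t2" using B sides_eq[OF X c] by simp
  show "attached X B e" unfolding attached_def using 1 2 3 by blast
  show "sides X B e = A \<inter> e" using sides_eq[OF X 1 2 3] c(3) by blast
qed

lemma attached_cong: "A \<inter> e = B \<inter> e \<Longrightarrow> attached X A e = attached X B e"
  unfolding attached_def by simp

lemma sides_cong:
  assumes "A \<inter> e = B \<inter> e" shows "sides X A e = sides X B e"
proof -
  have "rim X e - A = rim X e - B" using assms rim_subset[of X e] by blast
  then show ?thesis unfolding sides_def by simp
qed

text \<open>Edges are kept as discs while a vertex is reduced to its boundary circle. In this form
  vertices and boundary components have the same nature, and duality acts inside one space.\<close>

definition skeleton :: "'a topology \<Rightarrow> 'a set set \<Rightarrow> 'a set set \<Rightarrow> bool" where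
  "skeleton X \<V> \<E> \<longleftrightarrow> Hausdorff_space X \<and> circles X \<V> \<and> finite \<E> \<and> pairwise disjnt \<E> \<and>
     (\<forall>e\<in>\<E>. closed_disc_in X e \<and> attached X (\<Union>\<V>) e)"

lemma skeletonD:
  assumes "skeleton X \<V> \<E>"
  shows "Hausdorff_space X" "circles X \<V>" "finite \<E>" "e \<in> \<E> \<Longrightarrow> closed_disc_in X e"
    "e \<in> \<E> \<Longrightarrow> attached X (\<Union>\<V>) e"
  using assms by (auto simp: skeleton_def)

lemma skeleton_disjoint:
  "skeleton X \<V> \<E> \<Longrightarrow> e \<in> \<E> \<Longrightarrow> f \<in> \<E> \<Longrightarrow> e \<noteq> f \<Longrightarrow> e \<inter> f = {}"
  by (simp add: skeleton_def pairwise_def disjnt_def)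

lemma skeleton_sides_subset:
  "skeleton X \<V> \<E> \<Longrightarrow> e \<in> \<E> \<Longrightarrow> sides X (\<Union>\<V>) e \<subseteq> e"
  using sides_subset skeletonD(1,5) by metis

text \<open>For a subset of the edges this is the result of exchanging arcs at these edges alone,
  which gives the intermediate stages between the vertex circles and the boundary.\<close>

definition free_boundary :: "'a topology \<Rightarrow> 'a set \<Rightarrow> 'a set set \<Rightarrow> 'a set" where
  "free_boundary X A \<E> = (A - \<Union>\<E>) \<union> (\<Union>e\<in>\<E>. sides X A e)"

definition boundary_circles :: "'a topology \<Rightarrow> 'a set set \<Rightarrow> 'a set set \<Rightarrow> 'a set set" where
  "boundary_circles X \<V> \<E> = connected_components_of (subtopology X (free_boundary X (\<Union>\<V>) \<E>))"

lemma skeleton_subset: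
  assumes "skeleton X \<V> \<E>" "\<V>' \<subseteq> \<V>" "\<E>' \<subseteq> \<E>" "\<And>e. e \<in> \<E>' \<Longrightarrow> \<Union>\<V>' \<inter> e = \<Union>\<V> \<inter> e"
  shows "skeleton X \<V>' \<E>'"
proof -
  have "attached X (\<Union>\<V>') e" if "e \<in> \<E>'" for e
    using assms attached_cong[OF assms(4)[OF that]] that unfolding skeleton_def by auto
  then show ?thesis
    using assms circles_subset[of X \<V> \<V>'] unfolding skeleton_def
    by (auto intro: finite_subset elim: pairwise_subset)
qed

lemma free_boundary_insert_inter:
  assumes sk: "skeleton X \<V> \<E>" and "F \<subseteq> \<E>" "e \<in> \<E>" "e \<notin> F"
  shows "free_boundary X (\<Union>\<V>) F \<inter> e = \<Union>\<V> \<inter> e"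
proof -
  have "sides X (\<Union>\<V>) f \<inter> e = {}" "f \<inter> e = {}" if "f \<in> F" for f
  proof -
    have "f \<in> \<E>" "f \<noteq> e" using that assms by auto
    then show "f \<inter> e = {}" using skeleton_disjoint[OF sk _ \<open>e \<in> \<E>\<close>] by blast
    moreover have "sides X (\<Union>\<V>) f \<subseteq> f" by (rule skeleton_sides_subset[OF sk \<open>f \<in> \<E>\<close>])
    ultimately show "sides X (\<Union>\<V>) f \<inter> e = {}" by blast
  qed
  then show ?thesis unfolding free_boundary_def by blast
qed

lemma free_boundary_inter:
  assumes sk: "skeleton X \<V> \<E>" and e: "e \<in> \<E>"
  shows "free_boundary X (\<Union>\<V>) \<E> \<inter> e = sides X (\<Union>\<V>) e"
proof -
  have s: "sides X (\<Union>\<V>) f \<subseteq> f" if "f \<in> \<E>" for f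
    by (rule skeleton_sides_subset[OF sk that])
  have d: "f \<inter> e = {}" if "f \<in> \<E>" "f \<noteq> e" for f
    by (rule skeleton_disjoint[OF sk that(1) e that(2)])
  have "sides X (\<Union>\<V>) f \<inter> e \<subseteq> sides X (\<Union>\<V>) e" if "f \<in> \<E>" for f
    using s[OF that] d[OF that] by (cases "f = e") auto
  then show ?thesis unfolding free_boundary_def using e s[OF e] by blast
qed

text \<open>Induction on the set of edges at which arcs have been exchanged. An edge not yet treated
  is disjoint from the others, so it still meets the current circles in its original two segments,
  and \<open>circles_surgery\<close> applies to it.\<close>

lemma free_boundary_circles:
  assumes sk: "skeleton X \<V> \<E>"
  shows "\<exists>\<W>. circles X \<W> \<and> \<Union>\<W> = free_boundary X (\<Union>\<V>) \<E>"
proof -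
  have X: "Hausdorff_space X" and fin: "finite \<E>" using sk by (auto simp: skeleton_def)
  have "finite F \<Longrightarrow> F \<subseteq> \<E> \<Longrightarrow> \<exists>\<W>. circles X \<W> \<and> \<Union>\<W> = free_boundary X (\<Union>\<V>) F" for F
  proof (induction F rule: finite_induct)
    case empty
    then show ?case using sk unfolding skeleton_def free_boundary_def by auto
  next
    case (insert e F)
    then obtain \<W> where W: "circles X \<W>" "\<Union>\<W> = free_boundary X (\<Union>\<V>) F" by auto
    have "attached X (\<Union>\<V>) e" using skeletonD(5)[OF sk] insert.prems by simp
    then obtain s1 p1 t1 p2 s2 p3 t2 p0 where c: "cyclic_arcs X s1 p1 t1 p2 s2 p3 t2 p0"
       "rim X e = s1 \<union> t1 \<union> s2 \<union> t2" "\<Union>\<V> \<inter> e = s1 \<union> s2"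
      by (rule attachedE)
    have We: "\<Union>\<W> \<inter> e = s1 \<union> s2"
      unfolding W(2) using free_boundary_insert_inter[OF sk, of F e] insert c(3) by auto
    have "s1 \<union> t1 \<union> s2 \<union> t2 \<subseteq> e" using c(2) rim_subset[of X e] by simp
    then have W0: "\<Union>\<W> \<inter> (s1 \<union> t1 \<union> s2 \<union> t2) = s1 \<union> s2" using We by blast
    obtain \<W>' where "circles X \<W>' \<and> \<Union>\<W>' = (\<Union>\<W> - (s1 \<union> s2)) \<union> (t1 \<union> t2)"
      using circles_surgery[OF X W(1) c(1) W0] by (rule exE)
    then have W': "circles X \<W>'" "\<Union>\<W>' = (\<Union>\<W> - (s1 \<union> s2)) \<union> (t1 \<union> t2)" by auto
    have "\<Union>\<W> - (s1 \<union> s2) = \<Union>\<W> - e" using We by blast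
    then have W'2: "\<Union>\<W>' = (free_boundary X (\<Union>\<V>) F - e) \<union> sides X (\<Union>\<V>) e"
      using W'(2) W(2) sides_eq[OF X c] by (simp only:)
    have "f \<inter> e = {}" if "f \<in> F" for f
      by (rule skeleton_disjoint[OF sk]) (use insert that in auto)
    moreover have "sides X (\<Union>\<V>) f \<subseteq> f" if "f \<in> F" for f
      by (rule skeleton_sides_subset[OF sk]) (use insert that in auto)
    ultimately have "(\<Union>f\<in>F. sides X (\<Union>\<V>) f) \<inter> e = {}" by fast
    then have "\<Union>\<W>' = free_boundary X (\<Union>\<V>) (insert e F)"
      unfolding W'2 free_boundary_def UN_insert Union_insert by blast
    then show ?case using W'(1) by blast
  qed
  then show ?thesis using fin by blast
qed

lemma boundary_circles:
  assumes "skeleton X \<V> \<E>"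
  shows "circles X (boundary_circles X \<V> \<E>)" "\<Union>(boundary_circles X \<V> \<E>) = free_boundary X (\<Union>\<V>) \<E>"
proof -
  have X: "Hausdorff_space X" using assms by (auto simp: skeleton_def)
  obtain \<W> where W: "circles X \<W>" "\<Union>\<W> = free_boundary X (\<Union>\<V>) \<E>"
    using free_boundary_circles[OF assms] by blast
  have "boundary_circles X \<V> \<E> = \<W>"
    unfolding boundary_circles_def W(2)[symmetric] using connected_components_of_circles[OF X W(1)] .
  then show "circles X (boundary_circles X \<V> \<E>)" "\<Union>(boundary_circles X \<V> \<E>) = free_boundary X (\<Union>\<V>) \<E>"
    using W by auto
qed

lemma skeleton_boundary_circles:
  assumes sk: "skeleton X \<V> \<E>"
  shows "skeleton X (boundary_circles X \<V> \<E>) \<E>"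
proof -
  have X: "Hausdorff_space X" using sk by (auto simp: skeleton_def)
  have "attached X (\<Union>(boundary_circles X \<V> \<E>)) e" if "e \<in> \<E>" for e
    unfolding boundary_circles(2)[OF sk]
    by (rule attached_dual(1)[OF X skeletonD(5)[OF sk that] free_boundary_inter[OF sk that]])
  then show ?thesis using sk boundary_circles[OF sk] unfolding skeleton_def by blast
qed

text \<open>Exchanges at different edges do not interact, and each one undoes itself. With
  \<open>F\<close> empty this gives the double dual; with \<open>F = {e}\<close> it shows that
  dualising, forgetting \<open>e\<close> and dualising back amounts to the exchange at
  \<open>e\<close> alone.\<close>

lemma free_boundary_minus:
  assumes sk: "skeleton X \<V> \<E>" and F: "F \<subseteq> \<E>"
  shows "free_boundary X (free_boundary X (\<Union>\<V>) \<E>) (\<E> - F) = free_boundary X (\<Union>\<V>) F"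
proof -
  have X: "Hausdorff_space X" using sk by (auto simp: skeleton_def)
  let ?A = "\<Union>\<V>"
  let ?P = "free_boundary X ?A \<E>"
  have a: "attached X ?A e" if "e \<in> \<E>" for e by (rule skeletonD(5)[OF sk that])
  have s: "sides X ?P e = ?A \<inter> e" if "e \<in> \<E>" for e
    using attached_dual(2)[OF X a[OF that] free_boundary_inter[OF sk that]] .
  have sub: "sides X ?A f \<subseteq> f" if "f \<in> \<E>" for f
    using sides_subset[OF X a[OF that]] .
  have dis: "f \<inter> e = {}" if "f \<in> \<E>" "e \<in> \<E>" "e \<noteq> f" for e f
    using skeleton_disjoint[OF sk] that by metis
  have h1: "(\<Union>e\<in>\<E> - F. sides X ?P e) = ?A \<inter> \<Union>(\<E> - F)" using s by auto
  have h2: "?P - \<Union>(\<E> - F) = (?A - \<Union>\<E>) \<union> (\<Union>e\<in>F. sides X ?A e)"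
  proof -
    have 1: "sides X ?A e - \<Union>(\<E> - F) = {}" if "e \<in> \<E> - F" for e using sub[of e] that by blast
    have 2: "sides X ?A e \<inter> \<Union>(\<E> - F) = {}" if "e \<in> F" for e
    proof -
      have "e \<inter> f = {}" if "f \<in> \<E> - F" for f using dis[of e f] that \<open>e \<in> F\<close> F by blast
      then show ?thesis using sub[of e] that F by blast
    qed
    show ?thesis
    proof (intro equalityI subsetI)
      fix x assume x: "x \<in> ?P - \<Union>(\<E> - F)"
      then show "x \<in> (?A - \<Union>\<E>) \<union> (\<Union>e\<in>F. sides X ?A e)" unfolding free_boundary_def using 1 by blast
    next
      fix x assume "x \<in> (?A - \<Union>\<E>) \<union> (\<Union>e\<in>F. sides X ?A e)"
      then show "x \<in> ?P - \<Union>(\<E> - F)" unfolding free_boundary_def using 2 F by blast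
    qed
  qed
  have h3: "(?A - \<Union>\<E>) \<union> (?A \<inter> \<Union>(\<E> - F)) = ?A - \<Union>F"
  proof -
    have "\<Union>(\<E> - F) \<inter> \<Union>F = {}" using dis F by blast
    moreover have "\<Union>\<E> = \<Union>(\<E> - F) \<union> \<Union>F" using F by blast
    ultimately show ?thesis by blast
  qed
  have "free_boundary X ?P (\<E> - F) = (?A - \<Union>\<E>) \<union> (\<Union>e\<in>F. sides X ?A e) \<union> (?A \<inter> \<Union>(\<E> - F))"
    unfolding free_boundary_def[of X ?P] by (simp only: h1 h2)
  also have "\<dots> = ((?A - \<Union>\<E>) \<union> (?A \<inter> \<Union>(\<E> - F))) \<union> (\<Union>e\<in>F. sides X ?A e)"
    by (simp only: Un_ac)
  finally show ?thesis by (simp only: h3 free_boundary_def[of X ?A F])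
qed

lemma boundary_circles_involution:
  assumes sk: "skeleton X \<V> \<E>"
  shows "boundary_circles X (boundary_circles X \<V> \<E>) \<E> = \<V>"
proof -
  have "free_boundary X (free_boundary X (\<Union>\<V>) \<E>) \<E> = \<Union>\<V>"
    using free_boundary_minus[OF sk, of "{}"] by (simp add: free_boundary_def)
  then show ?thesis
    using connected_components_of_circles[of X \<V>] sk
    unfolding boundary_circles_def[of X "boundary_circles X \<V> \<E>"] boundary_circles(2)[OF sk] skeleton_def
    by simp
qed

section \<open>The circles at a single edge\<close>

definition circles_meeting :: "'a set set \<Rightarrow> 'a set \<Rightarrow> 'a set set" where
  "circles_meeting \<V> e = {c \<in> \<V>. c \<inter> e \<noteq> {}}"

text \<open>The circles along which the contraction of \<open>e\<close> glues new vertices, replacing those that meet \<open>e\<close>.\<close>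

definition new_circles :: "'a topology \<Rightarrow> 'a set set \<Rightarrow> 'a set \<Rightarrow> 'a set set" where
  "new_circles X \<V> e = boundary_circles X (circles_meeting \<V> e) {e}"

lemma circles_meeting_inter: "\<Union>(circles_meeting \<V> e) \<inter> e = \<Union>\<V> \<inter> e"
  unfolding circles_meeting_def by blast

lemma skeleton_circles_meeting:
  assumes "skeleton X \<V> \<E>" "e \<in> \<E>"
  shows "skeleton X (circles_meeting \<V> e) {e}"
proof (rule skeleton_subset[OF assms(1)])
  show "circles_meeting \<V> e \<subseteq> \<V>" unfolding circles_meeting_def by blast
  show "{e} \<subseteq> \<E>" using assms by simp
  fix f assume "f \<in> {e}"
  then show "\<Union>(circles_meeting \<V> e) \<inter> f = \<Union>\<V> \<inter> f" by (simp add: circles_meeting_inter)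
qed

lemma new_circles_subset:
  assumes "skeleton X \<V> \<E>" "e \<in> \<E>"
  shows "\<Union>(new_circles X \<V> e) \<subseteq> \<Union>(circles_meeting \<V> e) \<union> e"
proof -
  have "attached X (\<Union>(circles_meeting \<V> e)) e" "Hausdorff_space X"
    using skeleton_circles_meeting[OF assms] unfolding skeleton_def by auto
  then have "sides X (\<Union>(circles_meeting \<V> e)) e \<subseteq> e" using sides_subset by blast
  then show ?thesis
    unfolding new_circles_def boundary_circles(2)[OF skeleton_circles_meeting[OF assms]] free_boundary_def
    by blast
qed

lemma new_circles_disjoint:
  assumes "skeleton X \<V> \<E>" "e \<in> \<E>" "c \<in> \<V> - circles_meeting \<V> e"
  shows "c \<inter> (\<Union>(circles_meeting \<V> e) \<union> e) = {}" "c \<inter> \<Union>(new_circles X \<V> e) = {}"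
proof -
  have "c \<inter> d = {}" if "d \<in> circles_meeting \<V> e" for d
    using circles_unique[OF skeletonD(2)[OF assms(1)], of c d] that assms(3)
    unfolding circles_meeting_def by blast
  moreover have "c \<inter> e = {}" using assms(3) unfolding circles_meeting_def by blast
  ultimately show "c \<inter> (\<Union>(circles_meeting \<V> e) \<union> e) = {}" by blast
  then show "c \<inter> \<Union>(new_circles X \<V> e) = {}" using new_circles_subset[OF assms(1,2)] by blast
qed

text \<open>A new circle missing \<open>e\<close> would be open and closed in an old one, hence equal to it.\<close>

lemma new_circle_meets:
  assumes sk: "skeleton X \<V> \<E>" and e: "e \<in> \<E>" and c: "c \<in> new_circles X \<V> e"
  shows "c \<inter> e \<noteq> {}"
proof
  assume ce: "c \<inter> e = {}"
  let ?M = "circles_meeting \<V> e" and ?N = "new_circles X \<V> e"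
  note skM = skeleton_circles_meeting[OF sk e]
  have X: "Hausdorff_space X" using sk by (auto simp: skeleton_def)
  have N: "circles X ?N" "\<Union>?N = free_boundary X (\<Union>?M) {e}"
    using boundary_circles[OF skM] unfolding new_circles_def by auto
  have M: "circles X ?M" using skM by (auto simp: skeleton_def)
  have cc: "circle_in X c" using N c by (auto simp: circles_def)
  have cM: "c \<subseteq> \<Union>?M" using new_circles_subset[OF sk e] c ce by blast
  obtain a where a: "a \<in> ?M" "c \<subseteq> a"
  proof (rule connectedin_subset_of_disjoint_closed[OF circle_in_connectedin[OF cc] circle_in_nonempty[OF cc] cM])
  qed (use M circle_in_closedin[OF X] in \<open>auto simp: circles_def\<close>)
  \<comment> \<open>Closed, disjoint from \<open>c\<close>, and together with \<open>c\<close> it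
    covers the old circle \<open>a\<close>; it does meet \<open>a\<close>, namely in
    \<open>e\<close>.\<close>
  let ?R = "\<Union>(?N - {c}) \<union> e"
  have "closedin X e"
    using skeletonD(4)[OF sk e] closed_disc_in_iff_parametrizes[OF X, of e] parametrizes_closedin[OF X _ compact_cball]
    by blast
  moreover have "closedin X (\<Union>(?N - {c}))"
    using N circle_in_closedin[OF X] unfolding circles_def by (intro closedin_Union) auto
  ultimately have "closedin X ?R" by (rule closedin_Un[rotated])
  moreover have "closedin X c" using circle_in_closedin[OF X cc] .
  moreover have "a \<subseteq> c \<union> ?R" using a N(2) unfolding free_boundary_def by blast
  moreover have "c \<inter> ?R = {}" using ce circles_unique[OF N(1) c] by blast
  moreover have "c \<inter> a \<noteq> {}" using a circle_in_nonempty[OF cc] by blast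
  moreover have "connectedin X a" using M a circle_in_connectedin unfolding circles_def by blast
  ultimately have "?R \<inter> a = {}" unfolding connectedin_closedin by (metis Int_empty_left)
  then show False using a unfolding circles_meeting_def by blast
qed

text \<open>The left side is the boundary after deletion of \<open>e\<close> in the dual, the right
  side the vertex circles of the contraction of \<open>e\<close>. The second equation justifies the
  rule of \<open>cdelete\<close> that the boundary components arising from the deletion are those
  that meet \<open>e\<close>.\<close>

lemma boundary_circles_delete:
  assumes sk: "skeleton X \<V> \<E>" and e: "e \<in> \<E>"
  shows "boundary_circles X (boundary_circles X \<V> \<E>) (\<E> - {e}) =
      (\<V> - circles_meeting \<V> e) \<union> new_circles X \<V> e"
    and "circles_meeting (boundary_circles X (boundary_circles X \<V> \<E>) (\<E> - {e})) e = new_circles X \<V> e"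
proof -
  let ?M = "circles_meeting \<V> e" and ?N = "new_circles X \<V> e"
  note skM = skeleton_circles_meeting[OF sk e]
  have X: "Hausdorff_space X" using sk by (auto simp: skeleton_def)
  have N: "circles X ?N" "\<Union>?N = free_boundary X (\<Union>?M) {e}"
    using boundary_circles[OF skM] unfolding new_circles_def by auto
  have c: "circles X ((\<V> - ?M) \<union> ?N)"
  proof (rule circles_Un[OF circles_subset N(1)])
    show "circles X \<V>" using sk by (simp add: skeleton_def)
    show "\<Union>(\<V> - ?M) \<inter> \<Union>?N = {}" using new_circles_disjoint(2)[OF sk e] by blast
  qed blast
  have "free_boundary X (free_boundary X (\<Union>\<V>) \<E>) (\<E> - {e}) = free_boundary X (\<Union>\<V>) {e}"
    using free_boundary_minus[OF sk, of "{e}"] e by simp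
  also have "\<dots> = \<Union>((\<V> - ?M) \<union> ?N)"
  proof -
    have "sides X (\<Union>\<V>) e = sides X (\<Union>?M) e" using sides_cong circles_meeting_inter[of \<V> e] by metis
    moreover have "\<Union>\<V> - e = \<Union>(\<V> - ?M) \<union> (\<Union>?M - e)" unfolding circles_meeting_def by blast
    ultimately show ?thesis unfolding Union_Un_distrib N(2) free_boundary_def by simp blast
  qed
  finally show 1: "boundary_circles X (boundary_circles X \<V> \<E>) (\<E> - {e}) = (\<V> - ?M) \<union> ?N"
    using connected_components_of_circles[OF X c]
    unfolding boundary_circles_def[of X "boundary_circles X \<V> \<E>"] boundary_circles(2)[OF sk] by simp
  show "circles_meeting (boundary_circles X (boundary_circles X \<V> \<E>) (\<E> - {e})) e = ?N"
    unfolding 1 using new_circle_meets[OF sk e] unfolding circles_meeting_def by blast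
qed

text \<open>No further surgery is needed: the contracted circles are the boundary circles of the
  dual skeleton without \<open>e\<close>, and forgetting an edge trivially leaves a skeleton. The
  involution then returns the old boundary.\<close>

lemma skeleton_contract:
  assumes sk: "skeleton X \<V> \<E>" and e: "e \<in> \<E>"
  shows "skeleton X ((\<V> - circles_meeting \<V> e) \<union> new_circles X \<V> e) (\<E> - {e})"
    and "boundary_circles X ((\<V> - circles_meeting \<V> e) \<union> new_circles X \<V> e) (\<E> - {e}) = boundary_circles X \<V> \<E>"
proof -
  have h: "skeleton X (boundary_circles X \<V> \<E>) (\<E> - {e})"
    by (rule skeleton_subset[OF skeleton_boundary_circles[OF sk]]) auto
  show "skeleton X ((\<V> - circles_meeting \<V> e) \<union> new_circles X \<V> e) (\<E> - {e})"
    "boundary_circles X ((\<V> - circles_meeting \<V> e) \<union> new_circles X \<V> e) (\<E> - {e}) = boundary_circles X \<V> \<E>"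
    unfolding boundary_circles_delete(1)[OF sk e, symmetric]
    by (rule skeleton_boundary_circles[OF h], rule boundary_circles_involution[OF h])
qed

section \<open>Two discs glued along an arc\<close>

text \<open>The upper half plane consists of the points at least as close to the imaginary unit as
  to its negative, so that the quotient of the two distances, the norm of the Cayley transform, is
  at most 1.\<close>

lemma half_plane_iff: "w \<in> half_plane \<longleftrightarrow> norm (w - \<i>) \<le> norm (w + \<i>)"
  and real_line_iff: "Im w = 0 \<longleftrightarrow> norm (w - \<i>) = norm (w + \<i>)"
proof -
  have 1: "(norm (w + \<i>))\<^sup>2 = (norm (w - \<i>))\<^sup>2 + 4 * Im w"
    by (simp only: cmod_power2) (simp add: power2_eq_square algebra_simps)
  have "norm (w - \<i>) \<le> norm (w + \<i>) \<longleftrightarrow> (norm (w - \<i>))\<^sup>2 \<le> (norm (w + \<i>))\<^sup>2"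
    by (simp add: power_mono_iff)
  then show "w \<in> half_plane \<longleftrightarrow> norm (w - \<i>) \<le> norm (w + \<i>)" unfolding 1 by (simp add: half_plane_def)
  have "norm (w - \<i>) = norm (w + \<i>) \<longleftrightarrow> (norm (w - \<i>))\<^sup>2 = (norm (w + \<i>))\<^sup>2"
    by (simp add: power2_eq_iff_nonneg)
  then show "Im w = 0 \<longleftrightarrow> norm (w - \<i>) = norm (w + \<i>)" unfolding 1 by simp
qed

definition cayley :: "complex \<Rightarrow> complex" where
  "cayley w = (w - \<i>) / (w + \<i>)"

definition inv_cayley :: "complex \<Rightarrow> complex" where
  "inv_cayley z = \<i> * (1 + z) / (1 - z)"

lemma half_plane_nonzero: "w \<in> half_plane \<Longrightarrow> w + \<i> \<noteq> 0"
  by (auto simp: half_plane_def complex_eq_iff)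

lemma cayley_inv: "z \<noteq> 1 \<Longrightarrow> cayley (inv_cayley z) = z" "z \<noteq> 1 \<Longrightarrow> inv_cayley z + \<i> \<noteq> 0"
proof -
  assume z: "z \<noteq> 1"
  have p: "inv_cayley z + \<i> = 2 * \<i> / (1 - z)" "inv_cayley z - \<i> = 2 * \<i> * z / (1 - z)"
    using z by (simp_all add: inv_cayley_def field_simps)
  show "inv_cayley z + \<i> \<noteq> 0" unfolding p(1) using z by simp
  show "cayley (inv_cayley z) = z" unfolding cayley_def p using z by simp
qed

lemma inv_cayley_cayley:
  assumes "w \<in> half_plane"
  shows "inv_cayley (cayley w) = w" "cayley w \<noteq> 1" "norm (cayley w) \<le> 1" "norm (cayley w) = 1 \<longleftrightarrow> Im w = 0"
proof -
  have nz: "w + \<i> \<noteq> 0" by (rule half_plane_nonzero[OF assms])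
  have p: "1 - cayley w = 2 * \<i> / (w + \<i>)" "1 + cayley w = 2 * w / (w + \<i>)"
    using nz by (simp_all add: cayley_def field_simps)
  show "cayley w \<noteq> 1" using p(1) nz by auto
  show "inv_cayley (cayley w) = w" unfolding inv_cayley_def p using nz by simp
  have "norm (cayley w) = norm (w - \<i>) / norm (w + \<i>)" by (simp add: cayley_def norm_divide)
  then show "norm (cayley w) \<le> 1" "norm (cayley w) = 1 \<longleftrightarrow> Im w = 0"
    using nz half_plane_iff[of w] real_line_iff[of w] assms by (simp_all add: divide_le_eq divide_eq_eq)
qed

lemma inv_cayley_half_plane:
  assumes "norm z \<le> 1" "z \<noteq> 1"
  shows "inv_cayley z \<in> half_plane"
proof -
  have "norm (cayley (inv_cayley z)) \<le> 1" using assms cayley_inv by simp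
  then have "norm (inv_cayley z - \<i>) \<le> norm (inv_cayley z + \<i>)"
    using cayley_inv(2)[OF assms(2)] by (simp add: cayley_def norm_divide divide_le_eq)
  then show ?thesis using half_plane_iff by blast
qed

text \<open>The Cayley transform, turned so that the omitted rim point is \<open>q\<close>. Arcs of
  the rim that avoid \<open>q\<close> become straight segments of the real line, along which two
  discs can be glued in coordinates.\<close>

lemma punctured_disc_half_plane:
  assumes X: "Hausdorff_space X" and d: "parametrizes X (cball (0::complex) 1) d D" and q: "norm q = 1"
  obtains r k where "continuous_map (top_of_set half_plane) X r" "r ` half_plane = D - {d q}"
    "continuous_map (subtopology X (D - {d q})) (top_of_set half_plane) k"
    "\<forall>w\<in>half_plane. k (r w) = w" "\<forall>x\<in>D - {d q}. r (k x) = x"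
    "\<forall>x\<in>D - {d q}. x \<in> d ` sphere 0 1 \<longleftrightarrow> Im (k x) = 0"
proof -
  have dc: "continuous_map (top_of_set (cball 0 1)) X d" and dinj: "inj_on d (cball 0 1)"
    and dD: "d ` cball 0 1 = D" using d by (auto simp: parametrizes_def)
  obtain m where m: "continuous_map (subtopology X D) (top_of_set (cball 0 1)) m"
    "\<And>z. z \<in> cball 0 1 \<Longrightarrow> m (d z) = z" "\<And>x. x \<in> D \<Longrightarrow> d (m x) = x" "m ` D = cball 0 1"
    using parametrizes_inverse[OF X compact_cball d] by metis
  have q0: "q \<noteq> 0" using q by auto
  \<comment> \<open>The Cayley transform misses the point 1 of the closed disc; the rotation moves
    the gap to \<open>q\<close>.\<close>
  define c where "c = (\<lambda>w. q * cayley w)"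
  define r where "r = d \<circ> c"
  define k where "k = (\<lambda>z. inv_cayley (z / q)) \<circ> m"
  have cH: "c w \<in> cball 0 1 - {q}" if "w \<in> half_plane" for w
    using inv_cayley_cayley[OF that] q q0 by (simp add: c_def norm_mult)
  have "continuous_on half_plane c"
    unfolding c_def cayley_def using half_plane_nonzero by (auto intro!: continuous_intros)
  then have "continuous_map (top_of_set half_plane) (top_of_set (cball 0 1)) c"
    unfolding continuous_map_in_subtopology using cH by auto
  then have 1: "continuous_map (top_of_set half_plane) X r"
    unfolding r_def using dc by (rule continuous_map_compose)
  have mq: "m x \<in> cball 0 1 - {q}" if "x \<in> D - {d q}" for x
    using that m(3,4) by auto
  have icq: "inv_cayley (z / q) \<in> half_plane" if "z \<in> cball 0 1 - {q}" for z
    using that q q0 by (intro inv_cayley_half_plane) (auto simp: norm_divide)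
  have "continuous_on (cball 0 1 - {q}) (\<lambda>z. inv_cayley (z / q))"
    unfolding inv_cayley_def using q0 by (auto intro!: continuous_intros simp: field_simps)
  then have ic: "continuous_map (top_of_set (cball 0 1 - {q})) (top_of_set half_plane) (\<lambda>z. inv_cayley (z / q))"
    unfolding continuous_map_in_subtopology using icq by auto
  have "continuous_map (subtopology X (D - {d q})) (top_of_set (cball 0 1)) m"
    using continuous_map_from_subtopology_mono[OF m(1)] by blast
  then have "continuous_map (subtopology X (D - {d q})) (top_of_set (cball 0 1 - {q})) m"
    unfolding continuous_map_in_subtopology using mq by auto
  then have 2: "continuous_map (subtopology X (D - {d q})) (top_of_set half_plane) k"
    unfolding k_def using ic by (rule continuous_map_compose)
  have kr: "k (r w) = w" if "w \<in> half_plane" for w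
  proof -
    have "m (r w) = c w" using cH[OF that] m(2) by (simp add: r_def)
    then show ?thesis using q0 inv_cayley_cayley(1)[OF that] by (simp add: k_def c_def)
  qed
  have rk: "r (k x) = x" if "x \<in> D - {d q}" for x
  proof -
    have "m x / q \<noteq> 1" using mq[OF that] q0 by auto
    then have "c (k x) = m x" using cayley_inv(1) q0 by (simp add: c_def k_def)
    then show ?thesis using m(3) that by (simp add: r_def)
  qed
  have kH: "k x \<in> half_plane" if "x \<in> D - {d q}" for x
    using icq[OF mq[OF that]] by (simp add: k_def)
  have rH: "r w \<in> D - {d q}" if "w \<in> half_plane" for w
  proof -
    have "q \<in> cball 0 1" using q by simp
    then have "d (c w) \<noteq> d q" using cH[OF that] inj_onD[OF dinj, of "c w" q] by auto
    then show ?thesis using cH[OF that] dD by (auto simp: r_def)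
  qed
  have 3: "r ` half_plane = D - {d q}"
  proof (intro equalityI subsetI)
    fix x assume "x \<in> D - {d q}"
    then show "x \<in> r ` half_plane" using rk kH by (metis imageI)
  qed (use rH in auto)
  have 4: "x \<in> d ` sphere 0 1 \<longleftrightarrow> Im (k x) = 0" if x: "x \<in> D - {d q}" for x
  proof -
    have xd: "d (m x) = x" "m x \<in> cball 0 1" using m(3) mq[OF x] x by auto
    have "x \<in> d ` sphere 0 1 \<longleftrightarrow> norm (m x) = 1"
    proof
      assume "x \<in> d ` sphere 0 1"
      then obtain z where "z \<in> sphere 0 1" "d z = x" by auto
      then show "norm (m x) = 1" using m(2)[of z] by auto
    next
      assume "norm (m x) = 1"
      then show "x \<in> d ` sphere 0 1" using xd by (metis image_eqI mem_sphere_0)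
    qed
    also have "m x / q \<noteq> 1" using mq[OF x] q0 by auto
    then have "cayley (k x) = m x / q" using cayley_inv(1) by (simp add: k_def)
    then have "norm (m x) = 1 \<longleftrightarrow> norm (cayley (k x)) = 1" using q by (simp add: norm_divide)
    also have "\<dots> \<longleftrightarrow> Im (k x) = 0" using inv_cayley_cayley(4)[OF kH[OF x]] .
    finally show ?thesis .
  qed
  show thesis by (rule that[OF 1 3 2 ballI[OF kr] ballI[OF rk] ballI[OF 4]])
qed

text \<open>\<open>U\<close> shows in the disc the open strip above the inner points of the segment.
  Its height is bounded by 1 so that it will fit into a compact rectangle.\<close>

lemma arc_in_half_plane:
  assumes X: "Hausdorff_space X" and d: "parametrizes X (cball (0::complex) 1) d D"
    and s: "arc_from X s a b" "s \<subseteq> d ` sphere 0 1"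
  obtains r u v k U where "continuous_map (top_of_set half_plane) X r"
    "\<forall>w\<in>half_plane. r w \<in> D" "inj_on r half_plane"
    "u < v" "r ` complex_of_real ` {u..v} = s" "r u = a \<and> r v = b \<or> r u = b \<and> r v = a"
    "continuous_map (subtopology X s) euclideanreal k" "\<forall>t\<in>{u..v}. k (r (complex_of_real t)) = t"
    "\<forall>w\<in>half_plane. r w \<in> d ` sphere 0 1 \<longleftrightarrow> Im w = 0"
    "openin X U" "U \<inter> D = r ` {w \<in> half_plane. u < Re w \<and> Re w < v \<and> Im w < 1}"
    "\<forall>y\<in>s. y \<in> U \<longleftrightarrow> y \<notin> {a, b}"
proof -
  have c: "circle_in X (d ` sphere 0 1)"
    using parametrizes_subset[OF d, of "sphere 0 1"] unfolding circle_in_def by auto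
  have "d ` sphere 0 1 \<noteq> s" using circle_not_arc[OF X c] s(1) by blast
  then obtain x where "x \<in> d ` sphere 0 1" "x \<notin> s" using s(2) by blast
  then obtain q where q: "norm q = 1" "d q \<notin> s" by auto
  obtain r k where r: "continuous_map (top_of_set half_plane) X r" "r ` half_plane = D - {d q}"
    and k0: "continuous_map (subtopology X (D - {d q})) (top_of_set half_plane) k"
    "\<forall>w\<in>half_plane. k (r w) = w" "\<forall>x\<in>D - {d q}. r (k x) = x"
    "\<forall>x\<in>D - {d q}. x \<in> d ` sphere 0 1 \<longleftrightarrow> Im (k x) = 0"
    using punctured_disc_half_plane[OF X d q(1)] .
  note k = k0[rule_format]
  have sph: "d ` sphere 0 1 \<subseteq> D" using d by (auto simp: parametrizes_def)
  have sD: "s \<subseteq> D - {d q}" using s(2) sph q(2) by blast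
  have rinj: "inj_on r half_plane" using k(2) by (rule inj_on_inverseI)
  have rD: "r w \<in> D - {d q}" if "w \<in> half_plane" for w using that r(2) by blast
  have kH: "k x \<in> half_plane" if "x \<in> D - {d q}" for x using that k(2) r(2) by (metis imageE)
  have ks: "continuous_map (subtopology X s) (top_of_set half_plane) k"
    by (rule continuous_map_from_subtopology_mono[OF k(1) sD])
  then have ks': "continuous_map (subtopology X s) euclidean k"
    using continuous_map_into_fulltopology by blast
  have "continuous_map euclidean euclideanreal Re" by (auto intro!: continuous_intros)
  then have Rek: "continuous_map (subtopology X s) euclideanreal (Re \<circ> k)"
    by (rule continuous_map_compose[OF ks'])
  have "compactin (subtopology X s) s" "connectedin (subtopology X s) s"
    using arc_from_compactin[OF s(1)] arc_from_connectedin[OF s(1)]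
    by (auto simp: compactin_subtopology connectedin_subtopology)
  then have "compactin euclideanreal ((Re \<circ> k) ` s)" "connectedin euclideanreal ((Re \<circ> k) ` s)"
    using image_compactin[OF _ Rek] connectedin_continuous_map_image[OF Rek] by blast+
  then have "compact ((Re \<circ> k) ` s)" "connected ((Re \<circ> k) ` s)"
    by (simp_all only: compactin_euclidean_iff connectedin_iff_connected)
  then have "\<exists>u v. (Re \<circ> k) ` s = {u..v}"
    by (intro iffD1[OF connected_compact_interval_1] conjI)
  then obtain u v where uv: "(Re \<circ> k) ` s = {u..v}" by (elim exE)
  have kreal: "k x = complex_of_real (Re (k x))" if "x \<in> s" for x
    using k(4)[of x] that sD s(2) by (auto simp: complex_eq_iff)
  have rs: "r (complex_of_real (Re (k x))) = x" if "x \<in> s" for x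
    using kreal[OF that] k(3)[of x] sD that by auto
  have im: "r ` complex_of_real ` {u..v} = s"
    unfolding uv[symmetric] using rs by (force simp: image_iff)
  have realH: "complex_of_real t \<in> half_plane" for t by (simp add: half_plane_def)
  have ab: "a \<in> s" "b \<in> s" "a \<noteq> b" using s(1) by (rule arc_from_ends)+
  have uvl: "u < v"
  proof (rule ccontr)
    assume "\<not> u < v"
    then have "{u..v} \<subseteq> {u}" by auto
    then have "s \<subseteq> {r (complex_of_real u)}" using im by blast
    then show False using ab by auto
  qed
  have arc: "arc_from X ((r \<circ> complex_of_real) ` {u..v}) ((r \<circ> complex_of_real) u) ((r \<circ> complex_of_real) v)"
  proof (rule arc_from_interval[OF uvl])
    have "continuous_map (top_of_set {u..v}) (top_of_set half_plane) complex_of_real"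
      unfolding continuous_map_in_subtopology using realH by (auto intro!: continuous_intros)
    then show "continuous_map (top_of_set {u..v}) X (r \<circ> complex_of_real)"
      using r(1) by (rule continuous_map_compose)
    show "inj_on (r \<circ> complex_of_real) {u..v}"
      using inj_onD[OF rinj _ realH realH] by (intro inj_onI) auto
  qed
  then have arc': "arc_from X s (r u) (r v)" by (simp only: image_comp[symmetric] im comp_apply)
  have ends: "r u = a \<and> r v = b \<or> r u = b \<and> r v = a"
    using arc_from_ends_unique[OF X s(1) arc'] by auto
  have kr: "(Re \<circ> k) (r (complex_of_real t)) = t" for t using k(2)[OF realH] by simp
  have bd: "r w \<in> d ` sphere 0 1 \<longleftrightarrow> Im w = 0" if "w \<in> half_plane" for w
    using k(4)[OF rD[OF that]] k(2)[OF that] by simp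
  let ?B = "{w. u < Re w \<and> Re w < v \<and> Im w < 1}"
  have "open ?B"
    by (intro open_Collect_conj open_Collect_less continuous_intros)
  then have "openin (subtopology X (D - {d q})) {x \<in> topspace (subtopology X (D - {d q})). k x \<in> ?B}"
    using openin_continuous_map_preimage[of "subtopology X (D - {d q})" euclidean k ?B] k(1)
      continuous_map_into_fulltopology by auto
  moreover have DX: "D \<subseteq> topspace X" using parametrizes_subset_topspace[OF d] .
  then have "topspace (subtopology X (D - {d q})) = D - {d q}" by auto
  ultimately have "openin (subtopology X (D - {d q})) {x \<in> D - {d q}. k x \<in> ?B}" by (simp only:)
  then obtain U0 where U0: "openin X U0" "{x \<in> D - {d q}. k x \<in> ?B} = U0 \<inter> (D - {d q})"
    unfolding openin_subtopology by blast
  have "q \<in> sphere 0 1" using q(1) by simp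
  then have "d q \<in> topspace X" using sph DX by blast
  then have "closedin X {d q}" using X by (simp add: closedin_Hausdorff_singleton)
  then have U: "openin X (U0 - {d q})" using U0(1) by blast
  have UD: "(U0 - {d q}) \<inter> D = r ` {w \<in> half_plane. u < Re w \<and> Re w < v \<and> Im w < 1}"
  proof -
    have "(U0 - {d q}) \<inter> D = {x \<in> D - {d q}. k x \<in> ?B}" unfolding U0(2) by blast
    also have "\<dots> = r ` {w \<in> half_plane. u < Re w \<and> Re w < v \<and> Im w < 1}"
    proof (intro equalityI subsetI)
      fix x assume "x \<in> {x \<in> D - {d q}. k x \<in> ?B}"
      then have "x = r (k x)" "k x \<in> {w \<in> half_plane. u < Re w \<and> Re w < v \<and> Im w < 1}"
        using k(3) kH by auto
      then show "x \<in> r ` {w \<in> half_plane. u < Re w \<and> Re w < v \<and> Im w < 1}" by blast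
    next
      fix x assume "x \<in> r ` {w \<in> half_plane. u < Re w \<and> Re w < v \<and> Im w < 1}"
      then show "x \<in> {x \<in> D - {d q}. k x \<in> ?B}" using rD k(2) by auto
    qed
    finally show ?thesis .
  qed
  let ?U = "U0 - {d q}"
  have req: "t = t'" if "r (complex_of_real t) = r (complex_of_real t')" for t t'
    using inj_onD[OF rinj that realH realH] by simp
  have in_ab: "r (complex_of_real t) \<in> {a, b} \<longleftrightarrow> t = u \<or> t = v" for t
    using ends req[of t u] req[of t v] by auto
  have Us: "y \<in> ?U \<longleftrightarrow> y \<notin> {a, b}" if y: "y \<in> s" for y
  proof -
    obtain t where t: "t \<in> {u..v}" "y = r (complex_of_real t)" using y unfolding im[symmetric] by blast
    have "y \<in> D" using sD y by blast
    then have "y \<in> ?U \<longleftrightarrow> (\<exists>w. y = r w \<and> w \<in> half_plane \<and> u < Re w \<and> Re w < v \<and> Im w < 1)" using UD by blast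
    also have "\<dots> \<longleftrightarrow> u < t \<and> t < v"
    proof
      assume "\<exists>w. y = r w \<and> w \<in> half_plane \<and> u < Re w \<and> Re w < v \<and> Im w < 1"
      then obtain w where w: "y = r w" "w \<in> half_plane" "u < Re w" "Re w < v" by blast
      then have "w = complex_of_real t" using inj_onD[OF rinj _ w(2) realH] t(2) by simp
      then show "u < t \<and> t < v" using w by simp
    next
      assume "u < t \<and> t < v"
      then show "\<exists>w. y = r w \<and> w \<in> half_plane \<and> u < Re w \<and> Re w < v \<and> Im w < 1"
        using t(2) realH by (intro exI[of _ "complex_of_real t"]) auto
    qed
    also have "\<dots> \<longleftrightarrow> y \<notin> {a, b}" using in_ab[of t] t by auto
    finally show ?thesis .
  qed
  show thesis
    by (rule that[OF r(1) _ rinj uvl im ends Rek _ _ U UD ballI[OF Us]]) (use rD kr bd in auto)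
qed

text \<open>Around an inner point of an arc shared by the boundaries of two discs, the two discs are
  two half planes glued along a segment of the real line.\<close>

lemma arc_interior_not_boundary:
  assumes X: "Hausdorff_space X"
    and d: "parametrizes X (cball (0::complex) 1) d D" and d': "parametrizes X (cball (0::complex) 1) d' D'"
    and DD: "D \<inter> D' \<subseteq> d ` sphere 0 1 \<inter> d' ` sphere 0 1"
    and s: "arc_from X s a b" "s \<subseteq> D \<inter> D'" and x: "x \<in> s - {a, b}"
    and W: "openin X W" "W \<subseteq> D \<union> D'" "W \<inter> D \<inter> D' \<subseteq> s" "x \<in> W"
  shows "x \<notin> surface_boundary X"
proof -
  have s1: "s \<subseteq> d ` sphere 0 1" and s2: "s \<subseteq> d' ` sphere 0 1" using s(2) DD by blast+
  obtain r u v k U where r0: "continuous_map (top_of_set half_plane) X r"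
    "\<forall>w\<in>half_plane. r w \<in> D" "inj_on r half_plane"
    and uv: "u < v" "r ` complex_of_real ` {u..v} = s" "r u = a \<and> r v = b \<or> r u = b \<and> r v = a"
    and k0: "continuous_map (subtopology X s) euclideanreal k" "\<forall>t\<in>{u..v}. k (r (complex_of_real t)) = t"
    and rb0: "\<forall>w\<in>half_plane. r w \<in> d ` sphere 0 1 \<longleftrightarrow> Im w = 0"
    and U: "openin X U" "U \<inter> D = r ` {w \<in> half_plane. u < Re w \<and> Re w < v \<and> Im w < 1}"
    and Us: "\<forall>y\<in>s. y \<in> U \<longleftrightarrow> y \<notin> {a, b}"
    using arc_in_half_plane[OF X d s(1) s1] .
  note r = r0[rule_format] and k = k0[rule_format] and rb = rb0[rule_format]
  obtain r' u' v' k' U' where r'0: "continuous_map (top_of_set half_plane) X r'"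
    "\<forall>w\<in>half_plane. r' w \<in> D'" "inj_on r' half_plane"
    and uv': "u' < v'" "r' ` complex_of_real ` {u'..v'} = s" "r' u' = a \<and> r' v' = b \<or> r' u' = b \<and> r' v' = a"
    and k'0: "continuous_map (subtopology X s) euclideanreal k'" "\<forall>t\<in>{u'..v'}. k' (r' (complex_of_real t)) = t"
    and rb'0: "\<forall>w\<in>half_plane. r' w \<in> d' ` sphere 0 1 \<longleftrightarrow> Im w = 0"
    and U': "openin X U'" "U' \<inter> D' = r' ` {w \<in> half_plane. u' < Re w \<and> Re w < v' \<and> Im w < 1}"
    and U's: "\<forall>y\<in>s. y \<in> U' \<longleftrightarrow> y \<notin> {a, b}"
    using arc_in_half_plane[OF X d' s(1) s2] .
  note r' = r'0[rule_format] and k' = k'0[rule_format] and rb' = rb'0[rule_format]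
  have realH: "complex_of_real t \<in> half_plane" for t by (simp add: half_plane_def)
  \<comment> \<open>The change of coordinate on the common arc, from the first half plane to the
    second. It may reverse the direction.\<close>
  define \<rho> where "\<rho> = (\<lambda>t. k' (r (complex_of_real t)))"
  have rs: "r (complex_of_real t) \<in> s" if "t \<in> {u..v}" for t using uv(2) that by blast
  have r's: "r' (complex_of_real t) \<in> s" if "t \<in> {u'..v'}" for t using uv'(2) that by blast
  have \<rho>: "\<rho> t \<in> {u'..v'}" "r' (complex_of_real (\<rho> t)) = r (complex_of_real t)" if t: "t \<in> {u..v}" for t
  proof -
    obtain t' where "t' \<in> {u'..v'}" "r (complex_of_real t) = r' (complex_of_real t')"
      using rs[OF t] unfolding uv'(2)[symmetric] by blast
    then show "\<rho> t \<in> {u'..v'}" "r' (complex_of_real (\<rho> t)) = r (complex_of_real t)"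
      using k'(2) by (simp_all add: \<rho>_def)
  qed
  have req: "t = t'" if "r (complex_of_real t) = r (complex_of_real t')" for t t'
    using inj_onD[OF r(3) that realH realH] by simp
  have r'eq: "t = t'" if "r' (complex_of_real t) = r' (complex_of_real t')" for t t'
    using inj_onD[OF r'(3) that realH realH] by simp
  have in_ab: "r (complex_of_real t) \<in> {a, b} \<longleftrightarrow> t = u \<or> t = v" for t
    using uv(3) req[of t u] req[of t v] by auto
  have in_ab': "r' (complex_of_real t) \<in> {a, b} \<longleftrightarrow> t = u' \<or> t = v'" for t
    using uv'(3) r'eq[of t u'] r'eq[of t v'] by auto
  \<comment> \<open>The chart is defined on a closed rectangle, so that continuity and injectivity
    already give an embedding, and then restricted to its interior.\<close>
  define R where "R = {z. u \<le> Re z \<and> Re z \<le> v \<and> -1 \<le> Im z \<and> Im z \<le> 1}"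
  define Ro where "Ro = {z. u < Re z \<and> Re z < v \<and> -1 < Im z \<and> Im z < 1}"
  have Rbox: "R = cbox (Complex u (-1)) (Complex v 1)"
    by (auto simp: R_def in_cbox_complex_iff)
  have Rc: "compact R" unfolding Rbox by (rule compact_cbox)
  have Ro: "open Ro" unfolding Ro_def
    by (intro open_Collect_conj open_Collect_less continuous_intros)
  have RoR: "Ro \<subseteq> R" by (auto simp: Ro_def R_def)
  let ?A = "R \<inter> {z. Im z \<ge> 0}" and ?B = "R \<inter> {z. Im z \<le> 0}"
  \<comment> \<open>The lower half is reflected into the half plane of the second disc, with \<rho>
    adjusting the real coordinate so that both halves agree on the real line.\<close>
  define low where "low = (\<lambda>z. Complex (\<rho> (Re z)) (- Im z))"
  define h where "h = (\<lambda>z. if z \<in> ?A then r z else (r' \<circ> low) z)"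
  have "continuous_map (top_of_set {u..v}) (top_of_set half_plane) complex_of_real"
    unfolding continuous_map_in_subtopology using realH by (auto intro!: continuous_intros)
  then have "continuous_map (top_of_set {u..v}) X (r \<circ> complex_of_real)"
    using r(1) by (rule continuous_map_compose)
  then have "continuous_map (top_of_set {u..v}) (subtopology X s) (r \<circ> complex_of_real)"
    unfolding continuous_map_in_subtopology using rs by auto
  then have "continuous_map (top_of_set {u..v}) euclideanreal (k' \<circ> (r \<circ> complex_of_real))"
    using k'(1) by (rule continuous_map_compose)
  then have \<rho>c: "continuous_on {u..v} \<rho>" unfolding \<rho>_def by (simp add: o_def)
  have lowc: "continuous_on ?B low"
  proof -
    have "continuous_on ?B (\<lambda>z. \<rho> (Re z))"
      by (rule continuous_on_compose2[OF \<rho>c]) (auto intro!: continuous_intros simp: R_def)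
    then show ?thesis unfolding low_def Complex_eq by (intro continuous_intros)
  qed
  have lowH: "low z \<in> half_plane" if "z \<in> ?B" for z using that by (auto simp: low_def half_plane_def)
  have "continuous_map (top_of_set ?B) (top_of_set half_plane) low"
    unfolding continuous_map_in_subtopology using lowc lowH by auto
  then have cB: "continuous_map (top_of_set ?B) X (r' \<circ> low)"
    using r'(1) by (rule continuous_map_compose)
  have AH: "?A \<subseteq> half_plane" by (auto simp: half_plane_def)
  have cA: "continuous_map (top_of_set ?A) X r"
    by (rule continuous_map_from_subtopology_mono[OF r(1) AH])
  have clA: "closed ?A" "closed ?B"
    using compact_imp_closed[OF Rc] closed_halfspace_Im_ge[of 0] closed_halfspace_Im_le[of 0]
    by (auto intro!: closed_Int)
  have agree: "r z = (r' \<circ> low) z" if "z \<in> ?A \<inter> ?B" for z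
  proof -
    have z: "z = complex_of_real (Re z)" "Re z \<in> {u..v}" using that by (auto simp: R_def complex_eq_iff)
    have "low z = complex_of_real (\<rho> (Re z))" using that by (auto simp: low_def complex_eq_iff)
    then show ?thesis using \<rho>(2)[OF z(2)] z(1) by simp
  qed
  have AB: "?A \<union> ?B = R" by auto
  have hc: "continuous_map (top_of_set R) X h"
    using continuous_map_paste_euclidean[OF clA cA cB agree] unfolding AB h_def .
  have hA: "h z = r z" if "z \<in> ?A" for z using that by (simp add: h_def)
  have hB: "h z = r' (low z)" if "z \<in> ?B" for z using that agree[of z] by (auto simp: h_def)
  have sameA: "z = w" if "z \<in> ?A" "w \<in> ?A" "h z = h w" for z w
    using inj_onD[OF r(3)] hA that AH by auto
  have sameB: "z = w" if zw: "z \<in> ?B" "w \<in> ?B" "h z = h w" for z w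
  proof -
    have "low z = low w" using inj_onD[OF r'(3)] hB zw lowH by auto
    then have "\<rho> (Re z) = \<rho> (Re w)" "Im z = Im w" by (auto simp: low_def)
    moreover have "Re z \<in> {u..v}" "Re w \<in> {u..v}" using zw by (auto simp: R_def)
    ultimately have "r (complex_of_real (Re z)) = r (complex_of_real (Re w))"
      using \<rho>(2)[of "Re z"] \<rho>(2)[of "Re w"] by simp
    then have "Re z = Re w" by (rule req)
    then show ?thesis using \<open>Im z = Im w\<close> by (rule complex_eqI)
  qed
  \<comment> \<open>A common value of the two halves lies in both discs, hence on both rims, so both
    points are real and the injectivity of the lower half decides.\<close>
  have cross: "z = w" if zw: "z \<in> ?A" "w \<in> ?B" "h z = h w" for z w
  proof -
    have zH: "z \<in> half_plane" "low w \<in> half_plane" using zw AH lowH by auto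
    have "r z = r' (low w)" using zw hA hB by simp
    then have "r z \<in> D \<inter> D'" using r(2)[OF zH(1)] r'(2)[OF zH(2)] by auto
    then have "r z \<in> d ` sphere 0 1" "r' (low w) \<in> d' ` sphere 0 1" using DD \<open>r z = r' (low w)\<close> by auto
    then have "Im z = 0" "Im (low w) = 0" using rb rb' zH by blast+
    then have "Im z = 0" "Im w = 0" by (auto simp: low_def)
    then have "z \<in> ?B" using zw(1) by auto
    then show ?thesis using sameB zw by blast
  qed
  have hinj: "inj_on h R"
  proof (rule inj_onI)
    fix z w assume "z \<in> R" "w \<in> R" "h z = h w"
    moreover from this have "z \<in> ?A \<or> z \<in> ?B" "w \<in> ?A \<or> w \<in> ?B" by auto
    ultimately show "z = w" using sameA[of z w] sameB[of z w] cross[of z w] cross[of w z] by metis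
  qed
  have hp: "parametrizes X R h (h ` R)" using hc hinj by (simp add: parametrizes_def)
  let ?U = "U \<inter> D" and ?U' = "U' \<inter> D'"
  have hRo: "h ` Ro = ?U \<union> ?U'"
  proof (intro equalityI subsetI)
    fix y assume "y \<in> h ` Ro"
    then obtain z where z: "z \<in> Ro" "y = h z" by auto
    show "y \<in> ?U \<union> ?U'"
    proof (cases "Im z \<ge> 0")
      case True
      then have "z \<in> ?A" using z RoR by auto
      then have "y = r z" using hA z by simp
      moreover have "z \<in> {w \<in> half_plane. u < Re w \<and> Re w < v \<and> Im w < 1}"
        using z True by (auto simp: Ro_def half_plane_def)
      ultimately show ?thesis unfolding U(2) by blast
    next
      case False
      then have zB: "z \<in> ?B" using z RoR by auto
      then have y: "y = r' (low z)" using hB z by simp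
      have Rez: "Re z \<in> {u..v}" "Re z \<noteq> u" "Re z \<noteq> v" using z by (auto simp: Ro_def)
      then have "\<rho> (Re z) \<noteq> u' \<and> \<rho> (Re z) \<noteq> v'"
        using \<rho>(2)[OF Rez(1)] in_ab[of "Re z"] in_ab'[of "\<rho> (Re z)"] by auto
      then have "low z \<in> {w \<in> half_plane. u' < Re w \<and> Re w < v' \<and> Im w < 1}"
        using \<rho>(1)[OF Rez(1)] lowH[OF zB] z by (auto simp: low_def Ro_def)
      then show ?thesis unfolding U'(2) using y by blast
    qed
  next
    fix y assume "y \<in> ?U \<union> ?U'"
    then consider "y \<in> ?U" | "y \<in> ?U'" by blast
    then show "y \<in> h ` Ro"
    proof cases
      case 1
      then obtain w where w: "w \<in> half_plane" "u < Re w" "Re w < v" "Im w < 1" "y = r w"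
        unfolding U(2) by auto
      then have "w \<in> ?A" "w \<in> Ro" by (auto simp: half_plane_def R_def Ro_def)
      then show ?thesis using hA w(5) by (metis imageI)
    next
      case 2
      then obtain w where w: "w \<in> half_plane" "u' < Re w" "Re w < v'" "Im w < 1" "y = r' w"
        unfolding U'(2) by auto
      have "Re w \<in> {u'..v'}" using w by auto
      then obtain t where t: "t \<in> {u..v}" "r' (complex_of_real (Re w)) = r (complex_of_real t)"
        using r's[of "Re w"] unfolding uv(2)[symmetric] by blast
      have \<rho>t: "\<rho> t = Re w" using \<rho>(2)[OF t(1)] t(2) r'eq by metis
      have "t \<noteq> u" "t \<noteq> v" using in_ab[of t] in_ab'[of "Re w"] t(2) w by auto
      then have tt: "u < t" "t < v" using t by auto
      let ?z = "Complex t (- Im w)"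
      have "?z \<in> ?B" "?z \<in> Ro" using tt w by (auto simp: half_plane_def R_def Ro_def)
      moreover have "low ?z = w" by (simp add: low_def \<rho>t complex_eq_iff)
      ultimately show ?thesis using hB[of ?z] w(5) by (metis imageI)
    qed
  qed
  have clD: "closedin X D" "closedin X D'"
    using parametrizes_closedin[OF X _ compact_cball] d d' by blast+
  \<comment> \<open>The traces on the discs need not be open in \<open>X\<close>. Inside
    \<open>W\<close> their union is an open expression, because the discs overlap there only in
    \<open>s\<close>, where \<open>U\<close> and \<open>U'\<close> have the same points.\<close>
  have WU: "W \<inter> (?U \<union> ?U') = W \<inter> ((U \<inter> U') \<union> (U - D') \<union> (U' - D))"
  proof (intro set_eqI)
    fix y
    show "y \<in> W \<inter> (?U \<union> ?U') \<longleftrightarrow> y \<in> W \<inter> ((U \<inter> U') \<union> (U - D') \<union> (U' - D))"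
    proof (cases "y \<in> W")
      case True
      then have "y \<in> D \<or> y \<in> D'" using W(2) by blast
      moreover have "y \<in> U \<longleftrightarrow> y \<in> U'" if "y \<in> D" "y \<in> D'"
        using Us U's W(3) True that by blast
      ultimately show ?thesis by blast
    qed simp
  qed
  have "openin X (W \<inter> ((U \<inter> U') \<union> (U - D') \<union> (U' - D)))"
    using W(1) U(1) U'(1) clD by (intro openin_Int openin_Un openin_diff)
  then have oU: "openin X (W \<inter> h ` Ro)" unfolding hRo WU .
  define T where "T = {z \<in> Ro. h z \<in> W}"
  have hT: "h ` T = W \<inter> h ` Ro" by (auto simp: T_def)
  have "continuous_map (top_of_set Ro) X h" by (rule continuous_map_from_subtopology_mono[OF hc RoR])
  then have "openin (top_of_set Ro) T"
    using openin_continuous_map_preimage[OF _ W(1)] unfolding T_def by fastforce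
  then have oT: "open T" using Ro openin_open_eq by blast
  have "x \<in> U \<inter> D" using x s(2) Us by blast
  then have "x \<in> h ` T" unfolding hT hRo using W(4) by blast
  moreover have "T \<subseteq> R" using RoR by (auto simp: T_def)
  ultimately show ?thesis
    using open_chart_not_boundary[OF X hp Rc oT] oU unfolding hT by blast
qed

section \<open>Ribbon graphs with a given skeleton\<close>

lemma parametrizes_image:
  assumes "parametrizes X S h D" "continuous_map (subtopology X K) Y j" "inj_on j K" "D \<subseteq> K"
  shows "parametrizes Y S (j \<circ> h) (j ` D)"
proof -
  have h: "continuous_map (top_of_set S) X h" "inj_on h S" "h ` S = D"
    using assms(1) by (auto simp: parametrizes_def)
  have "continuous_map (top_of_set S) (subtopology X K) h"
    unfolding continuous_map_in_subtopology using h assms(4) by auto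
  then have "continuous_map (top_of_set S) Y (j \<circ> h)" using assms(2) by (rule continuous_map_compose)
  moreover have "inj_on (j \<circ> h) S"
    using h assms(3,4) by (intro comp_inj_on) (auto intro: inj_on_subset)
  moreover have "(j \<circ> h) ` S = j ` D" using h(3) by (simp only: image_comp[symmetric])
  ultimately show ?thesis unfolding parametrizes_def by blast
qed

text \<open>\<open>H\<close> arises from the copy of the skeleton embedded by \<open>j\<close> by spanning a vertex disc \<open>\<delta> c\<close> in
  every circle \<open>c\<close>.\<close>

definition presents :: "'a topology \<Rightarrow> ('a \<Rightarrow> 'b) \<Rightarrow> 'a set set \<Rightarrow> 'a set set \<Rightarrow> ('a set \<Rightarrow> 'b set) \<Rightarrow>
    'b ribbon_graph \<Rightarrow> bool" where
  "presents X j \<V> \<E> \<delta> H \<longleftrightarrow>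
     skeleton X \<V> \<E> \<and> Hausdorff_space (surface H) \<and>
     continuous_map (subtopology X (\<Union>\<V> \<union> \<Union>\<E>)) (surface H) j \<and> inj_on j (\<Union>\<V> \<union> \<Union>\<E>) \<and>
     vertices H = \<delta> ` \<V> \<and> edges H = (`) j ` \<E> \<and>
     topspace (surface H) = \<Union>(\<delta> ` \<V>) \<union> j ` \<Union>\<E> \<and>
     (\<forall>c\<in>\<V>. closed_disc_in (surface H) (\<delta> c) \<and> rim (surface H) (\<delta> c) = j ` c \<and>
        \<delta> c \<inter> j ` (\<Union>\<V> \<union> \<Union>\<E>) = j ` c) \<and>
     (\<forall>c\<in>\<V>. \<forall>c'\<in>\<V>. c \<noteq> c' \<longrightarrow> \<delta> c \<inter> \<delta> c' = {})"

lemma presentsD: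
  assumes "presents X j \<V> \<E> \<delta> H"
  shows "skeleton X \<V> \<E>" "Hausdorff_space (surface H)"
    "continuous_map (subtopology X (\<Union>\<V> \<union> \<Union>\<E>)) (surface H) j" "inj_on j (\<Union>\<V> \<union> \<Union>\<E>)"
    "vertices H = \<delta> ` \<V>" "edges H = (`) j ` \<E>"
    "topspace (surface H) = \<Union>(\<delta> ` \<V>) \<union> j ` \<Union>\<E>"
    "c \<in> \<V> \<Longrightarrow> closed_disc_in (surface H) (\<delta> c)"
    "c \<in> \<V> \<Longrightarrow> rim (surface H) (\<delta> c) = j ` c"
    "c \<in> \<V> \<Longrightarrow> \<delta> c \<inter> j ` (\<Union>\<V> \<union> \<Union>\<E>) = j ` c"
    "c \<in> \<V> \<Longrightarrow> c' \<in> \<V> \<Longrightarrow> c \<noteq> c' \<Longrightarrow> \<delta> c \<inter> \<delta> c' = {}"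
proof -
  note * = assms[unfolded presents_def]
  show "skeleton X \<V> \<E>" "Hausdorff_space (surface H)"
    "continuous_map (subtopology X (\<Union>\<V> \<union> \<Union>\<E>)) (surface H) j" "inj_on j (\<Union>\<V> \<union> \<Union>\<E>)"
    "vertices H = \<delta> ` \<V>" "edges H = (`) j ` \<E>"
    "topspace (surface H) = \<Union>(\<delta> ` \<V>) \<union> j ` \<Union>\<E>"
    using * by auto
  have "\<forall>c\<in>\<V>. closed_disc_in (surface H) (\<delta> c) \<and> rim (surface H) (\<delta> c) = j ` c \<and>
        \<delta> c \<inter> j ` (\<Union>\<V> \<union> \<Union>\<E>) = j ` c"
    using * by (elim conjE)
  from bspec[OF this] show "c \<in> \<V> \<Longrightarrow> closed_disc_in (surface H) (\<delta> c)"
    "c \<in> \<V> \<Longrightarrow> rim (surface H) (\<delta> c) = j ` c"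
    "c \<in> \<V> \<Longrightarrow> \<delta> c \<inter> j ` (\<Union>\<V> \<union> \<Union>\<E>) = j ` c"
    by simp_all
  have "\<forall>c\<in>\<V>. \<forall>c'\<in>\<V>. c \<noteq> c' \<longrightarrow> \<delta> c \<inter> \<delta> c' = {}" using * by (elim conjE)
  then show "c \<in> \<V> \<Longrightarrow> c' \<in> \<V> \<Longrightarrow> c \<noteq> c' \<Longrightarrow> \<delta> c \<inter> \<delta> c' = {}" by simp
qed

lemma presents_vertex:
  assumes p: "presents X j \<V> \<E> \<delta> H" and c: "c \<in> \<V>"
  obtains d where "parametrizes (surface H) (cball (0::complex) 1) d (\<delta> c)" "d ` sphere 0 1 = j ` c"
proof -
  obtain d where d: "parametrizes (surface H) (cball (0::complex) 1) d (\<delta> c)"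
    using presentsD(8)[OF p c] closed_disc_in_iff_parametrizes[OF presentsD(2)[OF p]] by blast
  have "d ` sphere 0 1 = j ` c"
    using surface_boundary_disc[OF presentsD(2)[OF p] d] presentsD(9)[OF p c] by (simp add: rim_def)
  then show thesis using that d by blast
qed

lemma presents_edge:
  assumes p: "presents X j \<V> \<E> \<delta> H" and e: "e \<in> \<E>"
  obtains d where "parametrizes (surface H) (cball (0::complex) 1) d (j ` e)" "d ` sphere 0 1 = j ` rim X e"
proof -
  note sk = presentsD(1)[OF p]
  have X: "Hausdorff_space X" using skeletonD(1)[OF sk] .
  obtain d where d: "parametrizes X (cball (0::complex) 1) d e"
    using skeletonD(4)[OF sk e] closed_disc_in_iff_parametrizes[OF X] by blast
  have "parametrizes (surface H) (cball 0 1) (j \<circ> d) (j ` e)"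
    by (rule parametrizes_image[OF d presentsD(3,4)[OF p]]) (use e in blast)
  moreover have "(j \<circ> d) ` sphere 0 1 = j ` rim X e"
    using surface_boundary_disc[OF X d] by (simp add: rim_def image_comp)
  ultimately show thesis using that by blast
qed

lemma presents_closedin:
  assumes p: "presents X j \<V> \<E> \<delta> H"
  shows "c \<in> \<V> \<Longrightarrow> closedin (surface H) (\<delta> c)" "e \<in> \<E> \<Longrightarrow> closedin (surface H) (j ` e)"
    "c \<in> \<V> \<Longrightarrow> compactin (surface H) (\<delta> c)" "e \<in> \<E> \<Longrightarrow> compactin (surface H) (j ` e)"
proof -
  show "compactin (surface H) (\<delta> c)" if "c \<in> \<V>" for c
    using presents_vertex[OF p that] parametrizes_compactin[OF _ compact_cball] by metis
  then show "closedin (surface H) (\<delta> c)" if "c \<in> \<V>" for c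
    using that compactin_imp_closedin[OF presentsD(2)[OF p]] by blast
  show "compactin (surface H) (j ` e)" if "e \<in> \<E>" for e
    using presents_edge[OF p that] parametrizes_compactin[OF _ compact_cball] by metis
  then show "closedin (surface H) (j ` e)" if "e \<in> \<E>" for e
    using that compactin_imp_closedin[OF presentsD(2)[OF p]] by blast
qed

lemma skeleton_finite_circles: "skeleton X \<V> \<E> \<Longrightarrow> finite \<V>"
  by (simp add: skeleton_def circles_def)

lemma presents_closedin_Union:
  assumes p: "presents X j \<V> \<E> \<delta> H" and "\<V>' \<subseteq> \<V>" "\<E>' \<subseteq> \<E>"
  shows "closedin (surface H) (\<Union>(\<delta> ` \<V>') \<union> j ` \<Union>\<E>')"
proof -
  have "finite \<V>'" "finite \<E>'"
    using assms skeleton_finite_circles[OF presentsD(1)[OF p]] skeletonD(3)[OF presentsD(1)[OF p]]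
    by (auto intro: finite_subset)
  then have "closedin (surface H) (\<Union>(\<delta> ` \<V>'))" "closedin (surface H) (\<Union>((`) j ` \<E>'))"
    using assms presents_closedin[OF p] by (auto intro!: closedin_Union)
  then have "closedin (surface H) (\<Union>(\<delta> ` \<V>') \<union> \<Union>((`) j ` \<E>'))" by (rule closedin_Un)
  then show ?thesis by (simp only: image_Union)
qed

lemma skeleton_compactin:
  assumes sk: "skeleton X \<V> \<E>"
  shows "compactin X (\<Union>\<V> \<union> \<Union>\<E>)"
proof -
  have X: "Hausdorff_space X" using skeletonD(1)[OF sk] .
  have "compactin X c" if "c \<in> \<V>" for c
    using skeletonD(2)[OF sk] that circle_in_compactin unfolding circles_def by blast
  moreover have "compactin X e" if "e \<in> \<E>" for e
    using skeletonD(4)[OF sk that] closed_disc_in_iff_parametrizes[OF X, of e]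
      parametrizes_compactin[OF _ compact_cball] by blast
  ultimately have "compactin X (\<Union>(\<V> \<union> \<E>))"
    using skeleton_finite_circles[OF sk] skeletonD(3)[OF sk] by (intro compactin_Union) auto
  then show ?thesis by (simp only: Union_Un_distrib)
qed

lemma presents_compact_space:
  assumes p: "presents X j \<V> \<E> \<delta> H"
  shows "compact_space (surface H)"
proof -
  have "compactin (surface H) (\<Union>(\<delta> ` \<V> \<union> (`) j ` \<E>))"
    using skeleton_finite_circles[OF presentsD(1)[OF p]] skeletonD(3)[OF presentsD(1)[OF p]]
      presents_closedin(3,4)[OF p] by (intro compactin_Union) auto
  moreover have "\<Union>(\<delta> ` \<V> \<union> (`) j ` \<E>) = topspace (surface H)"
    unfolding presentsD(7)[OF p] by (simp only: Union_Un_distrib image_Union)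
  ultimately show ?thesis by (simp add: compact_space_def)
qed

lemma presents_homeomorphic_map:
  assumes p: "presents X j \<V> \<E> \<delta> H"
  shows "homeomorphic_map (subtopology X (\<Union>\<V> \<union> \<Union>\<E>)) (subtopology (surface H) (j ` (\<Union>\<V> \<union> \<Union>\<E>))) j"
proof (rule continuous_imp_homeomorphic_map)
  let ?K = "\<Union>\<V> \<union> \<Union>\<E>"
  have K: "compactin X ?K" using skeleton_compactin[OF presentsD(1)[OF p]] .
  then show "compact_space (subtopology X ?K)" by (rule compact_space_subtopology)
  have tK: "topspace (subtopology X ?K) = ?K" using compactin_subset_topspace[OF K] by auto
  show "Hausdorff_space (subtopology (surface H) (j ` ?K))"
    by (rule Hausdorff_space_subtopology[OF presentsD(2)[OF p]])
  show "continuous_map (subtopology X ?K) (subtopology (surface H) (j ` ?K)) j"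
    unfolding continuous_map_in_subtopology using presentsD(3)[OF p] tK by auto
  have "j ` ?K \<subseteq> topspace (surface H)"
    using continuous_map_image_subset_topspace[OF presentsD(3)[OF p]] tK by auto
  then show "j ` topspace (subtopology X ?K) = topspace (subtopology (surface H) (j ` ?K))"
    using tK by auto
  show "inj_on j (topspace (subtopology X ?K))" unfolding tK by (rule presentsD(4)[OF p])
qed

section \<open>The boundary of a surface with a given skeleton\<close>

lemma free_boundary_subset:
  assumes sk: "skeleton X \<V> \<E>"
  shows "free_boundary X (\<Union>\<V>) \<E> \<subseteq> \<Union>\<V> \<union> \<Union>\<E>"
  unfolding free_boundary_def using skeleton_sides_subset[OF sk] by blast

lemma rim_diff_subset_sides:
  "e \<subseteq> topspace X \<Longrightarrow> rim X e - A \<subseteq> sides X A e"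
  unfolding sides_def by (rule closure_of_subset) (use rim_subset[of X e] in blast)

text \<open>Each point is examined in a neighbourhood obtained by removing closed pieces that avoid
  it. The delicate points lie on a vertex and an edge at once: they are on the boundary exactly if
  they are corners, which belong to \<open>sides\<close>.\<close>

lemma presents_surface_boundary:
  assumes p: "presents X j \<V> \<E> \<delta> H"
  shows "surface_boundary (surface H) = j ` free_boundary X (\<Union>\<V>) \<E>"
proof -
  let ?Y = "surface H" and ?A = "\<Union>\<V>" and ?K = "\<Union>\<V> \<union> \<Union>\<E>"
  note sk = presentsD(1)[OF p] and Y = presentsD(2)[OF p] and inj = presentsD(4)[OF p]
  have X: "Hausdorff_space X" using skeletonD(1)[OF sk] .
  have KX: "?K \<subseteq> topspace X" using compactin_subset_topspace[OF skeleton_compactin[OF sk]] .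
  have jin: "x = y" if "j x = j y" "x \<in> ?K" "y \<in> ?K" for x y using inj_onD[OF inj that] .
  have \<delta>K: "x \<in> c" if "j x \<in> \<delta> c" "c \<in> \<V>" "x \<in> ?K" for x c
  proof -
    have "j x \<in> j ` c" using presentsD(10)[OF p that(2)] that by blast
    then show ?thesis using jin that by blast
  qed
  have c\<delta>: "j x \<in> \<delta> c" if "x \<in> c" "c \<in> \<V>" for x c
    using presentsD(10)[OF p that(2)] that by blast
  \<comment> \<open>Without the other vertices and all edges, finitely many closed discs, an open
    set remains that lies inside \<open>\<delta> c\<close>. The edge case in \<open>echart\<close>
    is analogous.\<close>
  have main: "(y \<in> surface_boundary ?Y) = (y \<in> j ` c)"
    if y: "y \<in> \<delta> c" "y \<notin> j ` \<Union>\<E>" "c \<in> \<V>" for y c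
  proof -
      obtain d where d: "parametrizes ?Y (cball (0::complex) 1) d (\<delta> c)" "d ` sphere 0 1 = j ` c"
        using presents_vertex[OF p y(3)] .
      let ?W = "topspace ?Y - (\<Union>(\<delta> ` (\<V> - {c})) \<union> j ` \<Union>\<E>)"
      have W: "openin ?Y ?W" using presents_closedin_Union[OF p, of "\<V> - {c}" \<E>] by blast
      have Wc: "?W \<subseteq> \<delta> c" unfolding presentsD(7)[OF p] by blast
      have "y \<notin> \<Union>(\<delta> ` (\<V> - {c}))" using presentsD(11)[OF p _ y(3)] y(1) by blast
      moreover have "y \<in> topspace ?Y" unfolding presentsD(7)[OF p] using y by blast
      ultimately have "y \<in> ?W" using y(2) by blast
      then show ?thesis using disc_chart_boundary[OF Y d(1) W Wc] d(2) by simp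
  qed
  have vchart: "j x \<in> surface_boundary ?Y" if "x \<in> c" "c \<in> \<V>" "x \<notin> \<Union>\<E>" for x c
  proof -
    have "j x \<notin> j ` \<Union>\<E>" using jin that by blast
    then show ?thesis using main[OF c\<delta>[OF that(1,2)] _ that(2)] that(1) by blast
  qed
  have vchart2: "\<exists>x\<in>c. y = j x" if "y \<in> surface_boundary ?Y" "y \<in> \<delta> c" "y \<notin> j ` \<Union>\<E>" "c \<in> \<V>" for y c
    using main[OF that(2-4)] that(1) by blast
  have echart: "(j x \<in> surface_boundary ?Y) = (x \<in> rim X e)" if x: "x \<in> e" "e \<in> \<E>" "x \<notin> ?A" for x e
  proof -
    obtain d where d: "parametrizes ?Y (cball (0::complex) 1) d (j ` e)" "d ` sphere 0 1 = j ` rim X e"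
      using presents_edge[OF p x(2)] .
    let ?W = "topspace ?Y - (\<Union>(\<delta> ` \<V>) \<union> j ` \<Union>(\<E> - {e}))"
    have W: "openin ?Y ?W" using presents_closedin_Union[OF p, of \<V> "\<E> - {e}"] by blast
    have We: "?W \<subseteq> j ` e" unfolding presentsD(7)[OF p] by blast
    have "j x \<notin> \<Union>(\<delta> ` \<V>)" using \<delta>K x by blast
    moreover have "x \<notin> \<Union>(\<E> - {e})" using skeleton_disjoint[OF sk x(2)] x(1) by blast
    then have "j x \<notin> j ` \<Union>(\<E> - {e})" using jin x by blast
    moreover have "j x \<in> topspace ?Y" unfolding presentsD(7)[OF p] using x by blast
    ultimately have "j x \<in> ?W" by simp
    then have "j x \<in> surface_boundary ?Y \<longleftrightarrow> j x \<in> j ` rim X e"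
      using disc_chart_boundary[OF Y d(1) W We] d(2) by simp
    also have "\<dots> \<longleftrightarrow> x \<in> rim X e"
    proof -
      have "rim X e \<subseteq> ?K" using rim_subset[of X e] x(2) by blast
      then show ?thesis using jin[of x] x by blast
    qed
    finally show ?thesis .
  qed
  have rimtop: "e \<subseteq> topspace X" if "e \<in> \<E>" for e using KX that by blast
  show ?thesis
  proof (intro equalityI subsetI)
    fix y assume "y \<in> j ` free_boundary X ?A \<E>"
    then obtain x where x: "y = j x" "x \<in> free_boundary X ?A \<E>" by blast
    then consider "x \<in> ?A - \<Union>\<E>" | e where "e \<in> \<E>" "x \<in> sides X ?A e"
      unfolding free_boundary_def by blast
    then show "y \<in> surface_boundary ?Y"
    proof cases
      case 1
      then show ?thesis using vchart x(1) by blast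
    next
      case 2
      have xe: "x \<in> e" using skeleton_sides_subset[OF sk 2(1)] 2(2) by blast
      \<comment> \<open>Points of the rim off the vertex circles are decided by
        \<open>echart\<close>; the remaining points of the sides, the corners, follow because they
        are limits of these.\<close>
      let ?S = "rim X e - ?A"
      have SK: "?S \<subseteq> ?K" using rim_subset[of X e] 2(1) by blast
      have "(subtopology X ?K) closure_of ?S = ?K \<inter> X closure_of ?S"
        using SK by (simp add: closure_of_subtopology inf.absorb2)
      then have "x \<in> (subtopology X ?K) closure_of ?S"
        using 2 xe unfolding sides_def by blast
      then have "j x \<in> ?Y closure_of (j ` ?S)"
        using continuous_map_image_closure_subset[OF presentsD(3)[OF p], of ?S] by blast
      moreover have "j ` ?S \<subseteq> surface_boundary ?Y" using echart 2(1) rim_subset[of X e] by blast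
      then have "?Y closure_of (j ` ?S) \<subseteq> surface_boundary ?Y"
        by (rule closure_of_minimal[OF _ closedin_surface_boundary])
      ultimately show ?thesis using x(1) by blast
    qed
  next
    fix y assume y: "y \<in> surface_boundary ?Y"
    then have "y \<in> topspace ?Y" by (simp add: surface_boundary_def)
    then consider c where "c \<in> \<V>" "y \<in> \<delta> c" "y \<notin> j ` \<Union>\<E>"
      | e x where "e \<in> \<E>" "x \<in> e" "y = j x"
      unfolding presentsD(7)[OF p] by blast
    then show "y \<in> j ` free_boundary X ?A \<E>"
    proof cases
      case 1
      then obtain x where "x \<in> c" "y = j x" using vchart2[OF y 1(2,3,1)] by blast
      moreover from this have "x \<in> ?A - \<Union>\<E>" using 1 by blast
      ultimately show ?thesis unfolding free_boundary_def by blast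
    next
      case 2
      have xK: "x \<in> ?K" using 2 by blast
      have "x \<in> sides X ?A e"
      proof (cases "x \<in> ?A")
        case False
        then have "x \<in> rim X e - ?A" using echart[OF 2(2,1)] y 2(3) by blast
        then show ?thesis using rim_diff_subset_sides[OF rimtop[OF 2(1)]] by blast
      next
        case True
        then obtain c where c: "c \<in> \<V>" "x \<in> c" by blast
        show ?thesis
        proof (rule ccontr)
          assume ns: "x \<notin> sides X ?A e"
          obtain s1 p1 t1 p2 s2 p3 t2 p0 where cyc: "cyclic_arcs X s1 p1 t1 p2 s2 p3 t2 p0"
            "rim X e = s1 \<union> t1 \<union> s2 \<union> t2" "?A \<inter> e = s1 \<union> s2"
            using skeletonD(5)[OF sk 2(1)] by (rule attachedE)
          have a: "arc_from X s1 p0 p1" "arc_from X s2 p2 p3" and ss: "s1 \<inter> s2 = {}"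
            and st: "p0 \<in> t2" "p1 \<in> t1" "p2 \<in> t1" "p3 \<in> t2"
            using cyc(1) unfolding cyclic_arcs_def by auto
          have "x \<notin> t1 \<union> t2" using ns sides_eq[OF X cyc] by simp
          then have xs: "x \<in> s1 - {p0, p1} \<or> x \<in> s2 - {p2, p3}"
            using True 2(2) cyc(3) st by blast
          \<comment> \<open>\<open>s\<close> is the attaching segment with \<open>x\<close> as inner
            point and \<open>s'\<close> the other one; the two cases differ only in these
            names.\<close>
          obtain s s' a b where s: "arc_from X s a b" "closedin X s'" "s \<inter> s' = {}" "?A \<inter> e = s \<union> s'"
            "x \<in> s - {a, b}"
          proof (cases "x \<in> s1 - {p0, p1}")
            case True
            then show ?thesis by (intro that[OF a(1) arc_from_closedin[OF X a(2)] ss cyc(3)])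
          next
            case False
            moreover have "s2 \<inter> s1 = {}" "?A \<inter> e = s2 \<union> s1" using ss cyc(3) by blast+
            ultimately show ?thesis using xs by (intro that[OF a(2) arc_from_closedin[OF X a(1)]]) auto
          qed
          have sA: "s \<subseteq> ?A" "s \<subseteq> e" "s' \<subseteq> e" using s(4) by blast+
          have "s \<noteq> {}" using s(5) by blast
          then obtain c' where c': "c' \<in> \<V>" "s \<subseteq> c'"
          proof (rule connectedin_subset_of_disjoint_closed[OF arc_from_connectedin[OF s(1)] _ sA(1)])
          qed (use skeletonD(2)[OF sk] circle_in_closedin[OF X] in \<open>auto simp: circles_def\<close>)
          have sc: "s \<subseteq> c" using circles_unique[OF skeletonD(2)[OF sk] c'(1) c(1), of x] c' c s(5) by blast
          obtain d where d: "parametrizes ?Y (cball (0::complex) 1) d (\<delta> c)" "d ` sphere 0 1 = j ` c"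
            using presents_vertex[OF p c(1)] .
          obtain d' where d': "parametrizes ?Y (cball (0::complex) 1) d' (j ` e)" "d' ` sphere 0 1 = j ` rim X e"
            using presents_edge[OF p 2(1)] .
          have ce: "\<delta> c \<inter> j ` e = j ` (c \<inter> e)"
          proof
            show "\<delta> c \<inter> j ` e \<subseteq> j ` (c \<inter> e)" using \<delta>K[OF _ c(1)] 2(1) by blast
            show "j ` (c \<inter> e) \<subseteq> \<delta> c \<inter> j ` e" using c\<delta> c(1) by blast
          qed
          have cer: "c \<inter> e \<subseteq> rim X e" using cyc(2,3) c(1) by blast
          obtain q where q: "parametrizes X {0..1::real} q s" "q 0 = a" "q 1 = b"
            using s(1) unfolding arc_from_def by blast
          have sK: "s \<subseteq> ?K" "s' \<subseteq> ?K" using sA 2(1) by blast+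
          have ja: "arc_from ?Y (j ` s) (j a) (j b)"
            using parametrizes_image[OF q(1) presentsD(3,4)[OF p] sK(1)] q(2,3)
            unfolding arc_from_def by (intro exI[of _ "j \<circ> q"]) auto
          have "compactin (subtopology X ?K) s'"
            using closed_compactin[OF skeleton_compactin[OF sk] sK(2) s(2)] sK(2)
            by (simp add: compactin_subtopology)
          then have "compactin ?Y (j ` s')" using image_compactin presentsD(3)[OF p] by blast
          then have cs': "closedin ?Y (j ` s')" using compactin_imp_closedin[OF Y] by blast
          let ?Z = "\<Union>(\<delta> ` (\<V> - {c})) \<union> j ` \<Union>(\<E> - {e})"
          \<comment> \<open>The second segment is removed as well: at a loop it lies on the same
            vertex, and the neighbourhood may meet the common part of vertex and edge only in
            \<open>s\<close>.\<close>
          let ?W = "topspace ?Y - (?Z \<union> j ` s')"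
          have W: "openin ?Y ?W"
            using presents_closedin_Union[OF p, of "\<V> - {c}" "\<E> - {e}"] cs' by blast
          have W2: "?W \<subseteq> \<delta> c \<union> j ` e" unfolding presentsD(7)[OF p] by blast
          have W3: "?W \<inter> \<delta> c \<inter> j ` e \<subseteq> j ` s"
          proof -
            have "?W \<inter> \<delta> c \<inter> j ` e \<subseteq> (\<delta> c \<inter> j ` e) - j ` s'" by blast
            also have "\<dots> = j ` (c \<inter> e) - j ` s'" by (simp only: ce)
            also have "\<dots> \<subseteq> j ` s" using s(4) c(1) by blast
            finally show ?thesis .
          qed
          have W4: "j x \<in> ?W"
          proof -
            have "j x \<notin> \<Union>(\<delta> ` (\<V> - {c}))"
              using presentsD(11)[OF p _ c(1)] c\<delta>[OF c(2,1)] by blast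
            moreover have "x \<notin> \<Union>(\<E> - {e})" using skeleton_disjoint[OF sk 2(1)] 2(2) by blast
            then have "j x \<notin> j ` \<Union>(\<E> - {e})" using jin[OF _ xK] by blast
            moreover have "x \<notin> s'" using s(3,5) by blast
            then have "j x \<notin> j ` s'" using jin[OF _ xK] sK(2) by blast
            moreover have "j x \<in> topspace ?Y" using \<open>y \<in> topspace ?Y\<close> 2(3) by simp
            ultimately show ?thesis by blast
          qed
          have "a \<in> ?K" "b \<in> ?K" using arc_from_ends(1,2)[OF s(1)] sK(1) by auto
          then have "j x \<noteq> j a" "j x \<noteq> j b" using jin[OF _ xK] s(5) by blast+
          then have xab: "j x \<in> j ` s - {j a, j b}" using s(5) by blast
          have "j x \<notin> surface_boundary ?Y"
          proof (rule arc_interior_not_boundary[OF Y d(1) d'(1) _ ja _ xab W W2 W3 W4])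
            show "\<delta> c \<inter> j ` e \<subseteq> d ` sphere 0 1 \<inter> d' ` sphere 0 1"
              unfolding ce d(2) d'(2) using cer by blast
            show "j ` s \<subseteq> \<delta> c \<inter> j ` e" unfolding ce using sc sA(2) by blast
          qed
          then show False using y 2(3) by simp
        qed
      qed
      then show ?thesis using 2 unfolding free_boundary_def by blast
    qed
  qed
qed

lemma presents_boundary_components:
  assumes p: "presents X j \<V> \<E> \<delta> H"
  shows "boundary_components H = (`) j ` boundary_circles X \<V> \<E>"
proof -
  let ?K = "\<Union>\<V> \<union> \<Union>\<E>" and ?P = "free_boundary X (\<Union>\<V>) \<E>" and ?Y = "surface H"
  note sk = presentsD(1)[OF p]
  have PK: "?P \<subseteq> ?K" by (rule free_boundary_subset[OF sk])
  have KX: "?K \<subseteq> topspace X" using compactin_subset_topspace[OF skeleton_compactin[OF sk]] .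
  have jK: "j ` ?K \<subseteq> topspace ?Y"
    using continuous_map_image_subset_topspace[OF presentsD(3)[OF p]] KX by (simp add: inf.absorb2)
  have "homeomorphic_map (subtopology (subtopology X ?K) ?P)
      (subtopology (subtopology ?Y (j ` ?K)) (j ` ?P)) j"
  proof (rule homeomorphic_map_subtopologies[OF presents_homeomorphic_map[OF p]])
    have "topspace (subtopology X ?K) \<inter> ?P = ?P"
      unfolding topspace_subtopology using PK KX by blast
    moreover have "topspace (subtopology ?Y (j ` ?K)) \<inter> j ` ?P = j ` ?P"
      unfolding topspace_subtopology using PK jK by blast
    ultimately show "j ` (topspace (subtopology X ?K) \<inter> ?P) = topspace (subtopology ?Y (j ` ?K)) \<inter> j ` ?P"
      by (simp only:)
  qed
  moreover have "subtopology (subtopology X ?K) ?P = subtopology X ?P"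
    by (rule subtopology_subtopology_subset[OF PK])
  moreover have "subtopology (subtopology ?Y (j ` ?K)) (j ` ?P) = subtopology ?Y (j ` ?P)"
    by (rule subtopology_subtopology_subset[OF image_mono[OF PK]])
  ultimately have "homeomorphic_map (subtopology X ?P) (subtopology ?Y (j ` ?P)) j" by (simp only:)
  then have "connected_components_of (subtopology ?Y (j ` ?P)) = (`) j ` connected_components_of (subtopology X ?P)"
    by (rule homeomorphic_map_connected_components_of)
  then show ?thesis
    unfolding boundary_components_def boundary_curves_def presents_surface_boundary[OF p] boundary_circles_def .
qed

section \<open>Uniqueness and glued discs\<close>

text \<open>Alexander's trick: the cone over a self-map of the circle. At the origin the factor
  \<open>norm z\<close> makes the value 0, whatever \<open>\<alpha> (sgn 0)\<close> is.\<close>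

definition radial :: "(complex \<Rightarrow> complex) \<Rightarrow> complex \<Rightarrow> complex" where
  "radial \<alpha> z = norm z *\<^sub>R \<alpha> (sgn z)"

lemma radial_properties:
  assumes c: "continuous_on (sphere 0 1) \<alpha>" and im: "\<alpha> ` sphere 0 1 = sphere 0 1" and inj: "inj_on \<alpha> (sphere 0 1)"
  shows "continuous_on UNIV (radial \<alpha>)" "norm (radial \<alpha> z) = norm z" "inj (radial \<alpha>)" "surj (radial \<alpha>)"
    "norm z = 1 \<Longrightarrow> radial \<alpha> z = \<alpha> z"
proof -
  have sg: "sgn z \<in> sphere 0 1" if "z \<noteq> 0" for z :: complex using that by (simp add: norm_sgn)
  have n\<alpha>: "norm (\<alpha> w) = 1" if "w \<in> sphere 0 1" for w
    using im that by (metis imageI mem_sphere_0)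
  show nc: "norm (radial \<alpha> z) = norm z" for z
    using n\<alpha>[OF sg, of z] by (cases "z = 0") (auto simp: radial_def)
  show "radial \<alpha> z = \<alpha> z" if "norm z = 1" for z using that by (simp add: radial_def sgn_div_norm)
  have "continuous_on (UNIV - {0}) (\<lambda>z. \<alpha> (sgn z))"
    by (rule continuous_on_compose2[OF c]) (auto intro!: continuous_intros simp: norm_sgn split: if_splits)
  then have "continuous_on (UNIV - {0}) (radial \<alpha>)"
    unfolding radial_def by (intro continuous_intros)
  then have 1: "isCont (radial \<alpha>) z" if "z \<noteq> 0" for z
    using that by (simp add: continuous_on_eq_continuous_at open_Diff)
  \<comment> \<open>At the origin \<open>sgn\<close> is not continuous; continuity of the cone comes
    from the preserved norm.\<close>
  have "((\<lambda>z. norm (radial \<alpha> z)) \<longlongrightarrow> 0) (at 0)"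
    unfolding nc by (rule tendsto_norm_zero) (rule tendsto_ident_at)
  then have "(radial \<alpha> \<longlongrightarrow> 0) (at 0)" by (rule tendsto_norm_zero_cancel)
  then have "(radial \<alpha> \<longlongrightarrow> radial \<alpha> 0) (at 0)" by (simp only: radial_def norm_zero scaleR_zero_left)
  then have "isCont (radial \<alpha>) z" for z using 1 by (cases "z = 0") (auto simp: isCont_def)
  then show "continuous_on UNIV (radial \<alpha>)" by (simp add: continuous_on_eq_continuous_at)
  show "inj (radial \<alpha>)"
  proof (rule injI)
    fix z w assume e: "radial \<alpha> z = radial \<alpha> w"
    then have n: "norm z = norm w" using nc by metis
    show "z = w"
    proof (cases "z = 0")
      case False
      then have w: "w \<noteq> 0" using n by auto
      then have "\<alpha> (sgn z) = \<alpha> (sgn w)" using e n by (simp add: radial_def)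
      then have "sgn z = sgn w" using inj_onD[OF inj] sg False w by blast
      then have "norm z *\<^sub>R sgn z = norm w *\<^sub>R sgn w" using n by simp
      then show ?thesis using False w by (simp add: sgn_div_norm)
    qed (use n in auto)
  qed
  show "surj (radial \<alpha>)"
  proof (rule surjI)
    fix w :: complex
    show "radial \<alpha> (if w = 0 then 0 else norm w *\<^sub>R (SOME u. u \<in> sphere 0 1 \<and> \<alpha> u = sgn w)) = w"
    proof (cases "w = 0")
      case False
      define u where "u = (SOME u. u \<in> sphere 0 1 \<and> \<alpha> u = sgn w)"
      have "\<exists>u. u \<in> sphere 0 1 \<and> \<alpha> u = sgn w" using sg[OF False] im by (metis imageE)
      then have "u \<in> sphere 0 1 \<and> \<alpha> u = sgn w" unfolding u_def by (rule someI_ex)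
      then have u: "norm u = 1" "\<alpha> u = sgn w" by auto
      then have "sgn (norm w *\<^sub>R u) = u" using False by (simp add: sgn_div_norm)
      then have "radial \<alpha> (norm w *\<^sub>R u) = norm w *\<^sub>R sgn w" using u by (simp add: radial_def)
      also have "\<dots> = w" using False by (simp add: sgn_div_norm)
      finally show ?thesis using False u_def by simp
    qed (simp add: radial_def)
  qed
qed

text \<open>In disc coordinates \<psi> is a self-homeomorphism of the unit circle, and its cone
  extends it over the disc.\<close>

lemma disc_extension:
  assumes Y: "Hausdorff_space Y" and d: "parametrizes Y (cball (0::complex) 1) d D"
    and Y': "Hausdorff_space Y'" and d': "parametrizes Y' (cball (0::complex) 1) d' D'"
    and \<psi>: "continuous_map (subtopology Y (d ` sphere 0 1)) Y' \<psi>" "inj_on \<psi> (d ` sphere 0 1)"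
      "\<psi> ` d ` sphere 0 1 = d' ` sphere 0 1"
  shows "\<exists>\<Psi>. continuous_map (subtopology Y D) Y' \<Psi> \<and> inj_on \<Psi> D \<and> \<Psi> ` D = D' \<and>
    (\<forall>x\<in>d ` sphere 0 1. \<Psi> x = \<psi> x)"
proof -
  have dc: "continuous_map (top_of_set (cball 0 1)) Y d" "inj_on d (cball 0 1)" "d ` cball 0 1 = D"
    using d by (auto simp: parametrizes_def)
  have dc': "continuous_map (top_of_set (cball 0 1)) Y' d'" "inj_on d' (cball 0 1)" "d' ` cball 0 1 = D'"
    using d' by (auto simp: parametrizes_def)
  obtain m where m: "continuous_map (subtopology Y D) (top_of_set (cball 0 1)) m"
    "\<And>z. z \<in> cball 0 1 \<Longrightarrow> m (d z) = z" "\<And>x. x \<in> D \<Longrightarrow> d (m x) = x" "m ` D = cball 0 1"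
    using parametrizes_inverse[OF Y compact_cball d] by metis
  obtain m' where m': "continuous_map (subtopology Y' D') (top_of_set (cball 0 1)) m'"
    "\<And>z. z \<in> cball 0 1 \<Longrightarrow> m' (d' z) = z" "\<And>x. x \<in> D' \<Longrightarrow> d' (m' x) = x" "m' ` D' = cball 0 1"
    using parametrizes_inverse[OF Y' compact_cball d'] by metis
  have S: "sphere (0::complex) 1 \<subseteq> cball 0 1" by auto
  have SD': "d' ` sphere 0 1 \<subseteq> D'" using S dc'(3) by blast
  define \<alpha> where "\<alpha> = m' \<circ> (\<psi> \<circ> d)"
  have "continuous_map (top_of_set (sphere 0 1)) Y d"
    by (rule continuous_map_from_subtopology_mono[OF dc(1) S])
  then have "continuous_map (top_of_set (sphere 0 1)) (subtopology Y (d ` sphere 0 1)) d"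
    unfolding continuous_map_in_subtopology by auto
  then have "continuous_map (top_of_set (sphere 0 1)) Y' (\<psi> \<circ> d)" using \<psi>(1) by (rule continuous_map_compose)
  moreover have pd: "(\<psi> \<circ> d) ` sphere 0 1 = d' ` sphere 0 1" using \<psi>(3) by (simp only: image_comp)
  moreover have "(\<psi> \<circ> d) z \<in> D'" if "z \<in> sphere 0 1" for z using pd SD' that by blast
  ultimately have "continuous_map (top_of_set (sphere 0 1)) (subtopology Y' D') (\<psi> \<circ> d)"
    unfolding continuous_map_in_subtopology by auto
  then have "continuous_map (top_of_set (sphere 0 1)) (top_of_set (cball 0 1)) \<alpha>"
    unfolding \<alpha>_def using m'(1) by (rule continuous_map_compose)
  then have c: "continuous_on (sphere 0 1) \<alpha>" unfolding continuous_map_in_subtopology by simp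
  have md': "m' ` d' ` sphere 0 1 = sphere 0 1" using m'(2) S by (force simp: image_iff)
  have im: "\<alpha> ` sphere 0 1 = sphere 0 1"
    unfolding \<alpha>_def image_comp[symmetric] using \<psi>(3) md' by (simp only: image_comp)
  have "inj_on m' D'" using m'(3) by (rule inj_on_inverseI)
  then have mi: "inj_on m' ((\<psi> \<circ> d) ` sphere 0 1)" unfolding pd using SD' by (rule inj_on_subset)
  have "inj_on d (sphere 0 1)" using dc(2) S by (rule inj_on_subset)
  then have "inj_on (\<psi> \<circ> d) (sphere 0 1)" using \<psi>(2) by (rule comp_inj_on)
  then have inj: "inj_on \<alpha> (sphere 0 1)" unfolding \<alpha>_def using mi by (rule comp_inj_on)
  note k = radial_properties[OF c im inj]
  have kc: "radial \<alpha> z \<in> cball 0 1 \<longleftrightarrow> z \<in> cball 0 1" for z using k(2)[of z] by simp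
  define \<Psi> where "\<Psi> = d' \<circ> (radial \<alpha> \<circ> m)"
  have "continuous_map (top_of_set (cball 0 1)) (top_of_set (cball 0 1)) (radial \<alpha>)"
    unfolding continuous_map_in_subtopology using kc continuous_on_subset[OF k(1)] by auto
  with m(1) have "continuous_map (subtopology Y D) (top_of_set (cball 0 1)) (radial \<alpha> \<circ> m)"
    by (rule continuous_map_compose)
  then have 1: "continuous_map (subtopology Y D) Y' \<Psi>"
    unfolding \<Psi>_def using dc'(1) by (rule continuous_map_compose)
  have kim: "radial \<alpha> ` cball 0 1 = cball 0 1"
  proof (intro equalityI subsetI)
    fix z assume "z \<in> radial \<alpha> ` cball 0 1"
    then show "z \<in> cball 0 1" using kc by blast
  next
    fix z assume z: "z \<in> cball (0::complex) 1"
    obtain w where "radial \<alpha> w = z" using k(4) by (metis surjD)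
    then show "z \<in> radial \<alpha> ` cball 0 1" using kc z by blast
  qed
  have 2: "\<Psi> ` D = D'" unfolding \<Psi>_def image_comp[symmetric] m(4) kim dc'(3) ..
  have "inj_on m D" using m(3) by (rule inj_on_inverseI)
  moreover have "inj_on (radial \<alpha>) (m ` D)" using k(3) by (rule inj_on_subset) simp
  ultimately have "inj_on (radial \<alpha> \<circ> m) D" by (rule comp_inj_on)
  moreover have "inj_on d' ((radial \<alpha> \<circ> m) ` D)" unfolding image_comp[symmetric] m(4) kim by (rule dc'(2))
  ultimately have 3: "inj_on \<Psi> D" unfolding \<Psi>_def by (rule comp_inj_on)
  have 4: "\<Psi> (d z) = \<psi> (d z)" if z: "z \<in> sphere 0 1" for z
  proof -
    have "radial \<alpha> z = m' (\<psi> (d z))" using k(5)[of z] z by (simp add: \<alpha>_def)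
    moreover have "\<psi> (d z) \<in> D'" using \<psi>(3) SD' z by blast
    moreover have "m (d z) = z" using m(2) S z by blast
    ultimately show ?thesis using m'(3) by (simp add: \<Psi>_def)
  qed
  show ?thesis using 1 2 3 4 by blast
qed

text \<open>On the embedded skeleton the map is forced to be \<open>j'\<close> after the inverse of
  \<open>j\<close>; every vertex disc is filled in by \<open>disc_extension\<close>, and the
  finitely many closed pieces are pasted. The arbitrary choice in \<open>attaching_map\<close> is
  thereby irrelevant up to equivalence.\<close>

lemma presents_unique:
  assumes p: "presents X j \<V> \<E> \<delta> H" and p': "presents X j' \<V> \<E> \<delta>' H'"
  obtains \<phi> where "homeomorphic_map (surface H) (surface H') \<phi>" "\<forall>c\<in>\<V>. \<phi> ` \<delta> c = \<delta>' c"
    "\<forall>x\<in>\<Union>\<V> \<union> \<Union>\<E>. \<phi> (j x) = j' x"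
proof -
  let ?K = "\<Union>\<V> \<union> \<Union>\<E>" and ?Y = "surface H" and ?Y' = "surface H'"
  note sk = presentsD(1)[OF p] and Y = presentsD(2)[OF p] and Y' = presentsD(2)[OF p']
  have KX: "?K \<subseteq> topspace X" using compactin_subset_topspace[OF skeleton_compactin[OF sk]] .
  obtain i where i: "homeomorphic_maps (subtopology X ?K) (subtopology ?Y (j ` ?K)) j i"
    using presents_homeomorphic_map[OF p] homeomorphic_map_maps by blast
  have "topspace (subtopology X ?K) = ?K" using KX by (simp only: topspace_subtopology inf.absorb2)
  then have ij: "i (j x) = x" if "x \<in> ?K" for x
    using i that unfolding homeomorphic_maps_def by simp
  have "continuous_map (subtopology ?Y (j ` ?K)) (subtopology X ?K) i"
    using i unfolding homeomorphic_maps_def by blast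
  then have \<psi>c: "continuous_map (subtopology ?Y (j ` ?K)) ?Y' (j' \<circ> i)"
    using presentsD(3)[OF p'] by (rule continuous_map_compose)
  have \<psi>: "(j' \<circ> i) (j x) = j' x" if "x \<in> ?K" for x using ij[OF that] by simp
  have jin: "x = y" if "j x = j y" "x \<in> ?K" "y \<in> ?K" for x y using inj_onD[OF presentsD(4)[OF p] that] .
  have jin': "x = y" if "j' x = j' y" "x \<in> ?K" "y \<in> ?K" for x y using inj_onD[OF presentsD(4)[OF p'] that] .
  have "\<exists>\<Psi>. continuous_map (subtopology ?Y (\<delta> c)) ?Y' \<Psi> \<and> inj_on \<Psi> (\<delta> c) \<and> \<Psi> ` \<delta> c = \<delta>' c \<and>
      (\<forall>x\<in>c. \<Psi> (j x) = j' x)" if c: "c \<in> \<V>" for c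
  proof -
    obtain d where d: "parametrizes ?Y (cball (0::complex) 1) d (\<delta> c)" "d ` sphere 0 1 = j ` c"
      using presents_vertex[OF p c] .
    obtain d' where d': "parametrizes ?Y' (cball (0::complex) 1) d' (\<delta>' c)" "d' ` sphere 0 1 = j' ` c"
      using presents_vertex[OF p' c] .
    have cK: "c \<subseteq> ?K" using c by blast
    have 1: "continuous_map (subtopology ?Y (d ` sphere 0 1)) ?Y' (j' \<circ> i)"
      unfolding d(2) by (rule continuous_map_from_subtopology_mono[OF \<psi>c image_mono[OF cK]])
    have 2: "inj_on (j' \<circ> i) (d ` sphere 0 1)"
      unfolding d(2)
    proof (rule inj_onI)
      fix x y assume xy: "x \<in> j ` c" "y \<in> j ` c" "(j' \<circ> i) x = (j' \<circ> i) y"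
      then obtain x0 y0 where "x = j x0" "y = j y0" "x0 \<in> ?K" "y0 \<in> ?K" using cK by blast
      then show "x = y" using xy(3) \<psi> jin' by metis
    qed
    have "(j' \<circ> i) ` j ` c = j' ` c"
      unfolding image_image by (rule image_cong[OF refl]) (use \<psi> cK in blast)
    then have 3: "(j' \<circ> i) ` d ` sphere 0 1 = d' ` sphere 0 1" unfolding d(2) d'(2) .
    have "\<exists>\<Psi>. continuous_map (subtopology ?Y (\<delta> c)) ?Y' \<Psi> \<and> inj_on \<Psi> (\<delta> c) \<and> \<Psi> ` \<delta> c = \<delta>' c \<and>
      (\<forall>x\<in>d ` sphere 0 1. \<Psi> x = (j' \<circ> i) x)"
      by (rule disc_extension[OF Y d(1) Y' d'(1) 1 2 3])
    then obtain \<Psi> where P: "continuous_map (subtopology ?Y (\<delta> c)) ?Y' \<Psi> \<and> inj_on \<Psi> (\<delta> c) \<and> \<Psi> ` \<delta> c = \<delta>' c"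
      "\<forall>x\<in>j ` c. \<Psi> x = (j' \<circ> i) x" unfolding d(2) by (elim exE conjE) (rule that, simp_all)
    have "\<forall>x\<in>c. \<Psi> (j x) = j' x" using P(2) \<psi> cK by (metis imageI subsetD)
    then show ?thesis using P(1) by blast
  qed
  then obtain \<Psi> where \<Psi>: "\<And>c. c \<in> \<V> \<Longrightarrow> continuous_map (subtopology ?Y (\<delta> c)) ?Y' (\<Psi> c) \<and>
      inj_on (\<Psi> c) (\<delta> c) \<and> \<Psi> c ` \<delta> c = \<delta>' c \<and> (\<forall>x\<in>c. \<Psi> c (j x) = j' x)"
    by metis
  \<comment> \<open>Index set of the closed pieces: \<open>None\<close> for the embedded skeleton,
    \<open>Some c\<close> for the disc in the circle \<open>c\<close>.\<close>
  define I where "I = insert None (Some ` \<V>)"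
  define T where "T = (\<lambda>u. case u of None \<Rightarrow> j ` ?K | Some c \<Rightarrow> \<delta> c)"
  define f where "f = (\<lambda>u. case u of None \<Rightarrow> j' \<circ> i | Some c \<Rightarrow> \<Psi> c)"
  have jK: "compactin ?Y (j ` ?K)"
  proof -
    have "compactin (subtopology X ?K) ?K" using skeleton_compactin[OF sk] by (simp add: compactin_subtopology)
    then show ?thesis using presentsD(3)[OF p] by (rule image_compactin)
  qed
  have agreeK: "\<Psi> c x = (j' \<circ> i) x" if c: "c \<in> \<V>" "x \<in> \<delta> c" "x \<in> j ` ?K" for c x
  proof -
    have "x \<in> j ` c" using presentsD(10)[OF p c(1)] c(2,3) by blast
    then obtain y where "y \<in> c" "x = j y" by blast
    moreover from this have "y \<in> ?K" using c(1) by blast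
    ultimately show ?thesis using \<Psi>[OF c(1)] \<psi> by metis
  qed
  have "\<exists>\<phi>. continuous_map ?Y ?Y' \<phi> \<and> (\<forall>u\<in>I. \<forall>x\<in>topspace ?Y \<inter> T u. \<phi> x = f u x)"
  proof (rule pasting_lemma_exists_closed[of I ?Y T ?Y' f])
    fix g assume "continuous_map ?Y ?Y' g" "\<And>x i. i \<in> I \<Longrightarrow> x \<in> topspace ?Y \<inter> T i \<Longrightarrow> g x = f i x"
    then show "\<exists>\<phi>. continuous_map ?Y ?Y' \<phi> \<and> (\<forall>u\<in>I. \<forall>x\<in>topspace ?Y \<inter> T u. \<phi> x = f u x)"
      by (intro exI[of _ g]) simp
  next
    show "finite I" using skeleton_finite_circles[OF sk] by (simp add: I_def)
    show "topspace ?Y \<subseteq> \<Union>(T ` I)"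
      unfolding presentsD(7)[OF p] by (auto simp: I_def T_def)
    show "closedin ?Y (T u)" if "u \<in> I" for u
      using that compactin_imp_closedin[OF Y jK] presents_closedin(1)[OF p] by (auto simp: I_def T_def)
    show "continuous_map (subtopology ?Y (T u)) ?Y' (f u)" if "u \<in> I" for u
      using that \<psi>c \<Psi> unfolding I_def T_def f_def by (auto simp del: comp_apply)
    show "f u x = f v x" if uv: "u \<in> I" "v \<in> I" "x \<in> topspace ?Y \<inter> T u \<inter> T v" for u v x
    proof (cases u)
      case None
      show ?thesis
      proof (cases v)
        case (Some c)
        have "c \<in> \<V>" "x \<in> \<delta> c" "x \<in> j ` ?K" using uv Some None by (auto simp: I_def T_def)
        then show ?thesis using agreeK[of c x] None Some by (simp add: f_def)
      qed (simp add: None)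
    next
      case (Some c)
      show ?thesis
      proof (cases v)
        case None
        have "c \<in> \<V>" "x \<in> \<delta> c" "x \<in> j ` ?K" using uv Some None by (auto simp: I_def T_def)
        then show ?thesis using agreeK[of c x] None Some by (simp add: f_def)
      next
        case (Some c')
        have "c \<in> \<V>" "c' \<in> \<V>" "x \<in> \<delta> c" "x \<in> \<delta> c'"
          using uv \<open>u = Some c\<close> Some by (auto simp: I_def T_def)
        then have "c = c'" using presentsD(11)[OF p, of c c'] by blast
        then show ?thesis using \<open>u = Some c\<close> Some by simp
      qed
    qed
  qed
  then obtain \<phi> where \<phi>c: "continuous_map ?Y ?Y' \<phi>" and \<phi>f0: "\<forall>u\<in>I. \<forall>x\<in>topspace ?Y \<inter> T u. \<phi> x = f u x"
    by (elim exE conjE)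
  have \<phi>f: "\<phi> x = f u x" if "u \<in> I" "x \<in> topspace ?Y \<inter> T u" for x u
    using bspec[OF bspec[OF \<phi>f0 that(1)] that(2)] .
  have jKY: "j ` ?K \<subseteq> topspace ?Y" and \<delta>Y: "\<And>c. c \<in> \<V> \<Longrightarrow> \<delta> c \<subseteq> topspace ?Y"
    using compactin_subset_topspace[OF jK] compactin_subset_topspace[OF presents_closedin(3)[OF p]] by simp_all
  have \<phi>K: "\<phi> (j x) = j' x" if "x \<in> ?K" for x
  proof -
    have "j x \<in> topspace ?Y \<inter> T None" using that jKY by (auto simp: T_def)
    then have "\<phi> (j x) = f None (j x)" by (intro \<phi>f) (auto simp: I_def)
    then show ?thesis using \<psi>[OF that] by (simp add: f_def)
  qed
  have \<phi>\<delta>: "\<phi> x = \<Psi> c x" if "c \<in> \<V>" "x \<in> \<delta> c" for x c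
  proof -
    have "\<phi> x = f (Some c) x"
      by (rule \<phi>f) (use that \<delta>Y[OF that(1)] in \<open>auto simp: I_def T_def\<close>)
    then show ?thesis by (simp add: f_def)
  qed
  have \<phi>im: "\<phi> ` \<delta> c = \<delta>' c" if "c \<in> \<V>" for c
    using \<Psi>[OF that] \<phi>\<delta>[OF that] by (metis image_cong)
  have top: "topspace ?Y = \<Union>(\<delta> ` \<V>) \<union> j ` \<Union>\<E>" "topspace ?Y' = \<Union>(\<delta>' ` \<V>) \<union> j' ` \<Union>\<E>"
    using presentsD(7)[OF p] presentsD(7)[OF p'] .
  have sur: "\<phi> ` topspace ?Y = topspace ?Y'"
  proof -
    have "\<phi> ` j ` \<Union>\<E> = j' ` \<Union>\<E>" using \<phi>K by (force simp: image_iff)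
    moreover have "\<phi> ` \<Union>(\<delta> ` \<V>) = \<Union>(\<delta>' ` \<V>)" by (simp add: image_Union image_image \<phi>im)
    ultimately show ?thesis unfolding top image_Un by simp
  qed
  have in\<delta>: "x = y" if "c \<in> \<V>" "x \<in> \<delta> c" "y \<in> \<delta> c" "\<phi> x = \<phi> y" for x y c
    using \<Psi>[OF that(1)] \<phi>\<delta>[OF that(1)] that by (metis inj_onD)
  \<comment> \<open>The common image lies in \<open>\<delta>' c\<close> and on the skeleton, hence
    on the circle of that disc; so \<open>y\<close> is on \<open>c\<close>, and injectivity on
    \<open>\<delta> c\<close> applies.\<close>
  have cr: "x = j y" if c: "c \<in> \<V>" "x \<in> \<delta> c" and y: "y \<in> ?K" "\<phi> x = \<phi> (j y)" for x y c
  proof -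
    have "\<phi> x \<in> \<delta>' c" using c \<phi>im by blast
    then have "j' y \<in> \<delta>' c \<inter> j' ` ?K" using y \<phi>K by auto
    then have "j' y \<in> j' ` c" using presentsD(10)[OF p' c(1)] by simp
    then have "y \<in> c" using jin'[OF _ y(1)] c(1) by blast
    then have "j y \<in> \<delta> c" using presentsD(10)[OF p c(1)] by blast
    then show ?thesis using in\<delta>[OF c(1,2)] y(2) by blast
  qed
  have inj: "inj_on \<phi> (topspace ?Y)"
  proof (rule inj_onI)
    fix x y assume x: "x \<in> topspace ?Y" and y: "y \<in> topspace ?Y" and e: "\<phi> x = \<phi> y"
    have cov: "(\<exists>c\<in>\<V>. z \<in> \<delta> c) \<or> (\<exists>w\<in>?K. z = j w)" if "z \<in> topspace ?Y" for z
      using that unfolding top by blast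
    from cov[OF x] show "x = y"
    proof
      assume "\<exists>c\<in>\<V>. x \<in> \<delta> c"
      then obtain c where c: "c \<in> \<V>" "x \<in> \<delta> c" by blast
      from cov[OF y] show ?thesis
      proof
        assume "\<exists>c\<in>\<V>. y \<in> \<delta> c"
        then obtain c' where c': "c' \<in> \<V>" "y \<in> \<delta> c'" by blast
        have "\<phi> x \<in> \<delta>' c" "\<phi> y \<in> \<delta>' c'" using \<phi>im[OF c(1)] \<phi>im[OF c'(1)] c c' by blast+
        then have "c = c'" using presentsD(11)[OF p' c(1) c'(1)] e by auto
        then show ?thesis using in\<delta>[OF c] c' e by blast
      next
        assume "\<exists>w\<in>?K. y = j w"
        then show ?thesis using cr[OF c] e by blast
      qed
    next
      assume "\<exists>w\<in>?K. x = j w"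
      then obtain w where w: "w \<in> ?K" "x = j w" by blast
      from cov[OF y] show ?thesis
      proof
        assume "\<exists>c\<in>\<V>. y \<in> \<delta> c"
        then obtain c' where c': "c' \<in> \<V>" "y \<in> \<delta> c'" by blast
        have "y = j w" by (rule cr[OF c' w(1)]) (simp only: e[symmetric] w(2))
        then show ?thesis using w(2) by simp
      next
        assume "\<exists>w\<in>?K. y = j w"
        then obtain v where v: "v \<in> ?K" "y = j v" by blast
        have "j' w = j' v" using e w v \<phi>K by simp
        then show ?thesis using jin'[OF _ w(1) v(1)] w v by simp
      qed
    qed
  qed
  have "homeomorphic_map ?Y ?Y' \<phi>"
    by (rule continuous_imp_homeomorphic_map[OF \<phi>c presents_compact_space[OF p] Y' sur inj])
  then show thesis using that \<phi>im \<phi>K by blast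
qed

section \<open>Topology of the space with discs glued along circles\<close>

lemma attaching_map_parametrizes:
  assumes "Hausdorff_space X" "circle_in X c"
  shows "parametrizes X (sphere (0::complex) 1) (attaching_map X c) c"
proof -
  obtain h where h: "parametrizes X (sphere (0::complex) 1) h c" using assms(2) circle_in_def by blast
  then have "\<exists>h. homeomorphic_map (top_of_set (sphere (0::complex) 1)) (subtopology X c) h"
    using parametrizes_homeomorphic_map[OF assms(1) compact_sphere] by blast
  then have "homeomorphic_map (top_of_set (sphere (0::complex) 1)) (subtopology X c) (attaching_map X c)"
    unfolding attaching_map_def by (rule someI_ex)
  then show ?thesis using homeomorphic_map_parametrizes parametrizes_subset_topspace[OF h] by blast
qed

locale gluing =
  fixes X :: "'a topology" and S :: "'a set set"
  assumes X: "Hausdorff_space X" and S: "\<And>c. c \<in> S \<Longrightarrow> circle_in X c"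
begin

abbreviation Z :: "'a glued topology" where "Z \<equiv> glue_discs X S"

lemma attach:
  assumes "c \<in> S"
  shows "continuous_map (top_of_set (sphere 0 1)) X (attaching_map X c)"
    "inj_on (attaching_map X c) (sphere 0 1)" "attaching_map X c ` sphere 0 1 = c"
    "norm z = 1 \<Longrightarrow> attaching_map X c z \<in> topspace X"
proof -
  note h = attaching_map_parametrizes[OF X S[OF assms]]
  show 1: "continuous_map (top_of_set (sphere 0 1)) X (attaching_map X c)"
    "inj_on (attaching_map X c) (sphere 0 1)" "attaching_map X c ` sphere 0 1 = c"
    using h by (auto simp: parametrizes_def)
  show "attaching_map X c z \<in> topspace X" if "norm z = 1"
    using 1(3) parametrizes_subset_topspace[OF h] that by auto
qed

lemma topspace_glue: "topspace Z = Base ` topspace X \<union> {Disc c z | c z. c \<in> S \<and> norm z < 1}"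
proof -
  let ?U = "Base ` topspace X \<union> {Disc c z | c z. c \<in> S \<and> norm z < 1}"
  have "{x \<in> topspace X. Base x \<in> ?U} = topspace X" by auto
  moreover have "{z \<in> cball 0 1. disc_map X c z \<in> ?U} = cball 0 1" if "c \<in> S" for c
    using attach(4)[OF that] that by (auto simp: disc_map_def)
  ultimately have "openin Z ?U" unfolding openin_glue_discs glue_open_def by simp
  then have "?U \<subseteq> topspace Z" by (rule openin_subset)
  moreover have "openin Z (topspace Z)" by simp
  then have "topspace Z \<subseteq> ?U" unfolding openin_glue_discs glue_open_def by blast
  ultimately show ?thesis by blast
qed

lemma continuous_Base: "continuous_map X Z Base"
  unfolding continuous_map_def
proof (intro conjI allI impI)
  show "Base \<in> topspace X \<rightarrow> topspace Z" unfolding topspace_glue by blast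
  fix U assume "openin Z U"
  then show "openin X {x \<in> topspace X. Base x \<in> U}" unfolding openin_glue_discs glue_open_def by blast
qed

lemma continuous_disc_map:
  assumes c: "c \<in> S"
  shows "continuous_map (top_of_set (cball 0 1)) Z (disc_map X c)"
  unfolding continuous_map_def
proof (intro conjI allI impI)
  show "disc_map X c \<in> topspace (top_of_set (cball 0 1)) \<rightarrow> topspace Z"
    unfolding topspace_glue using attach(4)[OF c] c by (auto simp: disc_map_def)
  fix U assume "openin Z U"
  then show "openin (top_of_set (cball 0 1)) {z \<in> topspace (top_of_set (cball 0 1)). disc_map X c z \<in> U}"
    unfolding openin_glue_discs glue_open_def using c by simp
qed

lemma disc_map_sphere:
  assumes "c \<in> S" shows "disc_map X c ` sphere 0 1 = Base ` c"
proof -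
  have "disc_map X c ` sphere 0 1 = Base ` attaching_map X c ` sphere 0 1"
    unfolding image_image by (intro image_cong) (auto simp: disc_map_def)
  then show ?thesis unfolding attach(3)[OF assms] .
qed

lemma inj_disc_map:
  assumes "c \<in> S" shows "inj_on (disc_map X c) (cball 0 1)"
proof (rule inj_onI)
  fix z w assume zw: "z \<in> cball 0 1" "w \<in> cball 0 1" "disc_map X c z = disc_map X c w"
  show "z = w"
  proof (cases "norm z < 1 \<or> norm w < 1")
    case True
    then show ?thesis using zw by (auto simp: disc_map_def split: if_splits)
  next
    case False
    then have "z \<in> sphere 0 1" "w \<in> sphere 0 1" using zw by auto
    then show ?thesis using zw(3) inj_onD[OF attach(2)[OF assms], of z w] by (auto simp: disc_map_def)
  qed
qed

lemma glued_disc_parametrizes: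
  "c \<in> S \<Longrightarrow> parametrizes Z (cball 0 1) (disc_map X c) (glued_disc X c)"
  unfolding parametrizes_def glued_disc_def using continuous_disc_map inj_disc_map by blast

lemma glued_disc_eq: "c \<in> S \<Longrightarrow> glued_disc X c = Base ` c \<union> Disc c ` ball 0 1"
proof -
  assume c: "c \<in> S"
  have "glued_disc X c = disc_map X c ` (sphere 0 1 \<union> ball 0 1)"
    unfolding glued_disc_def by (rule arg_cong[of _ _ "\<lambda>T. disc_map X c ` T"]) auto
  moreover have "disc_map X c ` ball 0 1 = Disc c ` ball 0 1" by (intro image_cong) (auto simp: disc_map_def)
  ultimately show ?thesis using disc_map_sphere[OF c] by (simp only: image_Un)
qed

text \<open>The image of an open set of \<open>X\<close> need not be open after gluing. It is
  thickened along the radii of the discs, all but their centres, in a way that keeps disjoint sets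
  disjoint, as needed to separate two points of \<open>X\<close>.\<close>

definition collar :: "'a set \<Rightarrow> 'a glued set" where
  "collar U = Base ` U \<union> {Disc c z | c z. c \<in> S \<and> 0 < norm z \<and> norm z < 1 \<and> attaching_map X c (sgn z) \<in> U}"

lemma openin_collar:
  assumes U: "openin X U"
  shows "openin Z (collar U)"
  unfolding openin_glue_discs glue_open_def
proof (intro conjI ballI)
  have UX: "U \<subseteq> topspace X" using U by (rule openin_subset)
  then show "collar U \<subseteq> Base ` topspace X \<union> {Disc c z | c z. c \<in> S \<and> norm z < 1}"
    unfolding collar_def by blast
  have "{x \<in> topspace X. Base x \<in> collar U} = U" using UX by (auto simp: collar_def)
  then show "openin X {x \<in> topspace X. Base x \<in> collar U}" using U by simp
  fix c assume c: "c \<in> S"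
  let ?B = "cball (0::complex) 1 - {0}"
  have sg: "sgn z \<in> sphere 0 1" if "z \<noteq> 0" for z :: complex using that by (simp add: norm_sgn)
  \<comment> \<open>Off the centre, membership in the collar depends only on the direction. On the
    circle \<open>sgn z = z\<close>, so the same formula covers the attaching circle.\<close>
  have eq: "{z \<in> cball 0 1. disc_map X c z \<in> collar U} = {z \<in> ?B. (attaching_map X c \<circ> sgn) z \<in> U}"
  proof (intro set_eqI)
    fix z :: complex
    consider "norm z > 1" | "norm z = 1" | "norm z < 1" "z \<noteq> 0" | "z = 0" by fastforce
    then show "z \<in> {z \<in> cball 0 1. disc_map X c z \<in> collar U} \<longleftrightarrow> z \<in> {z \<in> ?B. (attaching_map X c \<circ> sgn) z \<in> U}"
    proof cases
      case 2
      then have "sgn z = z" by (simp add: sgn_div_norm)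
      moreover have "z \<noteq> 0" using 2 by auto
      ultimately show ?thesis using 2 by (auto simp: disc_map_def collar_def)
    qed (auto simp: disc_map_def collar_def c)
  qed
  have "continuous_map (top_of_set ?B) (top_of_set (sphere 0 1)) sgn"
    unfolding continuous_map_in_subtopology using sg by (auto intro!: continuous_intros)
  then have "continuous_map (top_of_set ?B) X (attaching_map X c \<circ> sgn)"
    using attach(1)[OF c] by (rule continuous_map_compose)
  then have "openin (top_of_set ?B) {z \<in> ?B. (attaching_map X c \<circ> sgn) z \<in> U}"
    using openin_continuous_map_preimage[OF _ U] by fastforce
  moreover have "openin (top_of_set (cball (0::complex) 1)) ?B"
    by (rule openin_delete) simp
  ultimately show "openin (top_of_set (cball 0 1)) {z \<in> cball 0 1. disc_map X c z \<in> collar U}"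
    unfolding eq by (rule openin_trans)
qed

lemma openin_Disc:
  assumes V: "open V" "V \<subseteq> ball 0 1" and c: "c \<in> S"
  shows "openin Z (Disc c ` V)"
  unfolding openin_glue_discs glue_open_def
proof (intro conjI ballI)
  show "Disc c ` V \<subseteq> Base ` topspace X \<union> {Disc c z | c z. c \<in> S \<and> norm z < 1}" using V c by auto
  have eq: "{x \<in> topspace X. Base x \<in> Disc c ` V} = {}" by auto
  show "openin X {x \<in> topspace X. Base x \<in> Disc c ` V}" unfolding eq by (rule openin_empty)
  fix c' assume "c' \<in> S"
  have "{z \<in> cball 0 1. disc_map X c' z \<in> Disc c ` V} = (if c' = c then V else {})"
    using V(2) by (auto simp: disc_map_def)
  moreover have "openin (top_of_set (cball 0 1)) V"
    using V by (intro open_subset) auto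
  ultimately show "openin (top_of_set (cball 0 1)) {z \<in> cball 0 1. disc_map X c' z \<in> Disc c ` V}" by simp
qed

lemma openin_outside:
  assumes r: "0 < r" "r < 1"
  shows "openin Z (Base ` topspace X \<union> {Disc c z | c z. c \<in> S \<and> r < norm z \<and> norm z < 1})" (is "openin Z ?U")
  unfolding openin_glue_discs glue_open_def
proof (intro conjI ballI)
  show "?U \<subseteq> Base ` topspace X \<union> {Disc c z | c z. c \<in> S \<and> norm z < 1}" by blast
  have "{x \<in> topspace X. Base x \<in> ?U} = topspace X" by auto
  then show "openin X {x \<in> topspace X. Base x \<in> ?U}" by simp
  fix c assume c: "c \<in> S"
  have "{z \<in> cball 0 1. disc_map X c z \<in> ?U} = cball 0 1 \<inter> - cball 0 r"
    using attach(4)[OF c] c r by (auto simp: disc_map_def)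
  moreover have "open (- cball (0::complex) r)" by auto
  ultimately show "openin (top_of_set (cball 0 1)) {z \<in> cball 0 1. disc_map X c z \<in> ?U}"
    using openin_open by blast
qed

text \<open>Two points of \<open>X\<close> are separated by collars, two points inside discs by
  planar neighbourhoods or because the discs differ, and a mixed pair by a concentric
  circle.\<close>

lemma Hausdorff_glue: "Hausdorff_space Z"
  unfolding Hausdorff_space_def
proof (intro allI impI)
  have base_disc: "\<exists>U V. openin Z U \<and> openin Z V \<and> Base x \<in> U \<and> Disc c z \<in> V \<and> disjnt U V"
    if "x \<in> topspace X" "c \<in> S" "norm z < 1" for x c z
  proof -
    \<comment> \<open>Any radius strictly between \<open>norm z\<close> and 1 would do.\<close>
    define r where "r = (norm z + 1) / 2"
    have r: "0 < r" "r < 1" "norm z < r" using that by (auto simp: r_def intro: add_nonneg_pos)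
    let ?U = "Base ` topspace X \<union> {Disc c z | c z. c \<in> S \<and> r < norm z \<and> norm z < 1}"
    have "openin Z ?U" by (rule openin_outside[OF r(1,2)])
    moreover have "openin Z (Disc c ` ball 0 r)" using r that by (intro openin_Disc) auto
    moreover have "disjnt ?U (Disc c ` ball 0 r)" by (auto simp: disjnt_def)
    moreover have "Base x \<in> ?U" using that(1) by blast
    moreover have "Disc c z \<in> Disc c ` ball 0 r" using r(3) by simp
    ultimately show ?thesis by (intro exI conjI)
  qed
  fix x y assume xy: "x \<in> topspace Z \<and> y \<in> topspace Z \<and> x \<noteq> y"
  show "\<exists>U V. openin Z U \<and> openin Z V \<and> x \<in> U \<and> y \<in> V \<and> disjnt U V"
  proof (cases x)
    case x: (Base a)
    then have a: "a \<in> topspace X" using xy topspace_glue by auto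
    show ?thesis
    proof (cases y)
      case y: (Base b)
      then have "b \<in> topspace X" "a \<noteq> b" using xy x topspace_glue by auto
      then obtain U V where UV: "openin X U" "openin X V" "a \<in> U" "b \<in> V" "disjnt U V"
        using X a unfolding Hausdorff_space_def by metis
      have "disjnt (collar U) (collar V)" using UV(5) by (auto simp: collar_def disjnt_def)
      moreover have "x \<in> collar U" "y \<in> collar V" using UV x y by (auto simp: collar_def)
      ultimately show ?thesis using openin_collar UV(1,2) by blast
    next
      case y: (Disc c z)
      then have "c \<in> S" "norm z < 1" using xy topspace_glue by auto
      then show ?thesis using base_disc[OF a] x y by blast
    qed
  next
    case x: (Disc c z)
    then have c: "c \<in> S" "norm z < 1" using xy topspace_glue by auto
    show ?thesis
    proof (cases y)
      case y: (Base b)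
      then have "b \<in> topspace X" using xy topspace_glue by auto
      then obtain U V where "openin Z U" "openin Z V" "y \<in> U" "x \<in> V" "disjnt U V"
        using base_disc[OF _ c] x y by blast
      then show ?thesis using disjnt_sym by blast
    next
      case y: (Disc c' w)
      then have c': "c' \<in> S" "norm w < 1" using xy topspace_glue by auto
      obtain U V where UV: "open U" "open V" "z \<in> U" "w \<in> V" "c = c' \<Longrightarrow> U \<inter> V = {}"
      proof (cases "c = c'")
        case True
        then have "z \<noteq> w" using xy x y by auto
        then show ?thesis using hausdorff[of z w] that by metis
      next
        case False
        show ?thesis by (rule that[of UNIV UNIV]) (use False in auto)
      qed
      have "openin Z (Disc c ` (U \<inter> ball 0 1))" "openin Z (Disc c' ` (V \<inter> ball 0 1))"
        using UV c c' by (auto intro!: openin_Disc)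
      moreover have "disjnt (Disc c ` (U \<inter> ball 0 1)) (Disc c' ` (V \<inter> ball 0 1))"
        using UV(5) by (auto simp: disjnt_def)
      moreover have "x \<in> Disc c ` (U \<inter> ball 0 1)" "y \<in> Disc c' ` (V \<inter> ball 0 1)"
        using x y UV c c' by auto
      ultimately show ?thesis by blast
    qed
  qed
qed

end

section \<open>Duality, contraction and deletion on skeletons\<close>

lemma rim_subtopology: "D \<subseteq> S \<Longrightarrow> rim (subtopology X S) D = rim X D"
  unfolding rim_def by (simp add: subtopology_subtopology_subset)

lemma closed_disc_in_subtopology:
  assumes "D \<subseteq> S" "closed_disc_in X D"
  shows "closed_disc_in (subtopology X S) D"
  using assms unfolding closed_disc_in_def by (auto simp: subtopology_subtopology_subset)

lemma image_Int_empty_iff: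
  "inj_on j K \<Longrightarrow> a \<subseteq> K \<Longrightarrow> b \<subseteq> K \<Longrightarrow> j ` a \<inter> j ` b = {} \<longleftrightarrow> a \<inter> b = {}"
  by (metis image_is_empty inj_on_image_Int)

lemma Int_eq_restrict: "A \<inter> B = C \<Longrightarrow> C \<subseteq> B' \<Longrightarrow> B' \<subseteq> B \<Longrightarrow> A \<inter> B' = C"
  by blast

text \<open>Serves twice: for the deletion of an edge, and for the surface formed by an edge and its
  ends, whose boundary gives the contraction curves.\<close>

lemma presents_sub:
  assumes p: "presents X j \<V> \<E> \<delta> H" and V: "\<V>' \<subseteq> \<V>" and E: "\<E>' \<subseteq> \<E>" and sk: "skeleton X \<V>' \<E>'"
  shows "presents X j \<V>' \<E>' \<delta>
    \<lparr>surface = subtopology (surface H) (\<Union>(\<delta> ` \<V>') \<union> \<Union>((`) j ` \<E>')), vertices = \<delta> ` \<V>', edges = (`) j ` \<E>'\<rparr>"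
proof -
  let ?Y = "surface H" and ?U = "\<Union>(\<delta> ` \<V>') \<union> \<Union>((`) j ` \<E>')"
  let ?K = "\<Union>\<V> \<union> \<Union>\<E>" and ?K' = "\<Union>\<V>' \<union> \<Union>\<E>'"
  have KK: "?K' \<subseteq> ?K" using V E by blast
  have U: "?U \<subseteq> topspace ?Y"
    unfolding presentsD(7)[OF p] image_Union by (intro Un_mono Union_mono image_mono V E)
  have jU: "j x \<in> ?U" if "x \<in> ?K'" for x
  proof -
    have "j ` c \<subseteq> \<delta> c" if "c \<in> \<V>'" for c using presentsD(10)[OF p, of c] that V by blast
    then show ?thesis using that by blast
  qed
  have "continuous_map (subtopology X ?K') ?Y j"
    by (rule continuous_map_from_subtopology_mono[OF presentsD(3)[OF p] KK])
  then have 1: "continuous_map (subtopology X ?K') (subtopology ?Y ?U) j"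
    unfolding continuous_map_in_subtopology using jU by simp
  have 2: "inj_on j ?K'" by (rule inj_on_subset[OF presentsD(4)[OF p] KK])
  have 3: "topspace (subtopology ?Y ?U) = \<Union>(\<delta> ` \<V>') \<union> j ` \<Union>\<E>'"
    using U by (simp only: topspace_subtopology inf.absorb2 image_Union)
  have 4: "closed_disc_in (subtopology ?Y ?U) (\<delta> c) \<and> rim (subtopology ?Y ?U) (\<delta> c) = j ` c \<and>
      \<delta> c \<inter> j ` ?K' = j ` c" if c: "c \<in> \<V>'" for c
  proof (intro conjI)
    have cV: "c \<in> \<V>" and cU: "\<delta> c \<subseteq> ?U" using c V by blast+
    show "closed_disc_in (subtopology ?Y ?U) (\<delta> c)"
      by (rule closed_disc_in_subtopology[OF cU presentsD(8)[OF p cV]])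
    show "rim (subtopology ?Y ?U) (\<delta> c) = j ` c"
      unfolding rim_subtopology[OF cU] by (rule presentsD(9)[OF p cV])
    have "\<delta> c \<inter> j ` ?K = j ` c" by (rule presentsD(10)[OF p cV])
    moreover have "c \<subseteq> ?K'" using c by blast
    then have "j ` c \<subseteq> j ` ?K'" by (rule image_mono)
    moreover have "j ` ?K' \<subseteq> j ` ?K" using KK by (rule image_mono)
    ultimately show "\<delta> c \<inter> j ` ?K' = j ` c" by (rule Int_eq_restrict)
  qed
  have 5: "\<delta> c \<inter> \<delta> c' = {}" if "c \<in> \<V>'" "c' \<in> \<V>'" "c \<noteq> c'" for c c'
    by (rule presentsD(11)[OF p]) (use that V in auto)
  have 6: "Hausdorff_space (subtopology ?Y ?U)" by (rule Hausdorff_space_subtopology[OF presentsD(2)[OF p]])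
  show ?thesis
    unfolding presents_def ribbon_graph.simps
    by (intro conjI ballI impI sk 1 2 3 4[THEN conjunct1] 4[THEN conjunct2, THEN conjunct1]
        4[THEN conjunct2, THEN conjunct2] 5 6 refl)
qed

lemma presents_delete:
  assumes p: "presents X j \<V> \<E> \<delta> H" and e: "e \<in> \<E>"
  shows "presents X j \<V> (\<E> - {e}) \<delta> (delete_edge H (j ` e))"
proof -
  have "j ` f = j ` e \<longleftrightarrow> f = e" if "f \<in> \<E>" for f
    by (rule inj_on_image_eq_iff[OF presentsD(4)[OF p]]) (use that e in auto)
  then have eq: "(`) j ` \<E> - {j ` e} = (`) j ` (\<E> - {e})" using e by blast
  have sk: "skeleton X \<V> (\<E> - {e})" by (rule skeleton_subset[OF presentsD(1)[OF p]]) auto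
  show ?thesis
    using presents_sub[OF p order_refl Diff_subset sk]
    unfolding delete_edge_def presentsD(5)[OF p] presentsD(6)[OF p] eq .
qed

lemma presents_ends:
  assumes p: "presents X j \<V> \<E> \<delta> H" and e: "e \<in> \<E>"
  shows "ends H (j ` e) = \<delta> ` circles_meeting \<V> e"
proof -
  have "\<delta> c \<inter> j ` e = {} \<longleftrightarrow> c \<inter> e = {}" if c: "c \<in> \<V>" for c
  proof -
    have "\<delta> c \<inter> j ` e = (\<delta> c \<inter> j ` (\<Union>\<V> \<union> \<Union>\<E>)) \<inter> j ` e" using e by blast
    also have "\<dots> = j ` c \<inter> j ` e" by (simp only: presentsD(10)[OF p c])
    finally show ?thesis
      using image_Int_empty_iff[OF presentsD(4)[OF p], of c e] c e by blast
  qed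
  then show ?thesis unfolding ends_def presentsD(5)[OF p] circles_meeting_def by blast
qed

text \<open>The edge with its ends is itself a ribbon graph with one edge, so its boundary is
  already known from its skeleton.\<close>

lemma presents_contraction_curves:
  assumes p: "presents X j \<V> \<E> \<delta> H" and e: "e \<in> \<E>"
  shows "contraction_curves H (j ` e) = (`) j ` new_circles X \<V> e"
proof -
  let ?M = "circles_meeting \<V> e"
  have "presents X j ?M {e} \<delta> \<lparr>surface = subtopology (surface H) (\<Union>(\<delta> ` ?M) \<union> \<Union>((`) j ` {e})),
      vertices = \<delta> ` ?M, edges = (`) j ` {e}\<rparr>"
    by (rule presents_sub[OF p _ _ skeleton_circles_meeting[OF presentsD(1)[OF p] e]])
      (use e in \<open>auto simp: circles_meeting_def\<close>)
  then have "boundary_curves (subtopology (surface H) (\<Union>(\<delta> ` ?M) \<union> \<Union>((`) j ` {e}))) = (`) j ` new_circles X \<V> e"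
    using presents_boundary_components unfolding new_circles_def boundary_components_def by fastforce
  moreover have "\<Union>(\<delta> ` ?M) \<union> \<Union>((`) j ` {e}) = j ` e \<union> \<Union>(ends H (j ` e))"
    unfolding presents_ends[OF p e] by auto
  ultimately show ?thesis unfolding contraction_curves_def by (simp only:)
qed

text \<open>The common core of dual and contraction: \<U> holds the circles of the vertices that
  stay, none for the dual, and \<C> those that receive a new disc. \<open>V\<close> and
  \<open>E\<close> are variables given by equations, so that the record has the shape of the
  unfolded definitions.\<close>

lemma presents_glue:
  assumes p: "presents X j \<V> \<E> \<delta> H" and U: "\<U> \<subseteq> \<V>" and C: "\<Union>\<C> \<subseteq> \<Union>\<V> \<union> \<Union>\<E>" and E: "\<E>' \<subseteq> \<E>"
    and UC: "\<U> \<inter> \<C> = {}" and sk: "skeleton X (\<U> \<union> \<C>) \<E>'"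
    and Vn: "V = (`) Base ` \<delta> ` \<U> \<union> glued_disc (surface H) ` (`) j ` \<C>" and En: "E = (`) Base ` (`) j ` \<E>'"
  shows "presents X (Base \<circ> j) (\<U> \<union> \<C>) \<E>' (\<lambda>c. if c \<in> \<C> then glued_disc (surface H) (j ` c) else Base ` \<delta> c)
    \<lparr>surface = subtopology (glue_discs (surface H) ((`) j ` \<C>)) (\<Union>V \<union> \<Union>E), vertices = V, edges = E\<rparr>"
proof -
  let ?Y = "surface H" and ?K = "\<Union>\<V> \<union> \<Union>\<E>" and ?K' = "\<Union>(\<U> \<union> \<C>) \<union> \<Union>\<E>'"
  let ?\<delta> = "\<lambda>c. if c \<in> \<C> then glued_disc ?Y (j ` c) else Base ` \<delta> c"
  note Y = presentsD(2)[OF p] and inj = presentsD(4)[OF p]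
  have cir: "circles X (\<U> \<union> \<C>)" using skeletonD(2)[OF sk] .
  have CK: "c \<subseteq> ?K" if "c \<in> \<C>" for c using C that by blast
  have KK: "?K' \<subseteq> ?K" using U C E by blast
  have circ: "circle_in ?Y (j ` c)" if "c \<in> \<C>" for c
  proof -
    obtain h where "parametrizes X (sphere (0::complex) 1) h c"
      using cir \<open>c \<in> \<C>\<close> unfolding circles_def circle_in_def by blast
    then show ?thesis
      using parametrizes_image[OF _ presentsD(3,4)[OF p] CK[OF that]] unfolding circle_in_def by blast
  qed
  interpret gluing ?Y "(`) j ` \<C>" using Y circ by unfold_locales auto
  let ?W = "\<Union>V \<union> \<Union>E"
  have V: "V = ?\<delta> ` (\<U> \<union> \<C>)"
  proof -
    have "?\<delta> ` \<U> = (`) Base ` \<delta> ` \<U>" unfolding image_image using UC by (intro image_cong) auto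
    moreover have "?\<delta> ` \<C> = glued_disc ?Y ` (`) j ` \<C>" unfolding image_image by (intro image_cong) auto
    ultimately show ?thesis unfolding Vn image_Un by (simp only:)
  qed
  have E': "E = (`) (Base \<circ> j) ` \<E>'"
    unfolding En image_image[of "(`) Base"] by (simp only: image_comp)
  have Base_in: "(Base \<circ> j) ` c \<subseteq> ?\<delta> c" if c: "c \<in> \<U> \<union> \<C>" for c
  proof (cases "c \<in> \<C>")
    case True
    then show ?thesis using glued_disc_eq[of "j ` c"] by (auto simp: image_comp)
  next
    case False
    then have "c \<in> \<V>" using c U by blast
    then have "j ` c \<subseteq> \<delta> c" using presentsD(10)[OF p] by blast
    then show ?thesis using False by auto
  qed
  have im: "(Base \<circ> j) x \<in> ?W" if "x \<in> ?K'" for x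
  proof -
    consider c where "c \<in> \<U> \<union> \<C>" "x \<in> c" | e where "e \<in> \<E>'" "x \<in> e" using \<open>x \<in> ?K'\<close> by blast
    then show ?thesis
    proof cases
      case 1
      have x: "(Base \<circ> j) x \<in> ?\<delta> c" by (rule subsetD[OF Base_in[OF 1(1)] imageI[OF 1(2)]])
      have "?\<delta> c \<in> V" unfolding V using 1(1) by (rule imageI)
      then show ?thesis by (rule UnI1[OF UnionI[OF _ x]])
    next
      case 2
      have x: "(Base \<circ> j) x \<in> (Base \<circ> j) ` e" using 2(2) by (rule imageI)
      have "(Base \<circ> j) ` e \<in> E" unfolding E' using 2(1) by (rule imageI)
      then show ?thesis by (rule UnI2[OF UnionI[OF _ x]])
    qed
  qed
  have disc: "closed_disc_in Z (?\<delta> c) \<and> rim Z (?\<delta> c) = (Base \<circ> j) ` c" if c: "c \<in> \<U> \<union> \<C>" for c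
  proof (cases "c \<in> \<C>")
    case True
    then have jc: "j ` c \<in> (`) j ` \<C>" by blast
    note g = glued_disc_parametrizes[OF jc]
    have "rim Z (glued_disc ?Y (j ` c)) = (Base \<circ> j) ` c"
      unfolding rim_def surface_boundary_disc[OF Hausdorff_glue g] disc_map_sphere[OF jc] by (simp add: image_comp)
    moreover have "closed_disc_in Z (glued_disc ?Y (j ` c))"
      using g closed_disc_in_iff_parametrizes[OF Hausdorff_glue] by blast
    ultimately show ?thesis using True by simp
  next
    case False
    then have cV: "c \<in> \<V>" using c U by blast
    obtain d where d: "parametrizes ?Y (cball (0::complex) 1) d (\<delta> c)" "d ` sphere 0 1 = j ` c"
      using presents_vertex[OF p cV] .
    have "continuous_map (subtopology ?Y (\<delta> c)) Z Base"
      by (rule continuous_map_from_subtopology[OF continuous_Base])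
    then have g: "parametrizes Z (cball 0 1) (Base \<circ> d) (Base ` \<delta> c)"
      by (rule parametrizes_image[OF d(1)]) (auto simp: inj_on_def)
    have "rim Z (Base ` \<delta> c) = (Base \<circ> j) ` c"
      unfolding rim_def surface_boundary_disc[OF Hausdorff_glue g] image_comp[symmetric] d(2) ..
    moreover have "closed_disc_in Z (Base ` \<delta> c)"
      using g closed_disc_in_iff_parametrizes[OF Hausdorff_glue] by blast
    ultimately show ?thesis using False by simp
  qed
  have meet: "?\<delta> c \<inter> (Base \<circ> j) ` ?K' = (Base \<circ> j) ` c" if c: "c \<in> \<U> \<union> \<C>" for c
  proof -
    have cK: "c \<subseteq> ?K'" using c by blast
    have "?\<delta> c \<inter> (Base \<circ> j) ` ?K' \<subseteq> (Base \<circ> j) ` c"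
    proof (cases "c \<in> \<C>")
      case True
      then have g: "glued_disc ?Y (j ` c) = (Base \<circ> j) ` c \<union> Disc (j ` c) ` ball 0 1"
        unfolding image_comp[symmetric] by (intro glued_disc_eq) blast
      have "Disc (j ` c) ` ball 0 1 \<inter> (Base \<circ> j) ` ?K' = {}" by auto
      then show ?thesis unfolding if_P[OF True] g Int_Un_distrib2 by (simp only: Un_empty_right Int_lower1)
    next
      case False
      then have cV: "c \<in> \<V>" using c U by blast
      have "\<delta> c \<inter> j ` ?K' \<subseteq> \<delta> c \<inter> j ` ?K" by (intro Int_mono image_mono KK order_refl)
      then have "\<delta> c \<inter> j ` ?K' \<subseteq> j ` c" by (simp only: presentsD(10)[OF p cV])
      then have "Base ` (\<delta> c \<inter> j ` ?K') \<subseteq> Base ` j ` c" by (rule image_mono)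
      moreover have "Base ` (\<delta> c \<inter> j ` ?K') = Base ` \<delta> c \<inter> Base ` j ` ?K'"
        by (rule image_Int) (simp add: inj_on_def)
      ultimately show ?thesis using False by (simp only: image_comp if_False)
    qed
    moreover have "(Base \<circ> j) ` c \<subseteq> (Base \<circ> j) ` ?K'" using cK by (rule image_mono)
    ultimately show ?thesis using Base_in[OF c] by blast
  qed
  \<comment> \<open>An old disc meets the skeleton only in its own circle, and this circle is
    disjoint from the one along which the new disc is glued.\<close>
  have cross: "?\<delta> c \<inter> ?\<delta> c' = {}" if c: "c \<in> \<U>" "c \<notin> \<C>" and c': "c' \<in> \<C>" for c c'
  proof -
    have "c \<inter> c' = {}"
      using circles_unique[OF cir, of c c'] c c' by blast
    moreover have cV: "c \<in> \<V>" using c U by blast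
    then have cK: "c \<subseteq> ?K" by blast
    ultimately have "j ` c \<inter> j ` c' = {}" using image_Int_empty_iff[OF inj cK CK[OF c']] by simp
    moreover have "j ` c' \<subseteq> j ` ?K" by (rule image_mono[OF CK[OF c']])
    then have "\<delta> c \<inter> j ` c' \<subseteq> j ` c" using presentsD(10)[OF p cV] by blast
    ultimately have "\<delta> c \<inter> j ` c' = {}" by blast
    moreover have "glued_disc ?Y (j ` c') = Base ` j ` c' \<union> Disc (j ` c') ` ball 0 1"
      using c' by (intro glued_disc_eq) blast
    ultimately show ?thesis using c c' by auto
  qed
  have dis: "?\<delta> c \<inter> ?\<delta> c' = {}" if c: "c \<in> \<U> \<union> \<C>" "c' \<in> \<U> \<union> \<C>" "c \<noteq> c'" for c c'
  proof -
    consider "c \<in> \<C> \<and> c' \<in> \<C>" | "c \<in> \<U> \<and> c \<notin> \<C> \<and> c' \<in> \<C>" | "c' \<in> \<U> \<and> c' \<notin> \<C> \<and> c \<in> \<C>"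
      | "c \<in> \<U> \<and> c \<notin> \<C> \<and> c' \<in> \<U> \<and> c' \<notin> \<C>" using c by blast
    then show ?thesis
    proof cases
      case 1
      have "c \<inter> c' = {}" using circles_unique[OF cir c(1,2)] c(3) by blast
      then have "j ` c \<inter> j ` c' = {}" using image_Int_empty_iff[OF inj] CK 1 by metis
      moreover have "j ` c \<noteq> j ` c'" using inj_on_image_eq_iff[OF inj] CK 1 c(3) by metis
      moreover have "glued_disc ?Y (j ` c) = Base ` j ` c \<union> Disc (j ` c) ` ball 0 1"
        "glued_disc ?Y (j ` c') = Base ` j ` c' \<union> Disc (j ` c') ` ball 0 1"
        using 1 by (auto intro!: glued_disc_eq)
      ultimately show ?thesis using 1 by auto
    next
      case 2
      then show ?thesis using cross by blast
    next
      case 3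
      then have "?\<delta> c' \<inter> ?\<delta> c = {}" using cross[of c' c] by blast
      then show ?thesis by (subst Int_commute)
    next
      case 4
      then have "\<delta> c \<inter> \<delta> c' = {}" using presentsD(11)[OF p, of c c'] U c(3) by blast
      then show ?thesis using 4 by auto
    qed
  qed
  have Wtop: "?W \<subseteq> topspace Z"
  proof -
    have "?\<delta> c \<subseteq> topspace Z" if "c \<in> \<U> \<union> \<C>" for c
      using disc[OF that] by (simp add: closed_disc_in_def)
    moreover have "j ` e \<subseteq> topspace ?Y" if "e \<in> \<E>'" for e
      using presentsD(7)[OF p] E that by blast
    then have "Base ` j ` e \<subseteq> topspace Z" if "e \<in> \<E>'" for e
      unfolding topspace_glue by (intro le_supI1 image_mono) (use that in blast)
    ultimately show ?thesis unfolding V En by blast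
  qed
  have "continuous_map (subtopology X ?K') ?Y j"
    by (rule continuous_map_from_subtopology_mono[OF presentsD(3)[OF p] KK])
  then have "continuous_map (subtopology X ?K') Z (Base \<circ> j)"
    using continuous_Base by (rule continuous_map_compose)
  then have 1: "continuous_map (subtopology X ?K') (subtopology Z ?W) (Base \<circ> j)"
    unfolding continuous_map_in_subtopology using im by simp
  have 2: "inj_on (Base \<circ> j) ?K'"
    using inj_on_subset[OF inj KK] by (auto simp: inj_on_def)
  have 3: "topspace (subtopology Z ?W) = \<Union>(?\<delta> ` (\<U> \<union> \<C>)) \<union> (Base \<circ> j) ` \<Union>\<E>'"
  proof -
    have "topspace (subtopology Z ?W) = ?W" using Wtop by (simp only: topspace_subtopology inf.absorb2)
    then show ?thesis unfolding V E' by (simp only: image_Union)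
  qed
  have 4: "closed_disc_in (subtopology Z ?W) (?\<delta> c) \<and> rim (subtopology Z ?W) (?\<delta> c) = (Base \<circ> j) ` c \<and>
      ?\<delta> c \<inter> (Base \<circ> j) ` ?K' = (Base \<circ> j) ` c" if c: "c \<in> \<U> \<union> \<C>" for c
  proof -
    have cW: "?\<delta> c \<subseteq> ?W" unfolding V using c by blast
    show ?thesis
      using closed_disc_in_subtopology[OF cW] rim_subtopology[OF cW] disc[OF c] meet[OF c] by simp
  qed
  show ?thesis
    unfolding presents_def ribbon_graph.simps
  proof (intro conjI ballI impI)
    show "skeleton X (\<U> \<union> \<C>) \<E>'" by (rule sk)
    show "Hausdorff_space (subtopology Z ?W)" by (rule Hausdorff_space_subtopology[OF Hausdorff_glue])
    show "continuous_map (subtopology X ?K') (subtopology Z ?W) (Base \<circ> j)" by (rule 1)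
    show "inj_on (Base \<circ> j) ?K'" by (rule 2)
    show "V = ?\<delta> ` (\<U> \<union> \<C>)" by (rule V)
    show "E = (`) (Base \<circ> j) ` \<E>'" by (rule E')
    show "topspace (subtopology Z ?W) = \<Union>(?\<delta> ` (\<U> \<union> \<C>)) \<union> (Base \<circ> j) ` \<Union>\<E>'" by (rule 3)
  next
    fix c assume c: "c \<in> \<U> \<union> \<C>"
    show "closed_disc_in (subtopology Z ?W) (?\<delta> c)" "rim (subtopology Z ?W) (?\<delta> c) = (Base \<circ> j) ` c"
      "?\<delta> c \<inter> (Base \<circ> j) ` ?K' = (Base \<circ> j) ` c" using 4[OF c] by blast+
    fix c' assume "c' \<in> \<U> \<union> \<C>" "c \<noteq> c'"
    then show "?\<delta> c \<inter> ?\<delta> c' = {}" by (rule dis[OF c])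
  qed
qed

lemma presents_dual:
  assumes p: "presents X j \<V> \<E> \<delta> H"
  shows "presents X (Base \<circ> j) (boundary_circles X \<V> \<E>) \<E>
    (\<lambda>c. if c \<in> boundary_circles X \<V> \<E> then glued_disc (surface H) (j ` c) else Base ` \<delta> c)
    (geometric_dual H)"
proof -
  note sk = presentsD(1)[OF p]
  let ?C = "boundary_circles X \<V> \<E>"
  have C: "\<Union>?C \<subseteq> \<Union>\<V> \<union> \<Union>\<E>" unfolding boundary_circles(2)[OF sk] by (rule free_boundary_subset[OF sk])
  have s: "skeleton X ({} \<union> ?C) \<E>" using skeleton_boundary_circles[OF sk] by simp
  show ?thesis
    using presents_glue[OF p empty_subsetI C order_refl Int_empty_left s refl refl]
    unfolding geometric_dual_def presents_boundary_components[OF p] presentsD(6)[OF p] Let_def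
    by (simp only: image_empty Un_empty_left)
qed

lemma presents_contract:
  assumes p: "presents X j \<V> \<E> \<delta> H" and e: "e \<in> \<E>"
  shows "presents X (Base \<circ> j) ((\<V> - circles_meeting \<V> e) \<union> new_circles X \<V> e) (\<E> - {e})
    (\<lambda>c. if c \<in> new_circles X \<V> e then glued_disc (surface H) (j ` c) else Base ` \<delta> c)
    (contract_edge H (j ` e))"
proof -
  note sk = presentsD(1)[OF p]
  let ?M = "circles_meeting \<V> e" and ?N = "new_circles X \<V> e"
  have M: "?M \<subseteq> \<V>" unfolding circles_meeting_def by blast
  have N: "\<Union>?N \<subseteq> \<Union>\<V> \<union> \<Union>\<E>" using new_circles_subset[OF sk e] M e by blast
  have MN: "(\<V> - ?M) \<inter> ?N = {}"
  proof -
    have False if "c \<in> \<V> - ?M" "c \<in> ?N" for c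
      using new_circle_meets[OF sk e that(2)] that(1) unfolding circles_meeting_def by blast
    then show ?thesis by blast
  qed
  have "\<delta> c \<noteq> \<delta> d" if "c \<in> \<V>" "d \<in> \<V>" "c \<noteq> d" for c d
  proof -
    have "c \<noteq> {}" using skeletonD(2)[OF sk] that(1) circle_in_nonempty unfolding circles_def by blast
    then have "\<delta> c \<noteq> {}" using presentsD(10)[OF p that(1)] by blast
    then show ?thesis using presentsD(11)[OF p that] by blast
  qed
  then have V: "\<delta> ` \<V> - \<delta> ` ?M = \<delta> ` (\<V> - ?M)" using M by blast
  have "j ` f = j ` e \<longleftrightarrow> f = e" if "f \<in> \<E>" for f
    by (rule inj_on_image_eq_iff[OF presentsD(4)[OF p]]) (use that e in auto)
  then have E: "(`) j ` \<E> - {j ` e} = (`) j ` (\<E> - {e})" using e by blast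
  show ?thesis
    using presents_glue[OF p Diff_subset N Diff_subset MN skeleton_contract(1)[OF sk e] refl refl]
    unfolding contract_edge_def presents_contraction_curves[OF p e] presents_ends[OF p e]
      presentsD(5)[OF p] presentsD(6)[OF p] V E Let_def .
qed

section \<open>Colourings as classes of circles of the skeleton\<close>

definition cpresents :: "'a topology \<Rightarrow> ('a \<Rightarrow> 'b) \<Rightarrow> 'a set set \<Rightarrow> 'a set set \<Rightarrow> 'a set set set \<Rightarrow> 'a set set set \<Rightarrow>
    ('a set \<Rightarrow> 'b set) \<Rightarrow> 'b coloured_ribbon_graph \<Rightarrow> bool" where
  "cpresents X j \<V> \<E> PV PB \<delta> G \<longleftrightarrow>
     presents X j \<V> \<E> \<delta> (underlying G) \<and> \<Union>PV \<subseteq> \<V> \<and> \<Union>PB \<subseteq> boundary_circles X \<V> \<E> \<and>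
     vertex_classes G = (`) \<delta> ` PV \<and> boundary_classes G = (`) ((`) j) ` PB"

lemma cpresentsD:
  assumes "cpresents X j \<V> \<E> PV PB \<delta> G"
  shows "presents X j \<V> \<E> \<delta> (underlying G)" "\<Union>PV \<subseteq> \<V>" "\<Union>PB \<subseteq> boundary_circles X \<V> \<E>"
    "vertex_classes G = (`) \<delta> ` PV" "boundary_classes G = (`) ((`) j) ` PB"
  using assms by (auto simp: cpresents_def)

lemma boundary_circle_subset:
  assumes "skeleton X \<V> \<E>" "c \<in> boundary_circles X \<V> \<E>"
  shows "c \<subseteq> \<Union>\<V> \<union> \<Union>\<E>"
  using assms boundary_circles(2)[OF assms(1)] free_boundary_subset[OF assms(1)] by blast

text \<open>This is how all three claims end: equal data on the skeleton suffice. Vertex classes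
  follow the discs under the homeomorphism, and boundary classes follow the embedded
  circles.\<close>

lemma cpresents_equivalent:
  assumes G: "cpresents X j \<V> \<E> PV PB \<delta> G" and G': "cpresents X j' \<V> \<E> PV PB \<delta>' G'"
  shows "G \<cong>\<^sub>c G'"
proof -
  note p = cpresentsD(1)[OF G] and p' = cpresentsD(1)[OF G']
  obtain \<phi> where \<phi>: "homeomorphic_map (surface (underlying G)) (surface (underlying G')) \<phi>"
    "\<forall>c\<in>\<V>. \<phi> ` \<delta> c = \<delta>' c" "\<forall>x\<in>\<Union>\<V> \<union> \<Union>\<E>. \<phi> (j x) = j' x"
    using presents_unique[OF p p'] .
  have jj: "\<phi> ` j ` a = j' ` a" if "a \<subseteq> \<Union>\<V> \<union> \<Union>\<E>" for a
    unfolding image_image by (rule image_cong[OF refl]) (use \<phi>(3) that in blast)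
  have 1: "(`) \<phi> ` vertices (underlying G) = vertices (underlying G')"
    unfolding presentsD(5)[OF p] presentsD(5)[OF p'] image_image using \<phi>(2) by (intro image_cong) auto
  have 2: "(`) \<phi> ` edges (underlying G) = edges (underlying G')"
    unfolding presentsD(6)[OF p] presentsD(6)[OF p'] image_image[of "(`) \<phi>"]
    by (intro image_cong[OF refl] jj) blast
  have 3: "(`) ((`) \<phi>) ` vertex_classes G = vertex_classes G'"
    unfolding cpresentsD(4)[OF G] cpresentsD(4)[OF G'] image_image[of "(`) ((`) \<phi>)"]
  proof (rule image_cong[OF refl])
    fix C assume "C \<in> PV"
    then have "C \<subseteq> \<V>" using cpresentsD(2)[OF G] by blast
    then show "(`) \<phi> ` \<delta> ` C = \<delta>' ` C"
      unfolding image_image[of "(`) \<phi>"] using \<phi>(2) by (intro image_cong[OF refl]) blast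
  qed
  have 4: "(`) ((`) \<phi>) ` boundary_classes G = boundary_classes G'"
    unfolding cpresentsD(5)[OF G] cpresentsD(5)[OF G'] image_image[of "(`) ((`) \<phi>)"]
  proof (rule image_cong[OF refl])
    fix C assume C: "C \<in> PB"
    show "(`) \<phi> ` (`) j ` C = (`) j' ` C"
      unfolding image_image[of "(`) \<phi>"]
    proof (intro image_cong[OF refl] jj)
      fix c assume "c \<in> C"
      then have "c \<in> boundary_circles X \<V> \<E>" using C cpresentsD(3)[OF G] by blast
      then show "c \<subseteq> \<Union>\<V> \<union> \<Union>\<E>" by (rule boundary_circle_subset[OF presentsD(1)[OF p]])
    qed
  qed
  show ?thesis unfolding equivalent_def using \<phi>(1) 1 2 3 4 by blast
qed

text \<open>\<open>PV\<close> and \<open>PB\<close> change places. By the involution the old vertex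
  circles are the boundary circles of the dual, which makes the colouring defined by
  \<open>cdual\<close> through rims the right one.\<close>

lemma cpresents_dual:
  assumes G: "cpresents X j \<V> \<E> PV PB \<delta> G"
  shows "\<exists>\<delta>'. cpresents X (Base \<circ> j) (boundary_circles X \<V> \<E>) \<E> PB PV \<delta>' (cdual G)"
proof -
  note p = cpresentsD(1)[OF G]
  note sk = presentsD(1)[OF p]
  let ?C = "boundary_circles X \<V> \<E>" and ?Y = "surface (underlying G)"
  define \<delta>' where "\<delta>' = (\<lambda>c. if c \<in> ?C then glued_disc ?Y (j ` c) else Base ` \<delta> c)"
  have u: "underlying (cdual G) = geometric_dual (underlying G)"
    and v: "vertex_classes (cdual G) = (`) (glued_disc ?Y) ` boundary_classes G"
    and b: "boundary_classes (cdual G) = (`) (\<lambda>v. Base ` rim ?Y v) ` vertex_classes G"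
    by (simp_all add: cdual_def Let_def rim_def)
  have "presents X (Base \<circ> j) ?C \<E> \<delta>' (underlying (cdual G))"
    unfolding u \<delta>'_def by (rule presents_dual[OF p])
  moreover have "\<Union>PV \<subseteq> boundary_circles X ?C \<E>"
    unfolding boundary_circles_involution[OF sk] by (rule cpresentsD(2)[OF G])
  moreover have "vertex_classes (cdual G) = (`) \<delta>' ` PB"
    unfolding v cpresentsD(5)[OF G] image_image[of "(`) (glued_disc ?Y)"]
  proof (rule image_cong[OF refl])
    fix C assume C: "C \<in> PB"
    then have "c \<in> ?C" if "c \<in> C" for c using cpresentsD(3)[OF G] that by blast
    then show "glued_disc ?Y ` (`) j ` C = \<delta>' ` C"
      unfolding image_image[of "glued_disc ?Y"] by (intro image_cong) (auto simp: \<delta>'_def)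
  qed
  moreover have "boundary_classes (cdual G) = (`) ((`) (Base \<circ> j)) ` PV"
    unfolding b cpresentsD(4)[OF G] image_image[of "(`) (\<lambda>v. Base ` rim ?Y v)"]
  proof (rule image_cong[OF refl])
    fix C assume C: "C \<in> PV"
    then have "rim ?Y (\<delta> c) = j ` c" if "c \<in> C" for c
      using presentsD(9)[OF p] cpresentsD(2)[OF G] that by blast
    then show "(\<lambda>v. Base ` rim ?Y v) ` \<delta> ` C = (`) (Base \<circ> j) ` C"
      unfolding image_image[of "\<lambda>v. Base ` rim ?Y v"] by (intro image_cong) (auto simp: image_comp)
  qed
  ultimately show ?thesis using cpresentsD(3)[OF G] unfolding cpresents_def by blast
qed

text \<open>Kept elements are renamed by \<open>f\<close> and new ones by \<open>g\<close>, two
  different maps in a contraction: kept vertices are copied by \<open>Base\<close>, new ones are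
  glued discs. The single map \<open>h\<close> agrees with each where it matters, and injectivity of
  \<open>f\<close> preserves which classes meet \<open>M\<close>.\<close>

lemma recolour_image:
  assumes inj: "inj_on f A" and P: "\<Union>P \<subseteq> A" and M: "M \<subseteq> A"
    and hf: "\<And>c. c \<in> A - M \<Longrightarrow> h c = f c" and hg: "\<And>c. c \<in> N \<Longrightarrow> h c = g c"
  shows "recolour ((`) f ` P) (f ` M) (g ` N) = (`) h ` recolour P M N"
proof -
  have emp: "f ` C \<inter> f ` M = {} \<longleftrightarrow> C \<inter> M = {}" if "C \<in> P" for C
    using image_Int_empty_iff[OF inj _ M] that P by blast
  have hC: "h ` C = f ` C" if "C \<subseteq> A - M" for C
    using hf that by (intro image_cong) auto
  have 1: "{C \<in> (`) f ` P. C \<inter> f ` M = {}} = (`) h ` {C \<in> P. C \<inter> M = {}}"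
  proof -
    have "{C \<in> (`) f ` P. C \<inter> f ` M = {}} = (`) f ` {C \<in> P. C \<inter> M = {}}" using emp by blast
    also have "\<dots> = (`) h ` {C \<in> P. C \<inter> M = {}}"
    proof (rule image_cong[OF refl])
      fix C assume "C \<in> {C \<in> P. C \<inter> M = {}}"
      then have "C \<subseteq> A - M" using P by blast
      then show "f ` C = h ` C" using hC by simp
    qed
    finally show ?thesis .
  qed
  let ?U = "\<Union>{C \<in> P. C \<inter> M \<noteq> {}}"
  have U: "?U \<subseteq> A" using P by blast
  have "{C \<in> (`) f ` P. C \<inter> f ` M \<noteq> {}} = (`) f ` {C \<in> P. f ` C \<inter> f ` M \<noteq> {}}" by blast
  also have "{C \<in> P. f ` C \<inter> f ` M \<noteq> {}} = {C \<in> P. C \<inter> M \<noteq> {}}"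
    using emp by (intro Collect_cong conj_cong) simp_all
  finally have "\<Union>{C \<in> (`) f ` P. C \<inter> f ` M \<noteq> {}} = f ` ?U" by (simp only: image_Union)
  then have "\<Union>{C \<in> (`) f ` P. C \<inter> f ` M \<noteq> {}} - f ` M = f ` (?U - M)"
    using inj_on_image_set_diff[OF inj order_trans[OF Diff_subset U] M] by (simp only:)
  also have "\<dots> = h ` (?U - M)" using hC[of "?U - M"] U by blast
  finally have U': "\<Union>{C \<in> (`) f ` P. C \<inter> f ` M \<noteq> {}} - f ` M = h ` (?U - M)" .
  have "h ` N = g ` N" using hg by (intro image_cong) auto
  then have 2: "(\<Union>{C \<in> (`) f ` P. C \<inter> f ` M \<noteq> {}} - f ` M) \<union> g ` N = h ` ((?U - M) \<union> N)"
    by (simp only: U' image_Un)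
  show ?thesis unfolding recolour_def 1 2 by simp
qed

lemma Union_recolour: "\<Union>(recolour P M N) \<subseteq> (\<Union>P - M) \<union> N"
  unfolding recolour_def by blast

text \<open>The recolouring takes place on circles, before any disc is considered. A new circle
  meets \<open>e\<close> and a kept one does not, so \<delta>' is unambiguous.\<close>

lemma cpresents_contract:
  assumes G: "cpresents X j \<V> \<E> PV PB \<delta> G" and e: "e \<in> \<E>"
  shows "\<exists>\<delta>'. cpresents X (Base \<circ> j) ((\<V> - circles_meeting \<V> e) \<union> new_circles X \<V> e) (\<E> - {e})
    (recolour PV (circles_meeting \<V> e) (new_circles X \<V> e)) PB \<delta>' (ccontract G (j ` e))"
proof -
  note p = cpresentsD(1)[OF G]
  note sk = presentsD(1)[OF p]
  let ?M = "circles_meeting \<V> e" and ?N = "new_circles X \<V> e" and ?H = "underlying G"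
  let ?g = "\<lambda>c. glued_disc (surface ?H) (j ` c)" and ?f = "\<lambda>c. Base ` \<delta> c"
  define \<delta>' where "\<delta>' = (\<lambda>c. if c \<in> ?N then ?g c else ?f c)"
  have u: "underlying (ccontract G (j ` e)) = contract_edge ?H (j ` e)"
    and v: "vertex_classes (ccontract G (j ` e)) = recolour (base_classes (vertex_classes G))
      ((`) Base ` ends ?H (j ` e)) (glued_disc (surface ?H) ` contraction_curves ?H (j ` e))"
    and b: "boundary_classes (ccontract G (j ` e)) = base_classes (boundary_classes G)"
    by (simp_all add: ccontract_def Let_def)
  have 1: "presents X (Base \<circ> j) ((\<V> - ?M) \<union> ?N) (\<E> - {e}) \<delta>' (underlying (ccontract G (j ` e)))"
    unfolding u \<delta>'_def by (rule presents_contract[OF p e])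
  have 2: "\<Union>(recolour PV ?M ?N) \<subseteq> (\<V> - ?M) \<union> ?N"
    using Union_recolour[of PV ?M ?N] cpresentsD(2)[OF G] by blast
  have 3: "\<Union>PB \<subseteq> boundary_circles X ((\<V> - ?M) \<union> ?N) (\<E> - {e})"
    unfolding skeleton_contract(2)[OF sk e] by (rule cpresentsD(3)[OF G])
  have "?f c \<noteq> ?f d" if "c \<in> \<V>" "d \<in> \<V>" "c \<noteq> d" for c d
  proof -
    have "c \<noteq> {}" using skeletonD(2)[OF sk] that(1) circle_in_nonempty unfolding circles_def by blast
    then have "\<delta> c \<noteq> {}" using presentsD(10)[OF p that(1)] by blast
    then show ?thesis using presentsD(11)[OF p that] by auto
  qed
  then have inj: "inj_on ?f \<V>" by (meson inj_onI)
  have bc: "base_classes (vertex_classes G) = (`) ?f ` PV"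
    unfolding base_classes_def cpresentsD(4)[OF G] image_image by (simp add: image_image)
  have "ends ?H (j ` e) = \<delta> ` ?M" by (rule presents_ends[OF p e])
  then have en: "(`) Base ` ends ?H (j ` e) = ?f ` ?M" by (simp add: image_image)
  have cc: "glued_disc (surface ?H) ` contraction_curves ?H (j ` e) = ?g ` ?N"
    unfolding presents_contraction_curves[OF p e] by (simp add: image_image)
  have 4: "vertex_classes (ccontract G (j ` e)) = (`) \<delta>' ` recolour PV ?M ?N"
    unfolding v bc en cc
  proof (rule recolour_image[OF inj cpresentsD(2)[OF G]])
    show "?M \<subseteq> \<V>" unfolding circles_meeting_def by blast
    show "\<delta>' c = ?f c" if "c \<in> \<V> - ?M" for c
      using new_circle_meets[OF sk e, of c] that unfolding \<delta>'_def circles_meeting_def by auto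
    show "\<delta>' c = ?g c" if "c \<in> ?N" for c using that by (simp add: \<delta>'_def)
  qed
  have 5: "boundary_classes (ccontract G (j ` e)) = (`) ((`) (Base \<circ> j)) ` PB"
    unfolding b base_classes_def cpresentsD(5)[OF G] image_image by (simp add: image_image)
  show ?thesis unfolding cpresents_def using 1 2 3 4 5 by blast
qed

text \<open>The recolouring data are those of a contraction of \<open>e\<close> in the dual
  skeleton. This coincidence makes the colourings in the last two claims agree.\<close>

lemma cpresents_delete:
  assumes G: "cpresents X j \<V> \<E> PV PB \<delta> G" and e: "e \<in> \<E>"
  shows "cpresents X j \<V> (\<E> - {e}) PV
    (recolour PB (circles_meeting (boundary_circles X \<V> \<E>) e) (new_circles X (boundary_circles X \<V> \<E>) e))
    \<delta> (cdelete G (j ` e))"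
proof -
  note p = cpresentsD(1)[OF G]
  note sk = presentsD(1)[OF p] and inj = presentsD(4)[OF p]
  let ?B = "boundary_circles X \<V> \<E>" and ?B' = "boundary_circles X \<V> (\<E> - {e})" and ?H = "underlying G"
  let ?K = "\<Union>\<V> \<union> \<Union>\<E>"
  note skB = skeleton_boundary_circles[OF sk]
  \<comment> \<open>\<open>boundary_circles_delete\<close> for the dual skeleton, whose own boundary
    circles are \<V> again.\<close>
  have B': "?B' = (?B - circles_meeting ?B e) \<union> new_circles X ?B e" "circles_meeting ?B' e = new_circles X ?B e"
    using boundary_circles_delete[OF skB e] unfolding boundary_circles_involution[OF sk] by auto
  have u: "underlying (cdelete G (j ` e)) = delete_edge ?H (j ` e)"
    and v: "vertex_classes (cdelete G (j ` e)) = vertex_classes G"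
    and b: "boundary_classes (cdelete G (j ` e)) = recolour (boundary_classes G)
            {a \<in> boundary_components ?H. a \<inter> j ` e \<noteq> {}}
            {r \<in> boundary_components (delete_edge ?H (j ` e)). r \<inter> j ` e \<noteq> {}}"
    by (simp_all add: cdelete_def Let_def)
  note pd = presents_delete[OF p e]
  have 1: "presents X j \<V> (\<E> - {e}) \<delta> (underlying (cdelete G (j ` e)))" unfolding u by (rule pd)
  have BK: "c \<subseteq> ?K" if "c \<in> ?B" for c by (rule boundary_circle_subset[OF sk that])
  have BK': "c \<subseteq> ?K" if "c \<in> ?B'" for c
    using boundary_circle_subset[OF presentsD(1)[OF pd] that] by blast
  have jm: "j ` c \<inter> j ` e = {} \<longleftrightarrow> c \<inter> e = {}" if "c \<subseteq> ?K" for c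
    by (rule image_Int_empty_iff[OF inj that]) (use e in blast)
  have old: "{a \<in> boundary_components ?H. a \<inter> j ` e \<noteq> {}} = (`) j ` circles_meeting ?B e"
    unfolding presents_boundary_components[OF p] circles_meeting_def using jm[OF BK] by blast
  have new: "{r \<in> boundary_components (delete_edge ?H (j ` e)). r \<inter> j ` e \<noteq> {}} = (`) j ` new_circles X ?B e"
    unfolding presents_boundary_components[OF pd] B'(2)[symmetric] circles_meeting_def using jm[OF BK'] by blast
  have 2: "\<Union>(recolour PB (circles_meeting ?B e) (new_circles X ?B e)) \<subseteq> ?B'"
    using Union_recolour[of PB] cpresentsD(3)[OF G] unfolding B'(1) by blast
  have "inj_on ((`) j) (Pow ?K)" using inj by (rule inj_on_image_Pow)
  then have injB: "inj_on ((`) j) ?B" by (rule inj_on_subset) (use BK in blast)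
  have 3: "boundary_classes (cdelete G (j ` e)) =
      (`) ((`) j) ` recolour PB (circles_meeting ?B e) (new_circles X ?B e)"
    unfolding b cpresentsD(5)[OF G] old new
    by (rule recolour_image[OF injB cpresentsD(3)[OF G]]) (auto simp: circles_meeting_def)
  show ?thesis
    unfolding cpresents_def using 1 2 3 cpresentsD(2,4)[OF G] v by simp
qed

section \<open>From a ribbon graph to its skeleton\<close>

lemma ribbon_graphD:
  assumes "is_ribbon_graph H"
  shows "Hausdorff_space (surface H)" "finite (vertices H)" "finite (edges H)"
    "topspace (surface H) = \<Union>(vertices H) \<union> \<Union>(edges H)"
    "v \<in> vertices H \<Longrightarrow> closed_disc_in (surface H) v" "e \<in> edges H \<Longrightarrow> closed_disc_in (surface H) e"
    "pairwise disjnt (vertices H)" "pairwise disjnt (edges H)"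
    "s \<in> segments H \<Longrightarrow> line_segment_in (surface H) s"
    "s \<in> segments H \<Longrightarrow> \<exists>v. v \<in> vertices H \<and> s \<subseteq> rim (surface H) v"
    "s \<in> segments H \<Longrightarrow> \<exists>e. e \<in> edges H \<and> s \<subseteq> rim (surface H) e"
    "e \<in> edges H \<Longrightarrow> card {s \<in> segments H. s \<subseteq> e} = 2"
proof -
  note * = assms[unfolded is_ribbon_graph_def surface_with_boundary_def, folded rim_def]
  have seg: "\<forall>s\<in>segments H. line_segment_in (surface H) s \<and>
        (\<exists>!v. v \<in> vertices H \<and> s \<subseteq> rim (surface H) v) \<and> (\<exists>!e. e \<in> edges H \<and> s \<subseteq> rim (surface H) e)"
    using * by (elim conjE)
  show "s \<in> segments H \<Longrightarrow> line_segment_in (surface H) s" using seg by simp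
  show "s \<in> segments H \<Longrightarrow> \<exists>v. v \<in> vertices H \<and> s \<subseteq> rim (surface H) v" using seg by (meson ex1_implies_ex)
  show "s \<in> segments H \<Longrightarrow> \<exists>e. e \<in> edges H \<and> s \<subseteq> rim (surface H) e" using seg by (meson ex1_implies_ex)
  show "Hausdorff_space (surface H)" "finite (vertices H)" "finite (edges H)"
    "topspace (surface H) = \<Union>(vertices H) \<union> \<Union>(edges H)"
    "pairwise disjnt (vertices H)" "pairwise disjnt (edges H)"
    using * by auto
  show "v \<in> vertices H \<Longrightarrow> closed_disc_in (surface H) v" "e \<in> edges H \<Longrightarrow> closed_disc_in (surface H) e"
    "e \<in> edges H \<Longrightarrow> card {s \<in> segments H. s \<subseteq> e} = 2"
    using * by auto
qed

lemma ribbon_graph_segments: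
  assumes H: "is_ribbon_graph H" and v: "v \<in> vertices H" and e: "e \<in> edges H" and x: "x \<in> v" "x \<in> e"
  shows "\<exists>s\<in>segments H. x \<in> s \<and> s \<subseteq> v \<inter> e"
proof -
  let ?T = "subtopology (surface H) (v \<inter> e)"
  have "v \<subseteq> topspace (surface H)" using ribbon_graphD(5)[OF H v] by (simp add: closed_disc_in_def)
  then have "x \<in> topspace ?T" using x by auto
  then have "x \<in> \<Union>(connected_components_of ?T)" by (simp only: Union_connected_components_of)
  then obtain s where s: "s \<in> connected_components_of ?T" "x \<in> s" by blast
  have "s \<subseteq> v \<inter> e" using connected_components_of_subset[OF s(1)] by auto
  moreover have "s \<in> segments H" unfolding segments_def using v e s(1) by blast
  ultimately show ?thesis using s(2) by blast
qed

text \<open>A segment lies on the rim of some vertex and of some edge; since it is nonempty and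
  vertices are disjoint, as are edges, these are the ones that contain it.\<close>

lemma segment_in_rim:
  assumes H: "is_ribbon_graph H" and s: "s \<in> segments H"
  shows "s \<noteq> {}" "v \<in> vertices H \<Longrightarrow> s \<subseteq> v \<Longrightarrow> s \<subseteq> rim (surface H) v"
    "e \<in> edges H \<Longrightarrow> s \<subseteq> e \<Longrightarrow> s \<subseteq> rim (surface H) e"
proof -
  obtain a b where "arc_from (surface H) s a b"
    using ribbon_graphD(9)[OF H s] line_segment_in_iff_arc_from[OF ribbon_graphD(1)[OF H]] by blast
  then have "a \<in> s" by (rule arc_from_ends)
  then show ne: "s \<noteq> {}" by blast
  show "s \<subseteq> rim (surface H) v" if v: "v \<in> vertices H" "s \<subseteq> v"
  proof -
    obtain w where w: "w \<in> vertices H" "s \<subseteq> rim (surface H) w" using ribbon_graphD(10)[OF H s] by blast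
    then have "s \<subseteq> w" using rim_subset[of "surface H" w] by blast
    then have "v = w" using ribbon_graphD(7)[OF H] v w(1) ne unfolding pairwise_def disjnt_def by blast
    then show ?thesis using w by simp
  qed
  show "s \<subseteq> rim (surface H) e" if e: "e \<in> edges H" "s \<subseteq> e"
  proof -
    obtain f where f: "f \<in> edges H" "s \<subseteq> rim (surface H) f" using ribbon_graphD(11)[OF H s] by blast
    then have "s \<subseteq> f" using rim_subset[of "surface H" f] by blast
    then have "e = f" using ribbon_graphD(8)[OF H] e f(1) ne unfolding pairwise_def disjnt_def by blast
    then show ?thesis using f by simp
  qed
qed

lemma vertex_edge_in_rim:
  assumes H: "is_ribbon_graph H" and v: "v \<in> vertices H" and e: "e \<in> edges H"
  shows "v \<inter> e \<subseteq> rim (surface H) v"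
  using ribbon_graph_segments[OF H v e] segment_in_rim(2)[OF H _ v] by blast

lemma rim_circle_in:
  assumes "Hausdorff_space X" "closed_disc_in X D"
  shows "circle_in X (rim X D)"
proof -
  obtain d where d: "parametrizes X (cball (0::complex) 1) d D"
    using assms closed_disc_in_iff_parametrizes by blast
  have "parametrizes X (sphere (0::complex) 1) d (d ` sphere 0 1)"
    by (rule parametrizes_subset[OF d]) auto
  then show ?thesis
    unfolding circle_in_def rim_def surface_boundary_disc[OF assms(1) d] by blast
qed

lemma segments_disjoint:
  assumes H: "is_ribbon_graph H" and s: "s \<in> segments H" "t \<in> segments H" "s \<noteq> t"
  shows "s \<inter> t = {}"
proof (rule ccontr)
  assume "s \<inter> t \<noteq> {}"
  then obtain x where x: "x \<in> s" "x \<in> t" by blast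
  obtain v e where ve: "v \<in> vertices H" "e \<in> edges H" "s \<in> connected_components_of (subtopology (surface H) (v \<inter> e))"
    using s(1) unfolding segments_def by blast
  obtain w f where wf: "w \<in> vertices H" "f \<in> edges H" "t \<in> connected_components_of (subtopology (surface H) (w \<inter> f))"
    using s(2) unfolding segments_def by blast
  have "s \<subseteq> v \<inter> e" "t \<subseteq> w \<inter> f"
    using connected_components_of_subset[OF ve(3)] connected_components_of_subset[OF wf(3)] by auto
  then have "v = w" "e = f"
    using ribbon_graphD(7,8)[OF H] ve wf x unfolding pairwise_def disjnt_def by blast+
  then have "s = t" using connected_components_of_overlap[of s _ t] ve(3) wf(3) x by blast
  then show False using s(3) by blast
qed

text \<open>The two segments counted for an edge are disjoint arcs of its rim, so they are opposite
  arcs of a cut into four. The vertex circles meet the edge nowhere else because every common point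
  of a vertex and an edge lies in a segment.\<close>

lemma ribbon_graph_skeleton:
  assumes H: "is_ribbon_graph H"
  shows "skeleton (surface H) (rim (surface H) ` vertices H) (edges H)"
proof -
  let ?X = "surface H" and ?V = "rim (surface H) ` vertices H"
  note X = ribbon_graphD(1)[OF H]
  have "rim ?X v \<inter> rim ?X w = {}" if "v \<in> vertices H" "w \<in> vertices H" "v \<noteq> w" for v w
    using ribbon_graphD(7)[OF H] that rim_subset[of ?X v] rim_subset[of ?X w]
    unfolding pairwise_def disjnt_def by blast
  then have "pairwise disjnt ?V" unfolding pairwise_def disjnt_def by blast
  then have circ: "circles ?X ?V"
    unfolding circles_def using ribbon_graphD(2)[OF H] rim_circle_in[OF X ribbon_graphD(5)[OF H]] by blast
  have "attached ?X (\<Union>?V) e" if e: "e \<in> edges H" for e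
  proof -
    obtain s t where st: "{u \<in> segments H. u \<subseteq> e} = {s, t}" "s \<noteq> t"
      using ribbon_graphD(12)[OF H e] by (auto simp: card_2_iff)
    have s: "s \<in> segments H" "s \<subseteq> e" and t: "t \<in> segments H" "t \<subseteq> e" using st(1) by blast+
    have "s \<inter> t = {}" by (rule segments_disjoint[OF H s(1) t(1) st(2)])
    obtain a b where a: "arc_from ?X s a b"
      using ribbon_graphD(9)[OF H s(1)] line_segment_in_iff_arc_from[OF X] by blast
    obtain a' b' where a': "arc_from ?X t a' b'"
      using ribbon_graphD(9)[OF H t(1)] line_segment_in_iff_arc_from[OF X] by blast
    have rims: "s \<subseteq> rim ?X e" "t \<subseteq> rim ?X e"
      using segment_in_rim(3)[OF H s(1) e s(2)] segment_in_rim(3)[OF H t(1) e t(2)] .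
    obtain p0 p1 p2 p3 t1 t2 where c: "cyclic_arcs ?X s p1 t1 p2 t p3 t2 p0" "rim ?X e = s \<union> t1 \<union> t \<union> t2"
      using cut_circle_two[OF X rim_circle_in[OF X ribbon_graphD(6)[OF H e]] a rims(1) a' rims(2) \<open>s \<inter> t = {}\<close>]
      by (elim exE conjE)
    have "\<Union>?V \<inter> e = s \<union> t"
    proof (intro equalityI subsetI)
      fix x assume "x \<in> \<Union>?V \<inter> e"
      then obtain v where v: "v \<in> vertices H" "x \<in> v" "x \<in> e" using rim_subset[of ?X] by blast
      then obtain u where "u \<in> segments H" "x \<in> u" "u \<subseteq> v \<inter> e" using ribbon_graph_segments[OF H v(1) e] by blast
      then show "x \<in> s \<union> t" using st(1) by blast
    next
      fix x assume x: "x \<in> s \<union> t"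
      obtain v where "v \<in> vertices H" "s \<subseteq> rim ?X v" using ribbon_graphD(10)[OF H s(1)] by blast
      moreover obtain w where "w \<in> vertices H" "t \<subseteq> rim ?X w" using ribbon_graphD(10)[OF H t(1)] by blast
      ultimately show "x \<in> \<Union>?V \<inter> e" using x s(2) t(2) by blast
    qed
    then show ?thesis unfolding attached_def using c by blast
  qed
  then show ?thesis
    unfolding skeleton_def using X circ ribbon_graphD(3,6,8)[OF H] by blast
qed

text \<open>The starting point of all presentations: the skeleton lies in the surface of
  \<open>G\<close> itself, embedded by the identity.\<close>

lemma coloured_ribbon_graph_cpresents:
  assumes G: "is_coloured_ribbon_graph G"
  shows "\<exists>X \<V> PV PB \<delta>. cpresents X id \<V> (edges (underlying G)) PV PB \<delta> G"
proof -
  let ?H = "underlying G"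
  let ?X = "surface ?H"
  let ?r = "rim ?X"
  let ?V = "?r ` vertices ?H"
  have H: "is_ribbon_graph ?H" and PV: "partition_on (vertices ?H) (vertex_classes G)"
    and PB: "partition_on (boundary_components ?H) (boundary_classes G)"
    using G by (auto simp: is_coloured_ribbon_graph_def)
  note X = ribbon_graphD(1)[OF H]
  have ne: "?r v \<noteq> {}" if "v \<in> vertices ?H" for v
    using circle_in_nonempty[OF rim_circle_in[OF X ribbon_graphD(5)[OF H that]]] .
  have dis: "v \<inter> w = {}" if "v \<in> vertices ?H" "w \<in> vertices ?H" "v \<noteq> w" for v w
    using ribbon_graphD(7)[OF H] that unfolding pairwise_def disjnt_def by blast
  have inj: "inj_on ?r (vertices ?H)"
  proof (rule inj_onI)
    fix v w assume vw: "v \<in> vertices ?H" "w \<in> vertices ?H" "?r v = ?r w"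
    then show "v = w" using ne[OF vw(1)] dis[OF vw(1,2)] rim_subset[of ?X v] rim_subset[of ?X w] by blast
  qed
  \<comment> \<open>A vertex is recovered from its boundary circle, since rims are nonempty subsets
    of disjoint vertices.\<close>
  define \<delta> where "\<delta> = inv_into (vertices ?H) ?r"
  have \<delta>: "\<delta> (?r v) = v" if "v \<in> vertices ?H" for v
    unfolding \<delta>_def by (rule inv_into_f_f[OF inj that])
  let ?K = "\<Union>?V \<union> \<Union>(edges ?H)"
  have im: "vertices ?H = \<delta> ` ?V" unfolding image_image using \<delta> by simp
  have KX: "?K \<subseteq> topspace ?X"
    unfolding ribbon_graphD(4)[OF H] using rim_subset[of ?X] by blast
  have vK: "v \<inter> ?K = ?r v" if v: "v \<in> vertices ?H" for v
  proof
    have "v \<inter> ?r w \<subseteq> ?r v" if "w \<in> vertices ?H" for w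
      using dis[OF v that] rim_subset[of ?X w] by (cases "v = w") auto
    moreover have "v \<inter> e \<subseteq> ?r v" if "e \<in> edges ?H" for e by (rule vertex_edge_in_rim[OF H v that])
    ultimately show "v \<inter> ?K \<subseteq> ?r v" by blast
    show "?r v \<subseteq> v \<inter> ?K" using rim_subset[of ?X v] v by blast
  qed
  have p: "presents ?X id ?V (edges ?H) \<delta> ?H"
    unfolding presents_def
  proof (intro conjI)
    show "skeleton ?X ?V (edges ?H)" by (rule ribbon_graph_skeleton[OF H])
    show "Hausdorff_space ?X" by (rule X)
    show "continuous_map (subtopology ?X ?K) ?X id"
      by (rule continuous_map_from_subtopology[OF continuous_map_id])
    show "inj_on id ?K" by simp
    show "vertices ?H = \<delta> ` ?V" by (rule im)
    show "edges ?H = (`) id ` edges ?H" by simp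
    show "topspace ?X = \<Union>(\<delta> ` ?V) \<union> id ` \<Union>(edges ?H)"
      unfolding im[symmetric] using ribbon_graphD(4)[OF H] by simp
    show "\<forall>c\<in>?V. closed_disc_in ?X (\<delta> c) \<and> ?r (\<delta> c) = id ` c \<and> \<delta> c \<inter> id ` ?K = id ` c"
    proof
      fix c assume "c \<in> ?V"
      then obtain v where v: "v \<in> vertices ?H" "c = ?r v" by blast
      show "closed_disc_in ?X (\<delta> c) \<and> ?r (\<delta> c) = id ` c \<and> \<delta> c \<inter> id ` ?K = id ` c"
        unfolding v(2) \<delta>[OF v(1)] using ribbon_graphD(5)[OF H v(1)] vK[OF v(1)] by simp
    qed
    show "\<forall>c\<in>?V. \<forall>c'\<in>?V. c \<noteq> c' \<longrightarrow> \<delta> c \<inter> \<delta> c' = {}"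
    proof (intro ballI impI)
      fix c c' assume "c \<in> ?V" "c' \<in> ?V" "c \<noteq> c'"
      then obtain v w where "v \<in> vertices ?H" "c = ?r v" "w \<in> vertices ?H" "c' = ?r w" "v \<noteq> w" by blast
      then show "\<delta> c \<inter> \<delta> c' = {}" using \<delta> dis by simp
    qed
  qed
  have bc: "boundary_components ?H = boundary_circles ?X ?V (edges ?H)"
    using presents_boundary_components[OF p] by simp
  have UV: "\<Union>(vertex_classes G) = vertices ?H" and UB: "\<Union>(boundary_classes G) = boundary_components ?H"
    using PV PB by (auto simp: partition_on_def)
  have "cpresents ?X id ?V (edges ?H) ((`) ?r ` vertex_classes G) (boundary_classes G) \<delta> G"
    unfolding cpresents_def
  proof (intro conjI)
    show "presents ?X id ?V (edges ?H) \<delta> ?H" by (rule p)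
    show "\<Union>((`) ?r ` vertex_classes G) \<subseteq> ?V" using UV by blast
    show "\<Union>(boundary_classes G) \<subseteq> boundary_circles ?X ?V (edges ?H)" using UB bc by simp
    have "\<delta> ` ?r ` C = C" if "C \<in> vertex_classes G" for C
    proof -
      have "\<delta> (?r v) = v" if "v \<in> C" for v using \<delta> UV that \<open>C \<in> vertex_classes G\<close> by blast
      then show ?thesis unfolding image_image by simp
    qed
    then show "vertex_classes G = (`) \<delta> ` (`) ?r ` vertex_classes G" unfolding image_image[of "(`) \<delta>"] by simp
    show "boundary_classes G = (`) ((`) id) ` boundary_classes G" by simp
  qed
  then show ?thesis by blast
qed

theorem theorem2p20:
  fixes G :: "'a coloured_ribbon_graph" and e :: "'a set"
  assumes "is_coloured_ribbon_graph G"
    and "e \<in> edges (underlying G)"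
  shows "cdual (cdual G) \<cong>\<^sub>c G \<and>
         cdual (ccontract G e) \<cong>\<^sub>c cdelete (cdual G) (Base ` e) \<and>
         cdual (cdelete G e) \<cong>\<^sub>c ccontract (cdual G) (Base ` e)"
proof (intro conjI)
  define \<E> where "\<E> = edges (underlying G)"
  have e: "e \<in> \<E>" using assms(2) by (simp add: \<E>_def)
  obtain X \<V> PV PB \<delta> where G: "cpresents X id \<V> \<E> PV PB \<delta> G"
    using coloured_ribbon_graph_cpresents[OF assms(1)] unfolding \<E>_def by (elim exE)
  note sk = presentsD(1)[OF cpresentsD(1)[OF G]]
  note skB = skeleton_boundary_circles[OF sk]
  let ?B = "boundary_circles X \<V> \<E>"
  obtain \<delta>1 where D: "cpresents X (Base \<circ> id) ?B \<E> PB PV \<delta>1 (cdual G)"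
    using cpresents_dual[OF G] by (rule exE)
  \<comment> \<open>The involution returns the original circles and classes, now embedded by a
    double \<open>Base\<close>.\<close>
  obtain \<delta>2 where DD: "cpresents X (Base \<circ> (Base \<circ> id)) \<V> \<E> PV PB \<delta>2 (cdual (cdual G))"
    using cpresents_dual[OF D] unfolding boundary_circles_involution[OF sk] by (rule exE)
  show "cdual (cdual G) \<cong>\<^sub>c G" by (rule cpresents_equivalent[OF DD G])
  have ide: "id ` e = e" "(Base \<circ> id) ` e = Base ` e" by simp_all
  obtain \<delta>3 where "cpresents X (Base \<circ> id) ((\<V> - circles_meeting \<V> e) \<union> new_circles X \<V> e) (\<E> - {e})
      (recolour PV (circles_meeting \<V> e) (new_circles X \<V> e)) PB \<delta>3 (ccontract G e)"
    using cpresents_contract[OF G e] unfolding ide by (rule exE)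
  \<comment> \<open>Contraction keeps the boundary circles, so those of \<open>G\<close> become the
    vertex circles of this dual.\<close>
  from cpresents_dual[OF this] obtain \<delta>4 where C: "cpresents X (Base \<circ> (Base \<circ> id)) ?B (\<E> - {e})
      PB (recolour PV (circles_meeting \<V> e) (new_circles X \<V> e)) \<delta>4 (cdual (ccontract G e))"
    unfolding skeleton_contract(2)[OF sk e] by (rule exE)
  \<comment> \<open>In the dual the boundary circles are \<V>, so deletion recolours
    \<open>PV\<close> with the very circles that contraction used.\<close>
  have "cpresents X (Base \<circ> id) ?B (\<E> - {e}) PB
      (recolour PV (circles_meeting \<V> e) (new_circles X \<V> e)) \<delta>1 (cdelete (cdual G) (Base ` e))"
    using cpresents_delete[OF D e] unfolding boundary_circles_involution[OF sk] ide .
  then show "cdual (ccontract G e) \<cong>\<^sub>c cdelete (cdual G) (Base ` e)"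
    by (rule cpresents_equivalent[OF C])
  have "cpresents X id \<V> (\<E> - {e}) PV (recolour PB (circles_meeting ?B e) (new_circles X ?B e)) \<delta> (cdelete G e)"
    using cpresents_delete[OF G e] unfolding ide .
  from cpresents_dual[OF this] obtain \<delta>5 where "cpresents X (Base \<circ> id) (boundary_circles X \<V> (\<E> - {e})) (\<E> - {e})
      (recolour PB (circles_meeting ?B e) (new_circles X ?B e)) PV \<delta>5 (cdual (cdelete G e))"
    by (rule exE)
  \<comment> \<open>Brings the vertex circles of the left side into the form that contraction
    produces from the dual skeleton.\<close>
  moreover have "boundary_circles X \<V> (\<E> - {e}) = (?B - circles_meeting ?B e) \<union> new_circles X ?B e"
    using boundary_circles_delete(1)[OF skB e] unfolding boundary_circles_involution[OF sk] .
  ultimately have L: "cpresents X (Base \<circ> id) ((?B - circles_meeting ?B e) \<union> new_circles X ?B e) (\<E> - {e})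
      (recolour PB (circles_meeting ?B e) (new_circles X ?B e)) PV \<delta>5 (cdual (cdelete G e))"
    by simp
  obtain \<delta>6 where "cpresents X (Base \<circ> (Base \<circ> id)) ((?B - circles_meeting ?B e) \<union> new_circles X ?B e) (\<E> - {e})
      (recolour PB (circles_meeting ?B e) (new_circles X ?B e)) PV \<delta>6 (ccontract (cdual G) (Base ` e))"
    using cpresents_contract[OF D e] unfolding ide by (rule exE)
  then show "cdual (cdelete G e) \<cong>\<^sub>c ccontract (cdual G) (Base ` e)"
    by (rule cpresents_equivalent[OF L])
qed

end
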